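(* Let $r, D\geq 2$ be integers, and let $H$ be a graph with maximum degree $D$. Let $\sigma: E(H)\to \mathbb{N}$ and let $H^\sigma$ be the subdivision of $H$ determined by $\sigma$, with $n=|V(H^\sigma)|$. Suppose that $\sigma(e)\geq 2\log_{D-1} n$ for every $e\in E(H)$, and suppose that $H^\sigma$ is bipartite. Then \[ \widehat{R}_r(H^\sigma)\leq r^{\,400 D\log D}\, n . \]
   Context: For a graph $H$ and a function $\sigma:E(H)\to\mathbb{N}$, the subdivision $H^\sigma$ is the graph obtained from $H$ by replacing every edge $e\in E(H)$ with a path of length $\sigma(e)$ (the internal vertices of these paths being new and distinct). For a positive integer $r$, the $r$-color size-Ramsey number $\widehat{R}_r(F)$ of a graph $F$ is the minimum number of edges of a graph $G$ such that every coloring of the edges of $G$ with $r$ colors contains a monochromatic copy of $F$. Here $\log$ denotes the natural logarithm and $\log_{D-1}$ the logarithm to base $D-1$.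
   Formalization: For D = 2 the logarithm to base D−1 = 1 is undefined; it is read as +∞ (its limit), so the condition on σ cannot hold and the theorem has content only for D ≥ 3, where it is as stated. *)

theory Defs
  imports Complex_Main "HOL-Library.Ramsey" "HOL-Library.Extended_Real"
begin

record 'a sgraph =
  verts :: "'a set"
  edges :: "'a set set"

definition finite_sgraph :: "'a sgraph \<Rightarrow> bool" where
  "finite_sgraph G \<longleftrightarrow> finite (verts G) \<and> edges G \<subseteq> [verts G]\<^bsup>2\<^esup>"

definition degree :: "'a sgraph \<Rightarrow> 'a \<Rightarrow> nat" where
  "degree G v = card {e \<in> edges G. v \<in> e}"

definition max_degree :: "'a sgraph \<Rightarrow> nat" where
  "max_degree G = (SUP v\<in>verts G. degree G v)"

definition bipartite :: "'a sgraph \<Rightarrow> bool" where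
  "bipartite G \<longleftrightarrow>
     (\<exists>A B. A \<union> B = verts G \<and> A \<inter> B = {} \<and> (\<forall>e\<in>edges G. \<exists>a\<in>A. \<exists>b\<in>B. e = {a, b}))"

text \<open>The two ends of an edge in an arbitrary but fixed order; a different choice of order gives
  an isomorphic subdivision.\<close>

definition end1 :: "'a set \<Rightarrow> 'a" where
  "end1 e = (SOME u. u \<in> e)"

definition end2 :: "'a set \<Rightarrow> 'a" where
  "end2 e = (SOME v. v \<in> e \<and> v \<noteq> end1 e)"

text \<open>The \<open>i\<close>-th vertex, \<open>0 \<le> i \<le> \<sigma> e\<close>, of the path replacing \<open>e\<close>.  The paths have length at
  least 1: the construction is meant for \<open>\<sigma> e > 0\<close>, and for \<open>\<sigma> e = 0\<close> it does not contract
  \<open>e\<close> but deletes it.\<close>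

definition subdiv_vertex :: "('a set \<Rightarrow> nat) \<Rightarrow> 'a set \<Rightarrow> nat \<Rightarrow> 'a + 'a set \<times> nat" where
  "subdiv_vertex \<sigma> e i =
     (if i = 0 then Inl (end1 e) else if i = \<sigma> e then Inl (end2 e) else Inr (e, i))"

definition subdivision :: "'a sgraph \<Rightarrow> ('a set \<Rightarrow> nat) \<Rightarrow> ('a + 'a set \<times> nat) sgraph" where
  "subdivision H \<sigma> =
     \<lparr>verts = Inl ` verts H \<union> {Inr (e, i) | e i. e \<in> edges H \<and> 0 < i \<and> i < \<sigma> e},
      edges = {{subdiv_vertex \<sigma> e i, subdiv_vertex \<sigma> e (Suc i)} | e i. e \<in> edges H \<and> i < \<sigma> e}\<rparr>"

text \<open>Copies are subgraphs, not necessarily induced.\<close>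

definition monochromatic_copy :: "'b sgraph \<Rightarrow> ('b set \<Rightarrow> nat) \<Rightarrow> nat \<Rightarrow> 'a sgraph \<Rightarrow> bool" where
  "monochromatic_copy G c k F \<longleftrightarrow>
     (\<exists>\<phi>. inj_on \<phi> (verts F) \<and> \<phi> ` verts F \<subseteq> verts G \<and>
          (\<forall>e\<in>edges F. \<phi> ` e \<in> edges G \<and> c (\<phi> ` e) = k))"

definition size_ramsey_host :: "nat \<Rightarrow> 'a sgraph \<Rightarrow> 'b sgraph \<Rightarrow> bool" where
  "size_ramsey_host r F G \<longleftrightarrow>
     finite_sgraph G \<and> (\<forall>c \<in> edges G \<rightarrow> {..<r}. \<exists>k<r. monochromatic_copy G c k F)"

text \<open>Every finite graph has an isomorphic copy on natural numbers, so it suffices to let the host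
  graph range over those.\<close>

definition size_ramsey :: "nat \<Rightarrow> 'a sgraph \<Rightarrow> nat" where
  "size_ramsey r F = (LEAST m. \<exists>G :: nat sgraph. size_ramsey_host r F G \<and> card (edges G) = m)"

text \<open>Logarithm to base \<open>b \<ge> 1\<close>.  For \<open>b = 1\<close> the library's real-valued \<^const>\<open>log\<close> is \<open>0\<close>, whereas the
  division of extended reals gives \<open>\<infinity>\<close> for \<open>x > 1\<close>, the limit for \<open>b\<close> tending to \<open>1\<close> from above.\<close>

definition elog :: "real \<Rightarrow> real \<Rightarrow> ereal" where
  "elog b x = ereal (ln x) / ereal (ln b)"

lemma elog_eq_log: "b > 1 \<Longrightarrow> elog b x = ereal (log b x)"
  by (simp add: elog_def log_def)

lemma elog_base_1: "x > 1 \<Longrightarrow> elog 1 x = \<infinity>"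
  by (simp add: elog_def divide_ereal_def)

lemma verts_edges_subdivision:
  "verts (subdivision H \<sigma>) = Inl ` verts H \<union> {Inr (e, i) | e i. e \<in> edges H \<and> 0 < i \<and> i < \<sigma> e}"
  "edges (subdivision H \<sigma>) =
     {{subdiv_vertex \<sigma> e i, subdiv_vertex \<sigma> e (Suc i)} | e i. e \<in> edges H \<and> i < \<sigma> e}"
  by (simp_all add: subdivision_def)

lemma end1_end2:
  assumes "e \<in> [V]\<^bsup>2\<^esup>"
  shows "e = {end1 e, end2 e}" "end1 e \<noteq> end2 e"
proof -
  obtain x y where xy: "e = {x, y}" "x \<noteq> y"
    using assms unfolding nsets_def mem_Collect_eq card_2_iff by blast
  have 1: "end1 e \<in> e"
    using someI[of "\<lambda>u. u \<in> e" x] by (simp add: end1_def xy(1))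
  have "\<exists>v. v \<in> e \<and> v \<noteq> end1 e"
    using xy by (metis insertCI)
  then have 2: "end2 e \<in> e \<and> end2 e \<noteq> end1 e"
    using someI_ex[of "\<lambda>v. v \<in> e \<and> v \<noteq> end1 e"] by (simp add: end2_def)
  show "e = {end1 e, end2 e}" "end1 e \<noteq> end2 e"
    using 1 2 xy by (metis insertE insert_commute singletonD)+
qed

lemma finite_sgraph_subdivision:
  assumes H: "finite_sgraph H"
  shows "finite_sgraph (subdivision H \<sigma>)"
proof -
  have fV: "finite (verts H)" and E: "edges H \<subseteq> [verts H]\<^bsup>2\<^esup>"
    using H by (auto simp: finite_sgraph_def)
  have fE: "finite (edges H)"
    using fV E finite_imp_finite_nsets finite_subset by metis
  have "{Inr (e, i) | e i. e \<in> edges H \<and> 0 < i \<and> i < \<sigma> e} \<subseteq> (Inr :: _ \<Rightarrow> 'a + 'a set \<times> nat) ` (SIGMA e:edges H. {..<\<sigma> e})"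
    by auto
  moreover have "finite (SIGMA e:edges H. {..<\<sigma> e})"
    using fE by blast
  ultimately have "finite {Inr (e, i) :: 'a + 'a set \<times> nat | e i. e \<in> edges H \<and> 0 < i \<and> i < \<sigma> e}"
    by (rule finite_subset[OF _ finite_imageI])
  then have fin: "finite (verts (subdivision H \<sigma>))"
    using fV by (simp only: verts_edges_subdivision finite_Un finite_imageI)
  have mem: "subdiv_vertex \<sigma> e i \<in> verts (subdivision H \<sigma>)" if "e \<in> edges H" "i \<le> \<sigma> e" for e i
  proof -
    have "e \<in> [verts H]\<^bsup>2\<^esup>" using E that by blast
    then have "end1 e \<in> verts H" "end2 e \<in> verts H"
      using end1_end2(1)[of e "verts H"] by (auto simp: nsets_def)
    then show ?thesis using that by (auto simp: subdiv_vertex_def verts_edges_subdivision)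
  qed
  have ne: "subdiv_vertex \<sigma> e i \<noteq> subdiv_vertex \<sigma> e (Suc i)" if "e \<in> edges H" for e i
    using end1_end2(2)[of e "verts H"] E that by (auto simp: subdiv_vertex_def)
  have "f \<in> [verts (subdivision H \<sigma>)]\<^bsup>2\<^esup>" if f: "f \<in> edges (subdivision H \<sigma>)" for f
  proof -
    obtain e i where ei: "e \<in> edges H" "i < \<sigma> e"
      and f: "f = {subdiv_vertex \<sigma> e i, subdiv_vertex \<sigma> e (Suc i)}"
      using f unfolding verts_edges_subdivision by blast
    show ?thesis
      using mem[of e i] mem[of e "Suc i"] ne[OF ei(1), of i] ei
      unfolding f nsets_def by simp
  qed
  with fin show ?thesis
    unfolding finite_sgraph_def by blast
qed

text \<open>By Ramsey's theorem, the set minimised over in \<^const>\<open>size_ramsey\<close> is nonempty.\<close>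

lemma size_ramsey_attained:
  assumes F: "finite_sgraph F"
  shows "\<exists>G :: nat sgraph. size_ramsey_host r F G \<and> card (edges G) = size_ramsey r F"
proof -
  obtain N :: nat where N: "partn_lst {..<N} (replicate r (card (verts F))) 2"
    using ramsey_full by blast
  define G :: "nat sgraph" where "G = \<lparr>verts = {..<N}, edges = [{..<N}]\<^bsup>2\<^esup>\<rparr>"
  have "\<exists>k<r. monochromatic_copy G c k F" if c: "c \<in> edges G \<rightarrow> {..<r}" for c
  proof -
    obtain k K where k: "k < r" and K: "K \<in> [{..<N}]\<^bsup>card (verts F)\<^esup>" "c ` [K]\<^bsup>2\<^esup> \<subseteq> {k}"
      using partn_lstE[OF N, of c r] c by (auto simp: G_def)
    then have "finite K" "card K = card (verts F)" "K \<subseteq> {..<N}"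
      by (auto simp: nsets_def)
    then obtain \<phi> where \<phi>: "bij_betw \<phi> (verts F) K"
      using F finite_same_card_bij unfolding finite_sgraph_def by metis
    have img: "\<phi> ` e \<in> [K]\<^bsup>2\<^esup>" if "e \<in> edges F" for e
    proof -
      have e: "e \<subseteq> verts F" "finite e" "card e = 2"
        using F that unfolding finite_sgraph_def nsets_def by auto
      then have "card (\<phi> ` e) = 2"
        using \<phi> by (metis bij_betw_def card_image inj_on_subset)
      moreover have "\<phi> ` e \<subseteq> K"
        using e \<phi> by (metis bij_betw_def image_mono)
      ultimately show ?thesis
        using e by (simp add: nsets_def)
    qed
    have "\<phi> ` e \<in> edges G \<and> c (\<phi> ` e) = k" if "e \<in> edges F" for e
      using img[OF that] K nsets_mono[OF \<open>K \<subseteq> {..<N}\<close>, of 2] unfolding G_def by auto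
    moreover have "inj_on \<phi> (verts F)" "\<phi> ` verts F \<subseteq> verts G"
      using \<phi> \<open>K \<subseteq> {..<N}\<close> by (simp_all add: bij_betw_def G_def)
    ultimately show ?thesis
      using k unfolding monochromatic_copy_def by blast
  qed
  then have "size_ramsey_host r F G"
    by (auto simp: size_ramsey_host_def finite_sgraph_def G_def)
  then have "\<exists>m. \<exists>G :: nat sgraph. size_ramsey_host r F G \<and> card (edges G) = m"
    by blast
  then show ?thesis
    unfolding size_ramsey_def by (rule LeastI_ex)
qed

end

theory Submission
  imports Defs
begin

text \<open>
  For \<open>D = 2\<close> the hypothesis on \<open>\<sigma>\<close> cannot be satisfied, so \<open>D \<ge> 3\<close>. Put \<open>n\<^sub>1 = r\<^bsup>O(log D)\<^esup>\<close>.

  If \<open>n < n\<^sub>1\<close>, the host is a complete bipartite graph and dependent random choice in the most frequent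
  colour finds every bipartite graph on \<open>n\<close> vertices of maximum degree \<open>D\<close>; the number of edges is
  polynomial in \<open>n\<close>, and \<open>n\<^sup>3\<close> is absorbed by the constant.

  If \<open>n \<ge> n\<^sub>1\<close>, the host is a sparse bipartite graph on \<open>N + N\<close> vertices, \<open>N = r\<^bsup>O(log D)\<^esup> n\<close>, in which no two sets of
  size \<open>n\<close> span more than a constant times the expected number of edges. In the most frequent colour
  take a pair \<open>(X, Y)\<close> with \<open>|X| = |Y| = s \<ge> n\<close> maximising density \<open>\<times> s\<^bsup>1/k\<^esup>\<close>, \<open>k = O(log D)\<close>. The host
  property bounds \<open>s\<close> from below, and maximality forces a large minimum degree and \<open>|N(U)| \<ge> 3s/5\<close> for all
  one-sided \<open>U\<close> with \<open>|U| \<ge> m = s/(32D\<^sup>2)\<close>, because \<open>(U, N(U))\<close> would otherwise be a better pair.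
  In such a graph the subdivided edges are embedded one by one by the method of Friedman and Pippenger:
  from both branch vertices grow trees with more than \<open>m\<close> leaves, connect the leaf sets, and delete the
  unused tree vertices. Trees have branching \<open>D\<^sup>2\<close>, so they are shallow enough because
  \<open>D\<^bsup>\<sigma>(e)\<^esup> \<ge> n\<^sup>2\<close> and \<open>n \<ge> n\<^sub>1\<close>.
\<close>

section \<open>Friedman--Pippenger embedding in bipartite expanders\<close>

text \<open>The obstacle is the length of the subdivided edges. Both trees must reach at least
  \<open>m \<ge> n\<close> leaves; with branching \<open>D\<close> they alone would use about 2
  log_D m, at least the whole length that \<open>n ^ 2 \<le> D ^ \<sigma> e\<close> guarantees.
  Branching \<open>D ^ 2\<close> halves this to log_D m + O(1), and the saved log_D n pays for the
  ratio m/n, which is at most \<open>(4 * r) ^ k\<close>. The price is an expander with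
  \<open>\<Delta> = D ^ 2\<close>, hence \<open>s \<ge> 32 * D ^ 2 * m\<close>. The exponent 1/k
  balances two demands. No pair is denser than the whole colour class by more than a factor
  \<open>4 * r\<close>, so the best pair is smaller than the host by a factor of at most
  \<open>(4 * r) ^ k\<close>. Conversely, a set with few neighbours yields a pair of size
  \<open>m\<close> and 5/4 times the density, which contradicts maximality once (5/4)^k > s/m; as
  s/m is of order D^2, a \<open>k\<close> of order log D suffices. Only small \<open>n\<close> costs
  the factor \<open>D\<close> in the final exponent: it comes from the \<open>2 * D\<close> samples
  of dependent random choice.\<close>

locale bipartite_expander =
  fixes X Y :: "'v set" and adj :: "'v \<Rightarrow> 'v \<Rightarrow> bool" and s m \<Delta> :: nat
  assumes finite_X: "finite X" and finite_Y: "finite Y" and disjoint_XY: "X \<inter> Y = {}"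
    and card_X: "card X = s" and card_Y: "card Y = s"
    and adj_sym: "adj x y \<Longrightarrow> adj y x"
    and adj_X: "adj x y \<Longrightarrow> x \<in> X \<Longrightarrow> y \<in> Y"
    and adj_Y: "adj x y \<Longrightarrow> x \<in> Y \<Longrightarrow> y \<in> X"
    and adj_XY: "adj x y \<Longrightarrow> x \<in> X \<union> Y"
    and expand: "U \<subseteq> X \<or> U \<subseteq> Y \<Longrightarrow> m \<le> card U \<Longrightarrow> 3 * s \<le> 5 * card {y. \<exists>x\<in>U. adj x y}"
    and m_pos: "m \<ge> 1" and \<Delta>_ge: "\<Delta> \<ge> 9" and s_ge: "32 * \<Delta> * m \<le> s"
begin

definition nbs :: "'v set \<Rightarrow> 'v set" where
  "nbs U = {y. \<exists>x\<in>U. adj x y}"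

definition sided :: "'v set \<Rightarrow> bool" where
  "sided U \<longleftrightarrow> U \<subseteq> X \<or> U \<subseteq> Y"

text \<open>\<open>W\<close> is the set of occupied vertices, and \<open>w v\<close> is the number of further children that \<open>v\<close> may still
  receive. Unoccupied vertices have \<open>w v = \<Delta>\<close>, so occupying one does not change \<open>w\<close> at it.\<close>

definition good :: "'v set \<Rightarrow> ('v \<Rightarrow> int) \<Rightarrow> bool" where
  "good W w \<longleftrightarrow> (\<forall>v. w v \<le> int \<Delta>) \<and>
     (\<forall>U. sided U \<longrightarrow> card U \<le> m \<longrightarrow> sum w U \<le> int (card (nbs U - W)))"

definition tight :: "'v set \<Rightarrow> ('v \<Rightarrow> int) \<Rightarrow> 'v set \<Rightarrow> bool" where
  "tight W w U \<longleftrightarrow> sided U \<and> card U \<le> m \<and> int (card (nbs U - W)) = sum w U"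

lemma sided_finite: "sided U \<Longrightarrow> finite U"
  using finite_X finite_Y finite_subset unfolding sided_def by blast

lemma sided_subset: "sided U \<Longrightarrow> U' \<subseteq> U \<Longrightarrow> sided U'"
  unfolding sided_def by blast

lemma nbs_subset: "nbs U \<subseteq> X \<union> Y"
  unfolding nbs_def using adj_sym adj_XY by blast

lemma nbs_X: "U \<subseteq> X \<Longrightarrow> nbs U \<subseteq> Y" and nbs_Y: "U \<subseteq> Y \<Longrightarrow> nbs U \<subseteq> X"
  unfolding nbs_def using adj_X adj_Y by blast+

lemma finite_nbs: "finite (nbs U)"
  using nbs_subset finite_X finite_Y by (meson finite_Un finite_subset)

lemma nbs_Un: "nbs (A \<union> B) = nbs A \<union> nbs B"
  unfolding nbs_def by blast

lemma nbs_mono: "A \<subseteq> B \<Longrightarrow> nbs A \<subseteq> nbs B"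
  unfolding nbs_def by blast

lemma card_nbs: "sided U \<Longrightarrow> m \<le> card U \<Longrightarrow> 3 * s \<le> 5 * card (nbs U)"
  using expand unfolding sided_def nbs_def by blast

lemma sum_demand_le:
  assumes "good W w" shows "sum w U \<le> int \<Delta> * int (card U)"
proof -
  have "sum w U \<le> of_nat (card U) * int \<Delta>"
    using assms unfolding good_def by (intro sum_bounded_above) blast
  then show ?thesis by (simp add: mult.commute)
qed

text \<open>Above size \<open>m\<close> expansion takes over from goodness: 3s/5 exceeds 19
  \<open>\<Delta> * m\<close>, so even without the occupied vertices more neighbours remain than the
  largest possible demand \<open>2 * \<Delta> * m\<close>.\<close>

lemma good_large:
  assumes g: "good W w" and W: "card W \<le> 5 * \<Delta> * m" "finite W" and U: "sided U" "m < card U" "card U \<le> 2 * m"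
  shows "sum w U < int (card (nbs U - W))"
proof -
  have "3 * s \<le> 5 * card (nbs U)" using card_nbs U by simp
  moreover have "card (nbs U) \<le> card (nbs U - W) + card W"
    using W(2) finite_nbs by (metis add.commute card_Un_le Un_Diff_cancel Un_upper2 card_mono finite_Diff finite_Un le_trans sup_commute)
  moreover have "\<Delta> * m \<ge> 1" using m_pos \<Delta>_ge by simp
  ultimately have "card (nbs U - W) > 2 * (\<Delta> * m)"
    using W(1) s_ge unfolding mult.assoc by linarith
  moreover have "sum w U \<le> int (2 * (\<Delta> * m))"
  proof -
    have "sum w U \<le> int (\<Delta> * card U)" using sum_demand_le[OF g] by simp
    also have "\<dots> \<le> int (\<Delta> * (2 * m))" using U(3) by (simp only: of_nat_le_iff mult_le_mono2)
    finally show ?thesis by (simp add: algebra_simps)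
  qed
  ultimately show ?thesis by linarith
qed

text \<open>The slack \<open>|N(U) - W| - w(U)\<close> is submodular in \<open>U\<close>, and it is positive for the sizes between
  \<open>m\<close> and \<open>2m\<close>, so a union of two tight sets cannot be larger than \<open>m\<close>.\<close>

lemma tight_Un:
  assumes g: "good W w" and W: "card W \<le> 5 * \<Delta> * m" "finite W"
    and t: "tight W w A" "tight W w B" and sd: "sided (A \<union> B)"
  shows "tight W w (A \<union> B)"
proof -
  have fin: "finite A" "finite B" using t sided_finite unfolding tight_def by auto
  let ?f = "\<lambda>U. nbs U - W"
  have 1: "card (?f (A \<union> B)) + card (?f A \<inter> ?f B) = card (?f A) + card (?f B)"
    using card_Un_Int[of "?f A" "?f B"] finite_nbs by (simp add: nbs_Un Un_Diff)
  have 2: "card (?f (A \<inter> B)) \<le> card (?f A \<inter> ?f B)"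
    using finite_nbs by (intro card_mono) (auto simp: nbs_def)
  have "card (A \<inter> B) \<le> m"
    using t fin unfolding tight_def by (meson card_mono inf_le1 le_trans)
  then have 3: "sum w (A \<inter> B) \<le> int (card (?f (A \<inter> B)))"
    using g sided_subset[OF sd, of "A \<inter> B"] unfolding good_def by blast
  have 4: "sum w (A \<union> B) + sum w (A \<inter> B) = sum w A + sum w B"
    using fin by (rule sum.union_inter)
  have le: "int (card (?f (A \<union> B))) \<le> sum w (A \<union> B)"
    using 1 2 3 4 t unfolding tight_def by linarith
  have "card (A \<union> B) \<le> 2 * m"
    using t card_Un_le[of A B] unfolding tight_def by linarith
  then have "card (A \<union> B) \<le> m"
    using good_large[OF g W sd] le by linarith
  moreover from this have "sum w (A \<union> B) \<le> int (card (?f (A \<union> B)))"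
    using g sd unfolding good_def by blast
  ultimately show ?thesis using le sd unfolding tight_def by simp
qed

text \<open>The empty set is tight and tight subsets of one side are closed under union. All
  obstructions on a side are thus collected in one tight set.\<close>

lemma tight_max:
  assumes g: "good W w" and W: "card W \<le> 5 * \<Delta> * m" "finite W" and S: "sided S"
  shows "\<exists>U0\<subseteq>S. tight W w U0 \<and> (\<forall>U\<subseteq>S. tight W w U \<longrightarrow> U \<subseteq> U0)"
proof -
  define \<F> where "\<F> = {U. U \<subseteq> S \<and> tight W w U}"
  have fin: "finite \<F>"
    using sided_finite[OF S] unfolding \<F>_def by simp
  have "tight W w (\<Union>\<G>)" if "finite \<G>" "\<G> \<subseteq> \<F>" for \<G>
    using that
  proof (induction \<G>)
    case empty
    then show ?case by (simp add: tight_def sided_def nbs_def)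
  next
    case (insert A \<G>)
    then have "tight W w A" "tight W w (\<Union>\<G>)" "A \<union> \<Union>\<G> \<subseteq> S" unfolding \<F>_def by auto
    then show ?case using tight_Un[OF g W] sided_subset[OF S] by simp
  qed
  then have "tight W w (\<Union>\<F>)" using fin by blast
  then show ?thesis by (intro exI[of _ "\<Union>\<F>"]) (auto simp: \<F>_def)
qed

lemma card_Diff_insert_ge: "int (card (A - W)) - 1 \<le> int (card (A - insert y W))"
proof (cases "finite (A - W)")
  case True
  have "A - insert y W = (A - W) - {y}" by blast
  then show ?thesis using True card_Diff_singleton_if[of "A - W" y] by (auto split: if_splits)
next
  case False
  then show ?thesis by simp
qed

lemma sided_nbs_opposite:
  assumes "sided U" "y \<in> nbs U" shows "y \<in> Y \<Longrightarrow> U \<subseteq> X" "y \<in> X \<Longrightarrow> U \<subseteq> Y"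
  using assms disjoint_XY nbs_X nbs_Y unfolding sided_def by blast+

text \<open>Occupying \<open>y\<close> takes a free neighbour from every set that sees
  \<open>y\<close>, which harms only tight sets. These all lie in the largest one,
  \<open>U0\<close>, so \<open>Bd\<close> is the free neighbourhood of \<open>U0\<close>; tightness
  bounds it by the demand of \<open>U0\<close>.\<close>

lemma few_bad:
  assumes g: "good W w" and W: "card W \<le> 5 * \<Delta> * m" "finite W"
    and S: "S = X \<and> S' = Y \<or> S = Y \<and> S' = X"
  shows "\<exists>Bd. finite Bd \<and> card Bd \<le> \<Delta> * m \<and> (\<forall>y\<in>S' - Bd - W. good (insert y W) w)"
proof -
  have "sided S" using S unfolding sided_def by blast
  from tight_max[OF g W this] obtain U0 where U0: "U0 \<subseteq> S" "tight W w U0"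
    and max: "\<And>U. U \<subseteq> S \<Longrightarrow> tight W w U \<Longrightarrow> U \<subseteq> U0" by blast
  have "int (card (nbs U0 - W)) \<le> int \<Delta> * int (card U0)"
    using U0(2) sum_demand_le[OF g, of U0] unfolding tight_def by simp
  also have "\<dots> \<le> int (\<Delta> * m)" using U0(2) unfolding tight_def by (simp add: mult_left_mono)
  finally have c: "card (nbs U0 - W) \<le> \<Delta> * m" by (simp only: of_nat_le_iff)
  have "good (insert y W) w" if y: "y \<in> S' - (nbs U0 - W) - W" for y
    unfolding good_def
  proof (intro conjI allI impI)
    show "w v \<le> int \<Delta>" for v using g unfolding good_def by blast
    fix U assume U: "sided U" "card U \<le> m"
    then have le: "sum w U \<le> int (card (nbs U - W))" using g unfolding good_def by blast
    show "sum w U \<le> int (card (nbs U - insert y W))"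
    proof (cases "y \<in> nbs U")
      case False
      then have "nbs U - insert y W = nbs U - W" by blast
      then show ?thesis using le by simp
    next
      case True
      have "U \<subseteq> S" using sided_nbs_opposite[OF U(1) True] y S by blast
      then have "\<not> tight W w U" using max[of U] True y nbs_mono by blast
      then have "sum w U < int (card (nbs U - W))" using le U unfolding tight_def by linarith
      then show ?thesis using card_Diff_insert_ge[of "nbs U" W y] by linarith
    qed
  qed
  then show ?thesis using c finite_nbs by (intro exI[of _ "nbs U0 - W"]) blast
qed

text \<open>The Friedman--Pippenger step. Sets containing \<open>u\<close> lose at most one free
  neighbour and exactly one unit of demand, so only tight sets avoiding \<open>u\<close> can
  obstruct; a vertex \<open>y\<close> unseen by the largest of them is safe.\<close>

lemma extend:
  assumes g: "good W w" and W: "card W \<le> 5 * \<Delta> * m" "finite W"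
    and u: "u \<in> X \<union> Y" "w u \<ge> 1"
  shows "\<exists>y. adj u y \<and> y \<notin> W \<and> good (insert y W) (w(u := w u - 1))"
proof -
  obtain S where S: "S = X \<or> S = Y" "u \<in> S" using u by blast
  then have sS: "sided S" unfolding sided_def by blast
  from tight_max[OF g W sided_subset[OF sS, of "S - {u}"]] obtain U0
    where U0: "U0 \<subseteq> S - {u}" "tight W w U0"
    and max: "\<And>U. U \<subseteq> S - {u} \<Longrightarrow> tight W w U \<Longrightarrow> U \<subseteq> U0" by blast
  have fU0: "finite U0" using U0 sided_finite unfolding tight_def by blast
  \<comment> \<open>Otherwise adding \<open>u\<close> to \<open>U0\<close> raises the demand by
    \<open>w u \<ge> 1\<close> without a new free neighbour. The enlarged set can have
    \<open>m + 1\<close> elements, a case that only \<open>good_large\<close> covers.\<close>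
  have "\<not> nbs {u} - W \<subseteq> nbs U0"
  proof
    assume sub: "nbs {u} - W \<subseteq> nbs U0"
    let ?U = "insert u U0"
    have eq: "nbs ?U - W = nbs U0 - W" using sub nbs_Un[of "{u}" U0] by auto
    have sU: "sided ?U" using U0(1) S sided_subset[OF sS, of ?U] by blast
    have sm: "sum w ?U = w u + sum w U0" using U0(1) fU0 by (subst sum.insert) auto
    have cU: "card ?U = Suc (card U0)" using U0(1) fU0 by (subst card_insert_disjoint) auto
    have "sum w ?U > int (card (nbs ?U - W))"
      using sm u(2) eq U0(2) unfolding tight_def by simp
    moreover have "card ?U \<le> m \<or> m < card ?U \<and> card ?U \<le> 2 * m"
      using cU U0(2) m_pos unfolding tight_def by linarith
    ultimately show False
      using good_large[OF g W sU] g sU unfolding good_def by (meson leD less_asym)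
  qed
  then obtain y where y: "y \<in> nbs {u}" "y \<notin> W" "y \<notin> nbs U0" by blast
  let ?w = "w(u := w u - 1)"
  have "good (insert y W) ?w"
    unfolding good_def
  proof (intro conjI allI impI)
    show "?w v \<le> int \<Delta>" for v
      using g unfolding good_def by (metis fun_upd_apply diff_le_eq le_add_same_cancel1 order_trans zero_le_one)
    fix U assume U: "sided U" "card U \<le> m"
    then have le: "sum w U \<le> int (card (nbs U - W))" using g unfolding good_def by blast
    show "sum ?w U \<le> int (card (nbs U - insert y W))"
    proof (cases "u \<in> U")
      case True
      have "sum ?w U = sum w U - 1"
        using True sided_finite[OF U(1)] by (simp add: sum.remove[of U u])
      then show ?thesis using le card_Diff_insert_ge[of "nbs U" W y] by linarith
    next
      case False
      then have sw: "sum ?w U = sum w U" by (intro sum.cong) auto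
      show ?thesis
      proof (cases "y \<in> nbs U")
        case False
        then have "nbs U - insert y W = nbs U - W" by blast
        then show ?thesis using le sw by simp
      next
        case True
        have "y \<in> (if S = X then Y else X)"
          using y(1) S adj_X adj_Y unfolding nbs_def by auto
        then have "U \<subseteq> S - {u}"
          using sided_nbs_opposite[OF U(1) True] \<open>u \<notin> U\<close> S by (auto split: if_splits)
        then have "\<not> tight W w U" using max[of U] True y nbs_mono by blast
        then have "sum w U < int (card (nbs U - W))" using le U unfolding tight_def by linarith
        then show ?thesis using card_Diff_insert_ge[of "nbs U" W y] sw by linarith
      qed
    qed
  qed
  then show ?thesis using y unfolding nbs_def by blast
qed

text \<open>The neighbours of a one-sided set lie on one side, so it sees at most one of
  \<open>x\<close> and \<open>y\<close> and the two insertions do not interact.\<close>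

lemma good_insert2:
  assumes g: "good (insert x W) w" "good (insert y W) w" and xy: "x \<in> X \<and> y \<in> Y \<or> x \<in> Y \<and> y \<in> X"
  shows "good (insert x (insert y W)) w"
  unfolding good_def
proof (intro conjI allI impI)
  show "w v \<le> int \<Delta>" for v using g(1) unfolding good_def by blast
  fix U assume U: "sided U" "card U \<le> m"
  have "nbs U \<subseteq> X \<or> nbs U \<subseteq> Y" using U nbs_X nbs_Y unfolding sided_def by blast
  then have "nbs U - insert x (insert y W) = nbs U - insert x W \<or> nbs U - insert x (insert y W) = nbs U - insert y W"
    using xy disjoint_XY by blast
  then show "sum w U \<le> int (card (nbs U - insert x (insert y W)))"
    using g U unfolding good_def by metis
qed

text \<open>A released vertex returns one unit of demand to its parent and is at the same time a
  free neighbour of that parent again. Summed over \<open>U\<close> the two effects cancel, so a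
  whole set is released at once rather than leaf by leaf.\<close>

lemma rollback:
  assumes g: "good W' w'" and W: "W \<subseteq> W'" "finite W'" and par: "\<And>c. c \<in> W' - W \<Longrightarrow> adj (\<pi> c) c"
    and w: "\<And>v. w v \<le> w' v + int (card {c \<in> W' - W. \<pi> c = v})" "\<And>v. w v \<le> int \<Delta>"
  shows "good W w"
  unfolding good_def
proof (intro conjI allI impI)
  show "w v \<le> int \<Delta>" for v by (rule w)
  fix U assume U: "sided U" "card U \<le> m"
  have fU: "finite U" using sided_finite U by blast
  let ?R = "{c \<in> W' - W. \<pi> c \<in> U}"
  have "sum w U \<le> (\<Sum>v\<in>U. w' v + int (card {c \<in> W' - W. \<pi> c = v}))"
    by (intro sum_mono w)
  also have "\<dots> = sum w' U + int (\<Sum>v\<in>U. card {c \<in> W' - W. \<pi> c = v})"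
    by (simp add: sum.distrib)
  also have "(\<Sum>v\<in>U. card {c \<in> W' - W. \<pi> c = v}) = card (\<Union>v\<in>U. {c \<in> W' - W. \<pi> c = v})"
    using fU W by (intro card_UN_disjoint[symmetric]) auto
  also have "(\<Union>v\<in>U. {c \<in> W' - W. \<pi> c = v}) = ?R" by blast
  also have "sum w' U \<le> int (card (nbs U - W'))" using g U unfolding good_def by blast
  finally have "sum w U \<le> int (card (nbs U - W') + card ?R)" by simp
  also have "card (nbs U - W') + card ?R = card ((nbs U - W') \<union> ?R)"
    using W finite_nbs by (intro card_Un_disjoint[symmetric]) auto
  also have "\<dots> \<le> card (nbs U - W)"
    using W par finite_nbs by (intro card_mono) (auto simp: nbs_def)
  finally show "sum w U \<le> int (card (nbs U - W))" by simp
qed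

end

section \<open>Growing trees and pruning them to a single branch\<close>

context bipartite_expander
begin

text \<open>Iterates \<open>extend\<close>. The remaining demand is recorded through the numbers of
  children under \<open>\<pi>\<close>, the form in which \<open>rollback\<close> can undo
  it.\<close>

lemma grow:
  assumes "good W w" "finite W" "finite T" "T \<subseteq> X \<union> Y" "card W + sum g T \<le> 5 * \<Delta> * m"
    and "\<And>t. t \<in> T \<Longrightarrow> int (g t) \<le> w t"
  shows "\<exists>C \<pi>. finite C \<and> C \<inter> W = {} \<and> (\<forall>c\<in>C. \<pi> c \<in> T \<and> adj (\<pi> c) c) \<and>
      (\<forall>t\<in>T. card {c\<in>C. \<pi> c = t} = g t) \<and> card C = sum g T \<and>
      good (W \<union> C) (\<lambda>v. w v - int (card {c\<in>C. \<pi> c = v}))"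
  using assms
proof (induction "sum g T" arbitrary: g W w)
  case 0
  then have "\<forall>t\<in>T. g t = 0" by simp
  then show ?case using 0 by (intro exI[of _ "{}"]) auto
next
  case (Suc k)
  then obtain t where t: "t \<in> T" "g t > 0"
    by (metis (no_types, lifting) gr0I nat.distinct(1) sum.neutral)
  have "w t \<ge> 1" using Suc.prems(6)[OF t(1)] t(2) by simp
  then obtain y where y: "adj t y" "y \<notin> W" and gy: "good (insert y W) (w(t := w t - 1))"
    using extend[OF Suc.prems(1) _ Suc.prems(2), of t] Suc.prems(4,5) t(1) by auto
  let ?g = "g(t := g t - 1)"
  have sg: "sum g T = Suc (sum ?g T)"
    using t Suc.prems(3) by (simp add: sum.remove[of T t])
  have "\<exists>C \<pi>. finite C \<and> C \<inter> insert y W = {} \<and> (\<forall>c\<in>C. \<pi> c \<in> T \<and> adj (\<pi> c) c) \<and>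
      (\<forall>t\<in>T. card {c\<in>C. \<pi> c = t} = ?g t) \<and> card C = sum ?g T \<and>
      good (insert y W \<union> C) (\<lambda>v. (w(t := w t - 1)) v - int (card {c\<in>C. \<pi> c = v}))"
  proof (rule Suc.hyps(1))
    show "k = sum ?g T" using Suc.hyps(2) sg by simp
    show "card (insert y W) + sum ?g T \<le> 5 * \<Delta> * m"
      using Suc.prems(5,2) sg y(2) by simp
    show "int (?g v) \<le> (w(t := w t - 1)) v" if "v \<in> T" for v
      using Suc.prems(6)[OF that] t by auto
    show "good (insert y W) (w(t := w t - 1))" by (rule gy)
  qed (use Suc.prems in auto)
  then obtain C \<pi> where C: "finite C" "C \<inter> insert y W = {}" "\<forall>c\<in>C. \<pi> c \<in> T \<and> adj (\<pi> c) c"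
      "\<forall>t\<in>T. card {c\<in>C. \<pi> c = t} = ?g t" "card C = sum ?g T"
      "good (insert y W \<union> C) (\<lambda>v. (w(t := w t - 1)) v - int (card {c\<in>C. \<pi> c = v}))" by blast
  let ?C = "insert y C" and ?\<pi> = "\<pi>(y := t)"
  have yC: "y \<notin> C" using C(2) by blast
  have set: "{c \<in> ?C. ?\<pi> c = v} = (if v = t then insert y {c\<in>C. \<pi> c = v} else {c\<in>C. \<pi> c = v})" for v
    using yC by auto
  have cd: "card {c \<in> ?C. ?\<pi> c = v} = card {c\<in>C. \<pi> c = v} + (if v = t then 1 else 0)" for v
    unfolding set using yC C(1) by simp
  have weq: "(\<lambda>v. w v - int (card {c\<in>?C. ?\<pi> c = v})) = (\<lambda>v. (w(t := w t - 1)) v - int (card {c\<in>C. \<pi> c = v}))"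
    unfolding cd by auto
  have "W \<union> ?C = insert y W \<union> C" by blast
  then have "good (W \<union> ?C) (\<lambda>v. w v - int (card {c\<in>?C. ?\<pi> c = v}))"
    using C(6) weq by simp
  moreover have "\<forall>v\<in>T. card {c\<in>?C. ?\<pi> c = v} = g v"
    unfolding cd using C(4) t by auto
  moreover have "\<forall>c\<in>?C. ?\<pi> c \<in> T \<and> adj (?\<pi> c) c" using C(3) t y yC by auto
  moreover have "finite ?C" "?C \<inter> W = {}" "card ?C = sum g T"
    using C yC y sg by auto
  ultimately show ?case by blast
qed

text \<open>Injectivity is included because each vertex of a branch must have only one child on it
  when the tree is pruned.\<close>

definition climbs :: "'v \<Rightarrow> nat \<Rightarrow> 'v set \<Rightarrow> ('v \<Rightarrow> 'v) \<Rightarrow> 'v \<Rightarrow> (nat \<Rightarrow> 'v) \<Rightarrow> bool" where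
  "climbs u i C \<pi> y p \<longleftrightarrow> p 0 = u \<and> p i = y \<and> inj_on p {..i} \<and>
     (\<forall>j<i. adj (p j) (p (Suc j)) \<and> p (Suc j) \<in> C \<and> \<pi> (p (Suc j)) = p j)"

text \<open>A tree of depth \<open>i\<close> hanging off \<open>u\<close>: \<open>C\<close> is the set of its vertices other than \<open>u\<close>, \<open>L\<close> its last
  level and \<open>\<pi>\<close> the parent map.\<close>

definition tree :: "'v set \<Rightarrow> 'v \<Rightarrow> nat \<Rightarrow> 'v set \<Rightarrow> 'v set \<Rightarrow> ('v \<Rightarrow> 'v) \<Rightarrow> bool" where
  "tree W u i L C \<pi> \<longleftrightarrow> finite C \<and> C \<inter> W = {} \<and> u \<in> W \<and> (i = 0 \<longrightarrow> C = {} \<and> L = {u}) \<and> (i > 0 \<longrightarrow> L \<subseteq> C) \<and>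
     (\<forall>c\<in>C. adj (\<pi> c) c \<and> \<pi> c \<in> insert u C \<and> \<pi> c \<notin> L) \<and> (\<forall>y\<in>L. \<exists>p. climbs u i C \<pi> y p)"

abbreviation used :: "('v \<Rightarrow> int) \<Rightarrow> 'v set \<Rightarrow> ('v \<Rightarrow> 'v) \<Rightarrow> 'v \<Rightarrow> int" where
  "used w C \<pi> \<equiv> \<lambda>v. w v - int (card {c\<in>C. \<pi> c = v})"

lemma tree_0: "u \<in> W \<Longrightarrow> tree W u 0 {u} {} \<pi>"
  unfolding tree_def climbs_def by (auto intro: exI[of _ "\<lambda>_. u"])

text \<open>The last level has no children yet, so its demand is still that of \<open>w\<close> and
  each of its vertices can receive \<open>q\<close> children.\<close>

lemma tree_step:
  assumes t: "tree W u i L C \<pi>" and g: "good (W \<union> C) (used w C \<pi>)" and W: "finite W" "W \<subseteq> X \<union> Y"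
    and q: "\<And>y. y \<in> L \<Longrightarrow> int q \<le> w y" and c: "card W + card C + q * card L \<le> 5 * \<Delta> * m"
  shows "\<exists>L' C' \<pi>'. tree W u (Suc i) L' C' \<pi>' \<and> good (W \<union> C') (used w C' \<pi>') \<and>
    card L' = q * card L \<and> card C' = card C + q * card L"
proof -
  note tr = t[unfolded tree_def]
  have fC: "finite C" and CW: "C \<inter> W = {}" and uW: "u \<in> W" using tr by auto
  have LC: "L \<subseteq> insert u C" using tr by (cases "i = 0") auto
  have fL: "finite L" using LC fC finite_subset by blast
  have Csub: "C \<subseteq> X \<union> Y" using tr adj_XY adj_sym by blast
  have noch: "{c \<in> C. \<pi> c = y} = {}" if "y \<in> L" for y using tr that by blast
  have "\<exists>C1 \<pi>1. finite C1 \<and> C1 \<inter> (W \<union> C) = {} \<and> (\<forall>c\<in>C1. \<pi>1 c \<in> L \<and> adj (\<pi>1 c) c) \<and>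
      (\<forall>t\<in>L. card {c\<in>C1. \<pi>1 c = t} = q) \<and> card C1 = sum (\<lambda>_. q) L \<and>
      good (W \<union> C \<union> C1) (\<lambda>v. used w C \<pi> v - int (card {c\<in>C1. \<pi>1 c = v}))"
  proof (rule grow[OF g])
    show "L \<subseteq> X \<union> Y" using LC W uW Csub by blast
    show "card (W \<union> C) + (\<Sum>_\<in>L. q) \<le> 5 * \<Delta> * m"
      using c CW fC W by (simp add: card_Un_disjoint Int_commute mult.commute)
    show "int q \<le> used w C \<pi> y" if "y \<in> L" for y using q[OF that] unfolding noch[OF that] by simp
  qed (use fL W fC in auto)
  then obtain C1 \<pi>1 where C1: "finite C1" "C1 \<inter> (W \<union> C) = {}" "\<forall>c\<in>C1. \<pi>1 c \<in> L \<and> adj (\<pi>1 c) c"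
      "card C1 = q * card L"
      "good (W \<union> C \<union> C1) (\<lambda>v. used w C \<pi> v - int (card {c\<in>C1. \<pi>1 c = v}))"
    by (auto simp: mult.commute)
  define \<pi>' where "\<pi>' = (\<lambda>c. if c \<in> C1 then \<pi>1 c else \<pi> c)"
  have dis: "C \<inter> C1 = {}" using C1(2) by blast
  have cd: "card {c\<in>C \<union> C1. \<pi>' c = v} = card {c\<in>C. \<pi> c = v} + card {c\<in>C1. \<pi>1 c = v}" for v
  proof -
    have "{c\<in>C \<union> C1. \<pi>' c = v} = {c\<in>C. \<pi> c = v} \<union> {c\<in>C1. \<pi>1 c = v}"
      using dis unfolding \<pi>'_def by auto
    then show ?thesis using dis fC C1(1) by (simp add: card_Un_disjoint disjoint_iff)
  qed
  have "used w (C \<union> C1) \<pi>' = (\<lambda>v. used w C \<pi> v - int (card {c\<in>C1. \<pi>1 c = v}))"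
    unfolding cd by auto
  then have g': "good (W \<union> (C \<union> C1)) (used w (C \<union> C1) \<pi>')"
    using C1(5) by (simp add: Un_assoc)
  have climb: "\<exists>p. climbs u (Suc i) (C \<union> C1) \<pi>' y p" if y: "y \<in> C1" for y
  proof -
    have "\<pi>1 y \<in> L" using C1 y by blast
    then obtain p where p: "climbs u i C \<pi> (\<pi>1 y) p" using tr by blast
    have ran: "p j \<in> insert u C" if "j \<le> i" for j
      using p that unfolding climbs_def by (cases j) auto
    have yn: "y \<notin> insert u C" using C1(2) y uW by blast
    have "inj_on (p(Suc i := y)) {..Suc i}"
    proof -
      have "inj_on (p(Suc i := y)) {..i}"
        using p unfolding climbs_def by (auto simp: inj_on_def)
      moreover have "y \<notin> (p(Suc i := y)) ` {..i}" using ran yn by auto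
      ultimately show ?thesis by (auto simp: atMost_Suc)
    qed
    moreover have "adj ((p(Suc i := y)) j) ((p(Suc i := y)) (Suc j)) \<and> (p(Suc i := y)) (Suc j) \<in> C \<union> C1 \<and>
        \<pi>' ((p(Suc i := y)) (Suc j)) = (p(Suc i := y)) j" if "j < Suc i" for j
    proof (cases "j = i")
      case True
      then show ?thesis using p y C1(3) unfolding climbs_def \<pi>'_def by auto
    next
      case False
      then have "j < i" using that by simp
      then have "adj (p j) (p (Suc j))" "p (Suc j) \<in> C" "\<pi> (p (Suc j)) = p j" using p unfolding climbs_def by auto
      then show ?thesis using \<open>j < i\<close> dis unfolding \<pi>'_def by auto
    qed
    moreover have "(p(Suc i := y)) 0 = u" using p unfolding climbs_def by simp
    ultimately show ?thesis unfolding climbs_def by (intro exI[of _ "p(Suc i := y)"]) auto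
  qed
  have "tree W u (Suc i) C1 (C \<union> C1) \<pi>'"
    unfolding tree_def
  proof (intro conjI ballI)
    fix c assume c: "c \<in> C \<union> C1"
    show "adj (\<pi>' c) c" using c tr C1 unfolding \<pi>'_def by auto
    show "\<pi>' c \<in> insert u (C \<union> C1)" using c tr C1 LC unfolding \<pi>'_def by auto
    show "\<pi>' c \<notin> C1" using c tr C1 LC dis uW unfolding \<pi>'_def by (auto split: if_splits)
  qed (use fC C1 CW uW climb in auto)
  moreover have "card (C \<union> C1) = card C + q * card L"
    using fC C1 dis by (simp add: card_Un_disjoint)
  ultimately show ?thesis using g' C1(4) by blast
qed

text \<open>An unbranched start. It absorbs surplus length, and it is the only possible start at a
  branch vertex that may have a single unit of demand left.\<close>

lemma tree_path:
  assumes g: "good W w" and W: "finite W" "W \<subseteq> X \<union> Y" "u \<in> W" "w u \<ge> 1"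
    and fresh: "\<And>v. v \<in> X \<union> Y - W \<Longrightarrow> w v = int \<Delta>" and c: "card W + i \<le> 5 * \<Delta> * m"
  shows "\<exists>L C \<pi>. tree W u i L C \<pi> \<and> good (W \<union> C) (used w C \<pi>) \<and> card L = 1 \<and> card C = i"
  using c
proof (induction i)
  case 0
  show ?case using tree_0[OF W(3)] g by (intro exI[of _ "{u}"] exI[of _ "{}"]) auto
next
  case (Suc i)
  then obtain L C \<pi> where t: "tree W u i L C \<pi>" "good (W \<union> C) (used w C \<pi>)" "card L = 1" "card C = i"
    by auto
  have "int 1 \<le> w y" if "y \<in> L" for y
  proof (cases "i = 0")
    case True
    then show ?thesis using t that W unfolding tree_def by simp
  next
    case False
    then have "y \<in> C" using t that unfolding tree_def by auto
    then have "y \<in> X \<union> Y - W" using t adj_XY adj_sym unfolding tree_def by blast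
    then show ?thesis using fresh \<Delta>_ge by simp
  qed
  from tree_step[OF t(1,2) W(1,2) this] Suc.prems t show ?case by auto
qed

text \<open>Since \<open>i > 0\<close>, all leaves were unoccupied before and have full demand, so
  every level is \<open>\<Delta>\<close> times the previous one. The factor 2 bounds the geometric
  sum of the levels.\<close>

lemma tree_branch:
  assumes t: "tree W u i L C \<pi>" "good (W \<union> C) (used w C \<pi>)" "i > 0" "card L = 1" "card C = i"
    and W: "finite W" "W \<subseteq> X \<union> Y"
    and fresh: "\<And>v. v \<in> X \<union> Y - W \<Longrightarrow> w v = int \<Delta>" and c: "card W + i + 2 * \<Delta> ^ h \<le> 5 * \<Delta> * m"
  shows "\<exists>L C \<pi>. tree W u (i + h) L C \<pi> \<and> good (W \<union> C) (used w C \<pi>) \<and> card L = \<Delta> ^ h \<and> card C \<le> i + 2 * \<Delta> ^ h"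
  using c
proof (induction h)
  case 0
  show ?case using t by (intro exI[of _ L] exI[of _ C] exI[of _ \<pi>]) simp
next
  case (Suc h)
  have big: "2 * \<Delta> ^ h + \<Delta> ^ Suc h \<le> 2 * \<Delta> ^ Suc h" using \<Delta>_ge by simp
  then have "card W + i + 2 * \<Delta> ^ h \<le> 5 * \<Delta> * m" using Suc.prems by linarith
  then obtain L C \<pi> where t: "tree W u (i + h) L C \<pi>" "good (W \<union> C) (used w C \<pi>)" "card L = \<Delta> ^ h"
      "card C \<le> i + 2 * \<Delta> ^ h"
    using Suc.IH by blast
  have w: "int \<Delta> \<le> w y" if "y \<in> L" for y
  proof -
    have "y \<in> C" using t that \<open>i > 0\<close> unfolding tree_def by auto
    then have "y \<in> X \<union> Y - W" using t adj_XY adj_sym unfolding tree_def by blast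
    then show ?thesis using fresh by simp
  qed
  have "card W + card C + \<Delta> * card L \<le> 5 * \<Delta> * m"
    using t(4) big Suc.prems unfolding t(3) power_Suc by linarith
  then have "\<exists>L' C' \<pi>'. tree W u (Suc (i + h)) L' C' \<pi>' \<and> good (W \<union> C') (used w C' \<pi>') \<and>
      card L' = \<Delta> * card L \<and> card C' = card C + \<Delta> * card L"
    using w by (intro tree_step[OF t(1,2) W]) auto
  then obtain L' C' \<pi>' where "tree W u (i + Suc h) L' C' \<pi>'" "good (W \<union> C') (used w C' \<pi>')"
      "card L' = \<Delta> ^ Suc h" "card C' = card C + \<Delta> ^ Suc h" using t(3) by auto
  moreover from this have "card C' \<le> i + 2 * \<Delta> ^ Suc h" using t(4) big by linarith
  ultimately show ?case by blast
qed

lemma tree_rollback: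
  assumes t: "tree W u i L C \<pi>" and y: "y \<in> L" and p: "climbs u i C \<pi> y p"
    and g: "good (W \<union> C \<union> Q) (used w C \<pi>)" and Q: "finite Q" "Q \<inter> C = {}" and W: "finite W"
    and w: "\<And>v. w v \<le> int \<Delta>"
  shows "good (W \<union> p ` {1..i} \<union> Q) (\<lambda>v. w v - (if v \<in> p ` {..<i} then 1 else 0))"
proof (rule rollback[OF g, where \<pi> = \<pi>])
  let ?P = "p ` {1..i}"
  have PC: "?P \<subseteq> C"
  proof
    fix z assume "z \<in> ?P"
    then obtain j where "z = p j" "1 \<le> j" "j \<le> i" by auto
    then show "z \<in> C" using p unfolding climbs_def by (cases j) auto
  qed
  have fC: "finite C" and CW: "C \<inter> W = {}" using t unfolding tree_def by auto
  show "W \<union> ?P \<union> Q \<subseteq> W \<union> C \<union> Q" using PC by blast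
  show "finite (W \<union> C \<union> Q)" using W Q fC by simp
  have D: "W \<union> C \<union> Q - (W \<union> ?P \<union> Q) = C - ?P" using CW Q PC by blast
  show "adj (\<pi> c) c" if "c \<in> W \<union> C \<union> Q - (W \<union> ?P \<union> Q)" for c
    using that t unfolding D tree_def by blast
  show "w v - (if v \<in> p ` {..<i} then 1 else 0) \<le> int \<Delta>" for v
    using w[of v] by auto
  show "w v - (if v \<in> p ` {..<i} then 1 else 0)
      \<le> used w C \<pi> v + int (card {c \<in> W \<union> C \<union> Q - (W \<union> ?P \<union> Q). \<pi> c = v})" for v
  proof -
    have "{c \<in> C. \<pi> c = v} = {c \<in> C - ?P. \<pi> c = v} \<union> {c \<in> ?P. \<pi> c = v}" using PC by blast
    then have "card {c \<in> C. \<pi> c = v} = card {c \<in> C - ?P. \<pi> c = v} + card {c \<in> ?P. \<pi> c = v}"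
      using fC by (subst card_Un_disjoint[symmetric]) auto
    moreover have "card {c \<in> ?P. \<pi> c = v} \<le> (if v \<in> p ` {..<i} then 1 else 0)"
    proof -
      have par: "\<exists>j<i. c = p (Suc j) \<and> v = p j" if c: "c \<in> ?P" "\<pi> c = v" for c
      proof -
        obtain j where "c = p j" "1 \<le> j" "j \<le> i" using c(1) by auto
        then have j: "j - 1 < i" "c = p (Suc (j - 1))" by auto
        then have "\<pi> c = p (j - 1)" using p unfolding climbs_def by blast
        then show ?thesis using j c(2) by blast
      qed
      show ?thesis
      proof (cases "v \<in> p ` {..<i}")
        case True
        then obtain j where j: "j < i" "v = p j" by auto
        have "{c \<in> ?P. \<pi> c = v} \<subseteq> {p (Suc j)}"
        proof
          fix c assume "c \<in> {c \<in> ?P. \<pi> c = v}"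
          then obtain j' where j': "j' < i" "c = p (Suc j')" "v = p j'" using par by blast
          then have "j' = j" using j p unfolding climbs_def by (auto dest: inj_onD)
          then show "c \<in> {p (Suc j)}" using j' by simp
        qed
        then have "card {c \<in> ?P. \<pi> c = v} \<le> card {p (Suc j)}" by (intro card_mono) auto
        then show ?thesis using True by simp
      next
        case False
        then have e: "{c \<in> ?P. \<pi> c = v} = {}" using par by auto
        show ?thesis unfolding e by simp
      qed
    qed
    ultimately have "int (card {c \<in> C. \<pi> c = v})
        \<le> int (card {c \<in> C - ?P. \<pi> c = v}) + (if v \<in> p ` {..<i} then 1 else 0)"
      by (cases "v \<in> p ` {..<i}") auto
    then show ?thesis unfolding D by linarith
  qed
qed

end

section \<open>Joining two occupied vertices by a path, and the initial good state\<close>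

context bipartite_expander
begin

lemma path_side:
  assumes "\<And>j. j < i \<Longrightarrow> adj (p j) (p (Suc j))"
  shows "p 0 \<in> X \<Longrightarrow> p i \<in> (if even i then X else Y)" "p 0 \<in> Y \<Longrightarrow> p i \<in> (if even i then Y else X)"
proof -
  have "(p 0 \<in> X \<longrightarrow> p i \<in> (if even i then X else Y)) \<and> (p 0 \<in> Y \<longrightarrow> p i \<in> (if even i then Y else X))"
    using assms
  proof (induction i)
    case (Suc i)
    then have "adj (p i) (p (Suc i))" by blast
    then have "p i \<in> X \<Longrightarrow> p (Suc i) \<in> Y" "p i \<in> Y \<Longrightarrow> p (Suc i) \<in> X" by (auto intro: adj_X adj_Y)
    then show ?case using Suc by (auto split: if_splits)
  qed simp
  then show "p 0 \<in> X \<Longrightarrow> p i \<in> (if even i then X else Y)" "p 0 \<in> Y \<Longrightarrow> p i \<in> (if even i then Y else X)"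
    by blast+
qed

lemma climbs_mem: "climbs u i C \<pi> y p \<Longrightarrow> 1 \<le> j \<Longrightarrow> j \<le> i \<Longrightarrow> p j \<in> C"
  unfolding climbs_def by (cases j) auto

lemma tree_level_side:
  assumes "tree W u i L C \<pi>"
  shows "u \<in> X \<Longrightarrow> L \<subseteq> (if even i then X else Y)" "u \<in> Y \<Longrightarrow> L \<subseteq> (if even i then Y else X)"
proof -
  have "(u \<in> X \<longrightarrow> y \<in> (if even i then X else Y)) \<and> (u \<in> Y \<longrightarrow> y \<in> (if even i then Y else X))" if y: "y \<in> L" for y
  proof -
    obtain p where p: "climbs u i C \<pi> y p" using assms y unfolding tree_def by blast
    then have "\<And>j. j < i \<Longrightarrow> adj (p j) (p (Suc j))" "p 0 = u" "p i = y" unfolding climbs_def by auto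
    then show ?thesis using path_side[of i p] by blast
  qed
  then show "u \<in> X \<Longrightarrow> L \<subseteq> (if even i then X else Y)" "u \<in> Y \<Longrightarrow> L \<subseteq> (if even i then Y else X)"
    by blast+
qed

text \<open>Two leaf sets of size at least \<open>m\<close> on opposite sides are joined by an edge \<open>xy\<close> between their
  neighbourhoods, and \<open>x\<close> and \<open>y\<close> can avoid the few vertices whose use would destroy goodness.\<close>

lemma bridge:
  assumes g: "good W w" and W: "finite W" "card W \<le> 5 * \<Delta> * m"
    and S: "S = X \<and> S' = Y \<or> S = Y \<and> S' = X" and L: "L1 \<subseteq> S" "m \<le> card L1" "L2 \<subseteq> S'" "m \<le> card L2"
  shows "\<exists>a\<in>L1. \<exists>b\<in>L2. \<exists>x y. adj a y \<and> adj y x \<and> adj x b \<and> x \<notin> W \<and> y \<notin> W \<and>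
    x \<in> S \<and> y \<in> S' \<and> good (insert x (insert y W)) w"
proof -
  from few_bad[OF g W(2,1) S] obtain B1 where B1: "finite B1" "card B1 \<le> \<Delta> * m"
    "\<And>y. y \<in> S' - B1 - W \<Longrightarrow> good (insert y W) w" by blast
  have S2: "S' = X \<and> S = Y \<or> S' = Y \<and> S = X" using S by blast
  from few_bad[OF g W(2,1) S2] obtain B2 where B2: "finite B2" "card B2 \<le> \<Delta> * m"
    "\<And>y. y \<in> S - B2 - W \<Longrightarrow> good (insert y W) w" by blast
  have sd: "sided L1" "sided L2" using L S unfolding sided_def by auto
  have n1: "nbs L1 \<subseteq> S'" and n2: "nbs L2 \<subseteq> S" using L S nbs_X nbs_Y by blast+
  define Y1 where "Y1 = nbs L1 - (B1 \<union> W)"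
  define X1 where "X1 = nbs L2 - (B2 \<union> W)"
  have \<Delta>m: "\<Delta> * m \<ge> 1" "m \<le> \<Delta> * m" using \<Delta>_ge m_pos by auto
  have "card (B1 \<union> W) \<le> 6 * (\<Delta> * m)" "card (B2 \<union> W) \<le> 6 * (\<Delta> * m)"
    using card_Un_le[of B1 W] card_Un_le[of B2 W] B1 B2 W unfolding mult.assoc by linarith+
  moreover have "card (nbs L1) - card (B1 \<union> W) \<le> card Y1" "card (nbs L2) - card (B2 \<union> W) \<le> card X1"
    unfolding Y1_def X1_def using B1 B2 W by (auto intro!: diff_card_le_card_Diff)
  moreover note card_nbs[OF sd(1) L(2)] card_nbs[OF sd(2) L(4)]
  ultimately have c: "5 * card Y1 + 30 * (\<Delta> * m) \<ge> 3 * s" "5 * card X1 + 30 * (\<Delta> * m) \<ge> 3 * s"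
    by (simp_all only: le_diff_conv)
  have "m \<le> card Y1" using c(1) \<Delta>m s_ge unfolding mult.assoc by linarith
  moreover have "sided Y1" using n1 S unfolding Y1_def sided_def by blast
  ultimately have c3: "3 * s \<le> 5 * card (nbs Y1)" using card_nbs by blast
  have sub: "nbs Y1 \<subseteq> S" "X1 \<subseteq> S"
  proof -
    have "Y1 \<subseteq> S'" using n1 unfolding Y1_def by blast
    then show "nbs Y1 \<subseteq> S" using S nbs_X[of Y1] nbs_Y[of Y1] by auto
    show "X1 \<subseteq> S" using n2 unfolding X1_def by blast
  qed
  \<comment> \<open>Both sets lie in \<open>S\<close>. They have at least 3s/5 and 3s/5 - 6
    \<open>\<Delta> * m\<close> elements, so they meet if s/5 > 6 \<open>\<Delta> * m\<close>. This
    is where the fraction must exceed 1/2 and where the constant 32 > 30 in the locale comes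
    from.\<close>
  have "nbs Y1 \<inter> X1 \<noteq> {}"
  proof
    assume "nbs Y1 \<inter> X1 = {}"
    then have "card (nbs Y1) + card X1 = card (nbs Y1 \<union> X1)"
      using finite_nbs by (simp add: card_Un_disjoint X1_def)
    also have "\<dots> \<le> card S" using sub S finite_X finite_Y by (intro card_mono) auto
    also have "\<dots> = s" using S card_X card_Y by auto
    finally show False using c c3 s_ge \<Delta>m unfolding mult.assoc by linarith
  qed
  then obtain x y where xy: "x \<in> X1" "y \<in> Y1" "adj y x" unfolding nbs_def by blast
  obtain a b where ab: "a \<in> L1" "adj a y" "b \<in> L2" "adj b x"
    using xy unfolding X1_def Y1_def nbs_def by blast
  have mem: "x \<in> S - B2 - W" "y \<in> S' - B1 - W" using xy n1 n2 unfolding X1_def Y1_def by blast+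
  have "good (insert x (insert y W)) w"
    using good_insert2[OF B2(3)[OF mem(1)] B1(3)[OF mem(2)]] S mem by blast
  then show ?thesis using ab xy mem adj_sym by blast
qed

text \<open>The tree at \<open>v\<close> is grown while the one at \<open>u\<close> is still
  occupied, and they are pruned in reverse order. In the end only \<open>u\<close> and
  \<open>v\<close> have paid, one unit each.\<close>

lemma connect:
  assumes g: "good W w" and W: "finite W" "W \<subseteq> X \<union> Y" "card W + 2 * l + 4 * \<Delta> ^ h \<le> 5 * \<Delta> * m"
    and uv: "u \<in> W" "v \<in> W" "u \<noteq> v" "w u \<ge> 1" "w v \<ge> 1"
    and fresh: "\<And>z. z \<in> X \<union> Y - W \<Longrightarrow> w z = int \<Delta>"
    and h: "m \<le> \<Delta> ^ h" "2 * h + 5 \<le> l" and side: "(u \<in> X \<longleftrightarrow> v \<in> X) \<longleftrightarrow> even l"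
  shows "\<exists>p w'. p 0 = u \<and> p l = v \<and> (\<forall>i<l. adj (p i) (p (Suc i))) \<and> inj_on p {1..<l} \<and> p ` {1..<l} \<inter> W = {} \<and>
     good (W \<union> p ` {1..<l}) w' \<and> w' u = w u - 1 \<and> w' v = w v - 1 \<and>
     (\<forall>z. z \<noteq> u \<longrightarrow> z \<noteq> v \<longrightarrow> z \<notin> p ` {1..<l} \<longrightarrow> w' z = w z)"
proof -
  \<comment> \<open>Of the \<open>l\<close> edges, 3 form the bridge, \<open>h + 1\<close> belong to
    the tree at \<open>v\<close> (one unbranched level, then \<open>h\<close> branching ones) and
    \<open>h\<close> to the branching levels at \<open>u\<close>. The rest is the unbranched start
    at \<open>u\<close>, and \<open>2 * h + 5 \<le> l\<close> makes it nonempty.\<close>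
  define i1 where "i1 = l - 3 - (h + 1) - h"
  define k1 where "k1 = i1 + h"
  define k2 where "k2 = 1 + h"
  have l: "l = k1 + k2 + 3" and i1: "i1 \<ge> 1" "i1 \<le> l" using h unfolding i1_def k1_def k2_def by linarith+
  have "card W + i1 \<le> 5 * \<Delta> * m" using i1 W by linarith
  from tree_path[OF g W(1,2) uv(1,4) fresh this] obtain L C \<pi> where
    "tree W u i1 L C \<pi>" "good (W \<union> C) (used w C \<pi>)" "card L = 1" "card C = i1" by blast
  from tree_branch[OF this(1,2) _ this(3,4) W(1,2) fresh, of h] obtain L1 C1 \<pi>1 where
    t1: "tree W u k1 L1 C1 \<pi>1" "good (W \<union> C1) (used w C1 \<pi>1)" "card L1 = \<Delta> ^ h" "card C1 \<le> i1 + 2 * \<Delta> ^ h"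
    using i1 W unfolding k1_def by auto
  have C1W: "C1 \<inter> W = {}" "finite C1" using t1 unfolding tree_def by auto
  have C1XY: "C1 \<subseteq> X \<union> Y" using t1 adj_XY adj_sym unfolding tree_def by blast
  have noch: "{c \<in> C1. \<pi>1 c = z} = {}" if "z \<notin> insert u C1" for z using that t1 unfolding tree_def by blast
  let ?W1 = "W \<union> C1" and ?w1 = "used w C1 \<pi>1"
  have cW1: "card ?W1 \<le> card W + i1 + 2 * \<Delta> ^ h" using card_Un_le[of W C1] t1 by linarith
  have W1: "finite ?W1" "?W1 \<subseteq> X \<union> Y" "v \<in> ?W1" using W C1W C1XY uv by auto
  have nv: "{c \<in> C1. \<pi>1 c = v} = {}" using noch[of v] uv C1W by blast
  have v1: "?w1 v \<ge> 1" unfolding nv using uv by simp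
  have fresh1: "?w1 z = int \<Delta>" if "z \<in> X \<union> Y - ?W1" for z
  proof -
    have nz: "{c \<in> C1. \<pi>1 c = z} = {}" using noch[of z] that uv by blast
    show ?thesis unfolding nz using fresh[of z] that by simp
  qed
  have "card ?W1 + 1 \<le> 5 * \<Delta> * m" using cW1 i1 W(3) l by linarith
  from tree_path[OF t1(2) W1 v1 fresh1 this] obtain L C \<pi> where
    "tree ?W1 v 1 L C \<pi>" "good (?W1 \<union> C) (used ?w1 C \<pi>)" "card L = 1" "card C = 1" by blast
  from tree_branch[OF this(1,2) _ this(3,4) W1(1,2) fresh1, of h] obtain L2 C2 \<pi>2 where
    t2: "tree ?W1 v k2 L2 C2 \<pi>2" "good (?W1 \<union> C2) (used ?w1 C2 \<pi>2)" "card L2 = \<Delta> ^ h" "card C2 \<le> 1 + 2 * \<Delta> ^ h"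
    using cW1 i1 W(3) l unfolding k2_def by auto
  have C2W: "C2 \<inter> W = {}" "C2 \<inter> C1 = {}" "finite C2" using t2 unfolding tree_def by auto
  let ?W2 = "?W1 \<union> C2"
  have cW2: "card ?W2 \<le> 5 * \<Delta> * m"
    using cW1 t2(4) card_Un_le[of ?W1 C2] i1 W(3) l by linarith
  obtain S S' where S: "S = X \<and> S' = Y \<or> S = Y \<and> S' = X" and L12: "L1 \<subseteq> S" "L2 \<subseteq> S'"
  proof -
    \<comment> \<open>The depths add up to \<open>l - 3\<close>, so by \<open>side\<close> the two
      leaf sets are on opposite sides.\<close>
    have "even k1 \<longleftrightarrow> \<not> (even k2 \<longleftrightarrow> even l)" using l by presburger
    then show thesis
      using that[of X Y] that[of Y X] tree_level_side[OF t1(1)] tree_level_side[OF t2(1)] side uv(1,2) W(2) disjoint_XY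
      by (cases "u \<in> X"; cases "v \<in> X"; cases "even k1"; cases "even k2") auto
  qed
  obtain a b x y where ab: "a \<in> L1" "b \<in> L2" "adj a y" "adj y x" "adj x b" "x \<notin> ?W2" "y \<notin> ?W2"
    and xyS: "x \<in> S" "y \<in> S'" and gxy: "good (insert x (insert y ?W2)) (used ?w1 C2 \<pi>2)"
    using bridge[OF t2(2) _ cW2 S L12(1) _ L12(2)] h(1) t1(3) t2(3) W1(1) C2W(3) by auto
  obtain p1 p2 where p1: "climbs u k1 C1 \<pi>1 a p1" and p2: "climbs v k2 C2 \<pi>2 b p2"
    using ab t1(1) t2(1) unfolding tree_def by meson
  have p1C: "p1 ` {1..k1} \<subseteq> C1" and p2C: "p2 ` {1..k2} \<subseteq> C2"
    using climbs_mem[OF p1] climbs_mem[OF p2] by auto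
  have wle: "w z \<le> int \<Delta>" for z using g unfolding good_def by blast
  have "good (?W1 \<union> p2 ` {1..k2} \<union> {x, y}) (\<lambda>z. ?w1 z - (if z \<in> p2 ` {..<k2} then 1 else 0))"
  proof (rule tree_rollback[OF t2(1) ab(2) p2])
    show "good (?W1 \<union> C2 \<union> {x, y}) (used ?w1 C2 \<pi>2)" using gxy by (simp add: insert_commute)
    show "?w1 z \<le> int \<Delta>" for z using wle[of z] by linarith
  qed (use ab W1 in auto)
  then have g1: "good (W \<union> C1 \<union> (p2 ` {1..k2} \<union> {x, y})) (used (\<lambda>z. w z - (if z \<in> p2 ` {..<k2} then 1 else 0)) C1 \<pi>1)"
    by (simp add: Un_assoc algebra_simps)
  let ?w' = "\<lambda>z. w z - (if z \<in> p2 ` {..<k2} then 1 else 0) - (if z \<in> p1 ` {..<k1} then 1 else 0)"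
  have g2: "good (W \<union> p1 ` {1..k1} \<union> (p2 ` {1..k2} \<union> {x, y})) ?w'"
  proof (rule tree_rollback[OF t1(1) ab(1) p1 g1])
    show "w z - (if z \<in> p2 ` {..<k2} then 1 else 0) \<le> int \<Delta>" for z using wle[of z] by auto
    show "(p2 ` {1..k2} \<union> {x, y}) \<inter> C1 = {}" using p2C C2W ab by auto
  qed (use W in auto)
  \<comment> \<open>The second branch runs backwards, from its leaf \<open>b\<close> at index
    \<open>k1 + 3\<close> to \<open>v\<close> at index \<open>l\<close>.\<close>
  define p where "p = (\<lambda>i. if i \<le> k1 then p1 i else if i = k1 + 1 then y else if i = k1 + 2 then x else p2 (l - i))"
  have im: "p ` {1..<l} = p1 ` {1..k1} \<union> (p2 ` {1..k2} \<union> {x, y})"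
  proof -
    have "{1..<l} = {1..k1} \<union> {k1 + 1, k1 + 2} \<union> {k1 + 3..<l}" using l by auto
    moreover have "p ` {1..k1} = p1 ` {1..k1}" by (auto simp: p_def)
    moreover have "p ` {k1 + 1, k1 + 2} = {x, y}" by (auto simp: p_def)
    moreover have "p ` {k1 + 3..<l} = p2 ` {1..k2}"
    proof -
      have "p ` {k1 + 3..<l} = p2 ` ((\<lambda>i. l - i) ` {k1 + 3..<l})"
        unfolding image_image by (intro image_cong) (auto simp: p_def)
      also have "(\<lambda>i. l - i) ` {k1 + 3..<l} = {1..k2}"
      proof (intro equalityI subsetI)
        fix j assume "j \<in> {1..k2}"
        then show "j \<in> (\<lambda>i. l - i) ` {k1 + 3..<l}" using l by (intro image_eqI[of _ _ "l - j"]) auto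
      qed (use l in auto)
      finally show ?thesis .
    qed
    ultimately show ?thesis by (simp only: image_Un) blast
  qed
  have inj: "inj_on p {1..<l}"
  proof (rule eq_card_imp_inj_on)
    have i1: "inj_on p1 {1..k1}" "inj_on p2 {1..k2}"
      using p1 p2 unfolding climbs_def by (auto elim: inj_on_subset)
    have xy: "x \<noteq> y" using xyS S disjoint_XY by blast
    have "card (p2 ` {1..k2} \<union> {x, y}) = k2 + 2"
      using i1(2) xy p2C ab by (subst card_Un_disjoint) (auto simp: card_image)
    moreover have "p1 ` {1..k1} \<inter> (p2 ` {1..k2} \<union> {x, y}) = {}" using p1C p2C C2W ab by blast
    ultimately have "card (p1 ` {1..k1} \<union> (p2 ` {1..k2} \<union> {x, y})) = k1 + (k2 + 2)"
      using i1(1) by (subst card_Un_disjoint) (auto simp: card_image)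
    then show "card (p ` {1..<l}) = card {1..<l}" unfolding im using l by simp
  qed simp
  have adjp: "adj (p i) (p (Suc i))" if il: "i < l" for i
  proof -
    consider "i < k1" | "i = k1" | "i = k1 + 1" | "i = k1 + 2" | "k1 + 3 \<le> i" by linarith
    then show ?thesis
    proof cases
      case 1 then show ?thesis using p1 unfolding p_def climbs_def by auto
    next
      case 2 then show ?thesis using p1 ab unfolding p_def climbs_def by auto
    next
      case 3 then show ?thesis using ab unfolding p_def by auto
    next
      case 4
      then have "l - Suc i = k2" using l by simp
      then show ?thesis using 4 p2 ab unfolding p_def climbs_def by auto
    next
      case 5
      obtain j where j: "l - i = Suc j" "l - Suc i = j" "j < k2" using 5 il l by (cases "l - i") auto
      have "adj (p2 j) (p2 (Suc j))" using p2 j unfolding climbs_def by blast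
      then show ?thesis using 5 j adj_sym unfolding p_def by auto
    qed
  qed
  have fresh_p: "p ` {1..<l} \<inter> W = {}"
    unfolding im using p1C p2C C1W C2W ab by blast
  have ends: "p 0 = u" "p l = v" using p1 p2 l unfolding p_def climbs_def by auto
  have k12: "k1 \<ge> 1" "k2 \<ge> 1" using i1 unfolding k1_def k2_def by auto
  have un: "u \<in> p1 ` {..<k1}" "v \<in> p2 ` {..<k2}"
    using p1 p2 k12 unfolding climbs_def by (auto intro: image_eqI[of _ _ 0])
  have sub1: "p1 ` {..<k1} \<subseteq> insert u (p1 ` {1..k1})"
  proof
    fix z assume "z \<in> p1 ` {..<k1}"
    then obtain j where "z = p1 j" "j < k1" by auto
    then show "z \<in> insert u (p1 ` {1..k1})" using p1 unfolding climbs_def by (cases j) auto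
  qed
  have sub2: "p2 ` {..<k2} \<subseteq> insert v (p2 ` {1..k2})"
  proof
    fix z assume "z \<in> p2 ` {..<k2}"
    then obtain j where "z = p2 j" "j < k2" by auto
    then show "z \<in> insert v (p2 ` {1..k2})" using p2 unfolding climbs_def by (cases j) auto
  qed
  have "u \<notin> p2 ` {..<k2}" "v \<notin> p1 ` {..<k1}"
  proof -
    have "u \<notin> insert v C2" "v \<notin> insert u C1" using C1W(1) C2W(1) uv(1-3) by auto
    then show "u \<notin> p2 ` {..<k2}" "v \<notin> p1 ` {..<k1}"
      using subset_trans[OF sub2 insert_mono[OF p2C]] subset_trans[OF sub1 insert_mono[OF p1C]] by (meson subsetD)+
  qed
  then have "?w' u = w u - 1" "?w' v = w v - 1" using un by simp_all
  moreover have "?w' z = w z" if "z \<noteq> u" "z \<noteq> v" "z \<notin> p ` {1..<l}" for z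
  proof -
    have "z \<notin> insert u (p1 ` {1..k1})" "z \<notin> insert v (p2 ` {1..k2})" using that unfolding im by auto
    then have "z \<notin> p1 ` {..<k1}" "z \<notin> p2 ` {..<k2}" using sub1 sub2 by (meson subsetD)+
    then show ?thesis by simp
  qed
  moreover have "good (W \<union> p ` {1..<l}) ?w'" using g2 unfolding im by (simp add: Un_assoc)
  ultimately show ?thesis
    using ends adjp inj fresh_p by (intro exI[of _ p] exI[of _ ?w'] conjI allI impI) simp_all
qed

text \<open>A maximal pair of small badly expanding sets is taken out; everything outside it expands.\<close>

lemma initial_good:
  "\<exists>Z w. Z \<subseteq> X \<union> Y \<and> card Z \<le> 2 * m \<and> good Z w \<and> (\<forall>v. v \<notin> Z \<longrightarrow> w v = int \<Delta>)"
proof -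
  define P where "P = (\<lambda>(A, B). A \<subseteq> X \<and> B \<subseteq> Y \<and> card A \<le> m \<and> card B \<le> m \<and>
     card (nbs A - B) \<le> \<Delta> * card A \<and> card (nbs B - A) \<le> \<Delta> * card B)"
  have "P ({}, {})" unfolding P_def by (auto simp: nbs_def)
  moreover have "\<forall>q. P q \<longrightarrow> card (fst q) + card (snd q) < 2 * m + 1" unfolding P_def by auto
  ultimately obtain q where q: "P q" "\<forall>q'. P q' \<longrightarrow> card (fst q') + card (snd q') \<le> card (fst q) + card (snd q)"
    using ex_has_greatest_nat[of P "({}, {})" "\<lambda>q. card (fst q) + card (snd q)" "2 * m + 1"] by (metis less_or_eq_imp_le)
  obtain A B where AB: "q = (A, B)" by (cases q)
  have A: "A \<subseteq> X" "card A \<le> m" "card (nbs A - B) \<le> \<Delta> * card A"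
    and B: "B \<subseteq> Y" "card B \<le> m" "card (nbs B - A) \<le> \<Delta> * card B" using q AB unfolding P_def by auto
  have fin: "finite A" "finite B" using A B finite_X finite_Y finite_subset by blast+
  have max: "card A' + card B' \<le> card A + card B" if "P (A', B')" for A' B' using q AB that by fastforce
  have \<Delta>m: "\<Delta> * m \<ge> 1" "m \<le> \<Delta> * m" using \<Delta>_ge m_pos by auto
  \<comment> \<open>If \<open>U\<close> expanded badly, so would \<open>A' \<union> U\<close>: with
    at most \<open>m\<close> elements it contradicts maximality, with more (at most
    \<open>2 * m\<close>) it contradicts the expansion of the graph.\<close>
  have key: "\<Delta> * card U \<le> card (nbs U - B')"
    if U: "sided U" "U \<inter> A' = {}" "card U \<le> m" and A': "finite A'" "sided (A' \<union> U)" "card A' \<le> m" "card (nbs A' - B') \<le> \<Delta> * card A'"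
      and B': "card B' \<le> m" "finite B'" 
      and mx: "card (A' \<union> U) \<le> m \<Longrightarrow> card (nbs (A' \<union> U) - B') \<le> \<Delta> * card (A' \<union> U) \<Longrightarrow> card U = 0" for U A' B'
  proof (rule ccontr)
    assume "\<not> ?thesis"
    then have lt: "card (nbs U - B') < \<Delta> * card U" by simp
    have cU: "card (A' \<union> U) = card A' + card U"
      using U sided_finite A' by (intro card_Un_disjoint) auto
    have "card (nbs (A' \<union> U) - B') \<le> card (nbs A' - B') + card (nbs U - B')"
      by (metis Un_Diff card_Un_le nbs_Un)
    then have le: "card (nbs (A' \<union> U) - B') \<le> \<Delta> * card (A' \<union> U)"
      using A'(4) lt unfolding cU distrib_left by linarith
    show False
    proof (cases "card (A' \<union> U) \<le> m")
      case True
      then show False using mx le lt by simp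
    next
      case False
      then have "3 * s \<le> 5 * card (nbs (A' \<union> U))" using card_nbs[OF A'(2)] by simp
      moreover have "card (nbs (A' \<union> U)) - card B' \<le> card (nbs (A' \<union> U) - B')"
        using B' by (intro diff_card_le_card_Diff)
      moreover have "\<Delta> * card (A' \<union> U) \<le> \<Delta> * (2 * m)" using cU A'(3) U(3) by (intro mult_le_mono2) simp
      then have "\<Delta> * card (A' \<union> U) \<le> 2 * (\<Delta> * m)" by (simp add: algebra_simps)
      ultimately show False using le B'(1) \<Delta>m s_ge unfolding mult.assoc by linarith
    qed
  qed
  define Z where "Z = A \<union> B"
  \<comment> \<open>Demand 0 discards \<open>Z\<close>: it stays occupied and the embedding avoids
    it.\<close>
  define w where "w = (\<lambda>v. if v \<in> Z then 0 else int \<Delta>)"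
  have "good Z w"
    unfolding good_def
  proof (intro conjI allI impI)
    show "w v \<le> int \<Delta>" for v unfolding w_def by simp
    fix U assume U: "sided U" "card U \<le> m"
    have fU: "finite U" using U sided_finite by blast
    have cU: "card (U - Z) \<le> m" using card_mono[of U "U - Z"] fU U by auto
    have "sum w U = sum w (U - Z)" using fU by (intro sum.mono_neutral_right) (auto simp: w_def)
    also have "\<dots> = int (\<Delta> * card (U - Z))" unfolding w_def by (simp add: mult.commute)
    finally have sw: "sum w U = int (\<Delta> * card (U - Z))" .
    have "\<Delta> * card (U - Z) \<le> card (nbs (U - Z) - Z)"
    proof (cases "U \<subseteq> X")
      case True
      have "\<Delta> * card (U - Z) \<le> card (nbs (U - Z) - B)"
      proof (rule key[where A' = A])
        assume a: "card (A \<union> (U - Z)) \<le> m" "card (nbs (A \<union> (U - Z)) - B) \<le> \<Delta> * card (A \<union> (U - Z))"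
        \<comment> \<open>Enlarging \<open>A\<close> can only shrink \<open>nbs B - A\<close>, so
          the other half of the pair stays admissible.\<close>
        have "card (nbs B - (A \<union> (U - Z))) \<le> card (nbs B - A)" using finite_nbs by (intro card_mono) auto
        then have "P (A \<union> (U - Z), B)" using a A B True unfolding P_def by auto
        then have "card (A \<union> (U - Z)) \<le> card A" using max by fastforce
        moreover have "card (A \<union> (U - Z)) = card A + card (U - Z)"
          using fin fU unfolding Z_def by (intro card_Un_disjoint) auto
        ultimately show "card (U - Z) = 0" by simp
      qed (use U A B True fin cU in \<open>auto simp: Z_def sided_def\<close>)
      also have "nbs (U - Z) - B = nbs (U - Z) - Z"
        using nbs_X[of "U - Z"] True A disjoint_XY unfolding Z_def by blast
      finally show ?thesis .
    next
      case False
      then have UY: "U \<subseteq> Y" using U unfolding sided_def by blast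
      have "\<Delta> * card (U - Z) \<le> card (nbs (U - Z) - A)"
      proof (rule key[where A' = B])
        assume a: "card (B \<union> (U - Z)) \<le> m" "card (nbs (B \<union> (U - Z)) - A) \<le> \<Delta> * card (B \<union> (U - Z))"
        have "card (nbs A - (B \<union> (U - Z))) \<le> card (nbs A - B)" using finite_nbs by (intro card_mono) auto
        then have "P (A, B \<union> (U - Z))" using a A B UY unfolding P_def by auto
        then have "card (B \<union> (U - Z)) \<le> card B" using max by fastforce
        moreover have "card (B \<union> (U - Z)) = card B + card (U - Z)"
          using fin fU unfolding Z_def by (intro card_Un_disjoint) auto
        ultimately show "card (U - Z) = 0" by simp
      qed (use U A B UY fin cU in \<open>auto simp: Z_def sided_def\<close>)
      also have "nbs (U - Z) - A = nbs (U - Z) - Z"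
        using nbs_Y[of "U - Z"] UY B disjoint_XY unfolding Z_def by blast
      finally show ?thesis .
    qed
    also have "\<dots> \<le> card (nbs U - Z)" using finite_nbs nbs_mono[of "U - Z" U] by (intro card_mono) auto
    finally show "sum w U \<le> int (card (nbs U - Z))" unfolding sw by (simp only: of_nat_le_iff)
  qed
  moreover have "card Z \<le> 2 * m" using A B card_Un_le[of A B] unfolding Z_def by linarith
  moreover have "Z \<subseteq> X \<union> Y" using A B unfolding Z_def by blast
  ultimately show ?thesis unfolding w_def by (intro exI[of _ Z] exI[of _ "\<lambda>v. if v \<in> Z then 0 else int \<Delta>"]) auto
qed

lemma add_free:
  assumes g: "good W w" and W: "finite W" "card W \<le> 5 * \<Delta> * m"
  shows "\<exists>x\<in>X - W. good (insert x W) w" "\<exists>y\<in>Y - W. good (insert y W) w"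
proof -
  have \<Delta>m: "\<Delta> * m \<ge> 1" using \<Delta>_ge m_pos by auto
  have "\<exists>x\<in>S' - W. good (insert x W) w" if S: "S = X \<and> S' = Y \<or> S = Y \<and> S' = X" for S S'
  proof -
    from few_bad[OF g W(2,1) S] obtain B1 where B1: "finite B1" "card B1 \<le> \<Delta> * m"
      "\<And>y. y \<in> S' - B1 - W \<Longrightarrow> good (insert y W) w" by blast
    have "card S' = s" using S card_X card_Y by auto
    then have "\<not> S' \<subseteq> B1 \<union> W"
      using card_mono[of "B1 \<union> W" S'] card_Un_le[of B1 W] B1 W s_ge \<Delta>m unfolding mult.assoc by auto
    then show ?thesis using B1(3) by blast
  qed
  from this[of Y X] this[of X Y] show "\<exists>x\<in>X - W. good (insert x W) w" "\<exists>y\<in>Y - W. good (insert y W) w" by blast+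
qed

end

section \<open>Embedding a long subdivision\<close>

lemma subdiv_vertex_mem:
  assumes H: "finite_sgraph H" and e: "e \<in> edges H" "i \<le> \<sigma> e"
  shows "subdiv_vertex \<sigma> e i \<in> verts (subdivision H \<sigma>)"
proof -
  have "e \<in> [verts H]\<^bsup>2\<^esup>" using H e by (auto simp: finite_sgraph_def)
  then have "end1 e \<in> verts H" "end2 e \<in> verts H"
    using end1_end2(1)[of e "verts H"] by (auto simp: nsets_def)
  then show ?thesis using e by (auto simp: subdiv_vertex_def verts_edges_subdivision)
qed

lemma subdivision_parity:
  assumes H: "finite_sgraph H" and e: "e \<in> edges H"
    and AB: "A \<inter> B = {}" "\<forall>f\<in>edges (subdivision H \<sigma>). \<exists>a\<in>A. \<exists>b\<in>B. f = {a, b}" and i: "i \<le> \<sigma> e"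
  shows "subdiv_vertex \<sigma> e i \<in> A \<longleftrightarrow> (subdiv_vertex \<sigma> e 0 \<in> A \<longleftrightarrow> even i)"
  using i
proof (induction i)
  case (Suc i)
  have "{subdiv_vertex \<sigma> e i, subdiv_vertex \<sigma> e (Suc i)} \<in> edges (subdivision H \<sigma>)"
    using e Suc.prems unfolding verts_edges_subdivision mem_Collect_eq
    by (intro exI[of _ e] exI[of _ i]) auto
  then obtain a b where "a \<in> A" "b \<in> B" "{subdiv_vertex \<sigma> e i, subdiv_vertex \<sigma> e (Suc i)} = {a, b}"
    using AB(2) by blast
  then have "subdiv_vertex \<sigma> e (Suc i) \<in> A \<longleftrightarrow> subdiv_vertex \<sigma> e i \<notin> A"
    using AB(1) by (auto simp: doubleton_eq_iff)
  then show ?case using Suc by auto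
qed simp

lemma subdivision_length_le:
  assumes H: "finite_sgraph H" and e: "e \<in> edges H"
  shows "\<sigma> e \<le> card (verts (subdivision H \<sigma>))"
proof -
  have fin: "finite (verts (subdivision H \<sigma>))"
    using finite_sgraph_subdivision[OF H] unfolding finite_sgraph_def by blast
  have "inj_on (subdiv_vertex \<sigma> e) {..<\<sigma> e}"
    by (auto simp: inj_on_def subdiv_vertex_def split: if_splits)
  then have "card (subdiv_vertex \<sigma> e ` {..<\<sigma> e}) = \<sigma> e" by (simp add: card_image)
  moreover have "subdiv_vertex \<sigma> e ` {..<\<sigma> e} \<subseteq> verts (subdivision H \<sigma>)"
    using subdiv_vertex_mem[OF H e] by auto
  ultimately show ?thesis using card_mono[OF fin] by metis
qed

context bipartite_expander
begin

text \<open>Serves the branch vertices, which are placed before any edge. \<open>P\<close> will be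
  membership in one part of the bipartition, so that the later path lengths have the right
  parity.\<close>

lemma place_vertices:
  assumes g: "good Z w" and Z: "finite Z" and V: "finite V" "card Z + card V \<le> 5 * \<Delta> * m"
  shows "\<exists>\<psi>. inj_on \<psi> V \<and> \<psi> ` V \<subseteq> X \<union> Y - Z \<and> (\<forall>v\<in>V. \<psi> v \<in> X \<longleftrightarrow> P v) \<and> good (Z \<union> \<psi> ` V) w"
  using V
proof (induction V)
  case empty
  then show ?case using g by simp
next
  case (insert v V)
  then obtain \<psi> where \<psi>: "inj_on \<psi> V" "\<psi> ` V \<subseteq> X \<union> Y - Z" "\<forall>v\<in>V. \<psi> v \<in> X \<longleftrightarrow> P v" "good (Z \<union> \<psi> ` V) w"
    by auto
  have "card (Z \<union> \<psi> ` V) \<le> card Z + card V"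
    using card_Un_le[of Z "\<psi> ` V"] card_image_le[OF insert.hyps(1), of \<psi>] by linarith
  then have "card (Z \<union> \<psi> ` V) \<le> 5 * \<Delta> * m" using insert by simp
  moreover have "finite (Z \<union> \<psi> ` V)" using insert Z by simp
  ultimately obtain x where x: "x \<in> X \<union> Y" "x \<notin> Z \<union> \<psi> ` V" "x \<in> X \<longleftrightarrow> P v" "good (insert x (Z \<union> \<psi> ` V)) w"
    using add_free[OF \<psi>(4)] disjoint_XY by (cases "P v") blast+
  let ?\<psi> = "\<psi>(v := x)"
  have im: "?\<psi> ` V = \<psi> ` V" using insert.hyps(2) by auto
  have "inj_on ?\<psi> (insert v V)"
    using \<psi>(1) x insert.hyps(2) im by (auto simp: inj_on_def)
  moreover have "?\<psi> ` insert v V \<subseteq> X \<union> Y - Z" using \<psi>(2) x im by auto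
  moreover have "\<forall>z\<in>insert v V. ?\<psi> z \<in> X \<longleftrightarrow> P z" using \<psi>(3) x insert.hyps(2) by auto
  moreover have "good (Z \<union> ?\<psi> ` insert v V) w" unfolding image_insert im fun_upd_same using x(4) by simp
  ultimately show ?case by blast
qed

lemma embed_subdivision:
  fixes H :: "'a sgraph"
  assumes H: "finite_sgraph H" and deg: "\<And>v. v \<in> verts H \<Longrightarrow> degree H v \<le> \<Delta>"
    and n: "card (verts (subdivision H \<sigma>)) \<le> m" and bip: "bipartite (subdivision H \<sigma>)"
    and h: "m \<le> \<Delta> ^ h" "\<Delta> ^ h \<le> \<Delta> * m" and \<sigma>: "\<And>e. e \<in> edges H \<Longrightarrow> 2 * h + 5 \<le> \<sigma> e"
  shows "\<exists>\<phi>. inj_on \<phi> (verts (subdivision H \<sigma>)) \<and> \<phi> ` verts (subdivision H \<sigma>) \<subseteq> X \<union> Y \<and>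
    (\<forall>e\<in>edges H. \<forall>i<\<sigma> e. adj (\<phi> (subdiv_vertex \<sigma> e i)) (\<phi> (subdiv_vertex \<sigma> e (Suc i))))"
proof -
  obtain A B where AB: "A \<inter> B = {}" "\<forall>f\<in>edges (subdivision H \<sigma>). \<exists>a\<in>A. \<exists>b\<in>B. f = {a, b}"
    using bip unfolding bipartite_def by blast
  obtain Z w0 where Z: "Z \<subseteq> X \<union> Y" "card Z \<le> 2 * m" and g0: "good Z w0" and w0: "\<And>v. v \<notin> Z \<Longrightarrow> w0 v = int \<Delta>"
    using initial_good by blast
  have fZ: "finite Z" using Z finite_X finite_Y by (meson finite_Un finite_subset)
  define V where "V = (\<lambda>E'. Inl ` verts H \<union> {Inr (e, i) | e i. e \<in> E' \<and> 0 < i \<and> i < \<sigma> e} :: ('a + 'a set \<times> nat) set)"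
  have V_all: "V (edges H) = verts (subdivision H \<sigma>)" unfolding V_def verts_edges_subdivision ..
  have fF: "finite (verts (subdivision H \<sigma>))"
    using finite_sgraph_subdivision[OF H] unfolding finite_sgraph_def by blast
  have Vsub: "V E' \<subseteq> verts (subdivision H \<sigma>)" if "E' \<subseteq> edges H" for E'
    using that unfolding V_all[symmetric] V_def by blast
  have fE: "finite (edges H)"
    using H finite_imp_finite_nsets finite_subset unfolding finite_sgraph_def by metis
  have ends: "end1 e \<in> verts H" "end2 e \<in> verts H" "end1 e \<noteq> end2 e" "end1 e \<in> e" "end2 e \<in> e" "e = {end1 e, end2 e}"
    if "e \<in> edges H" for e
  proof -
    have "e \<in> [verts H]\<^bsup>2\<^esup>" using H that by (auto simp: finite_sgraph_def)
    then have "e \<subseteq> verts H" and e: "e = {end1 e, end2 e}" "end1 e \<noteq> end2 e"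
      using end1_end2[of e "verts H"] by (auto simp: nsets_def)
    show "end1 e \<noteq> end2 e" "e = {end1 e, end2 e}" by fact+
    show "end1 e \<in> e" "end2 e \<in> e" by (subst e(1), simp)+
    then show "end1 e \<in> verts H" "end2 e \<in> verts H" using \<open>e \<subseteq> verts H\<close> by blast+
  qed
  \<comment> \<open>The last clause lets a branch vertex pay one unit per embedded edge, so a degree
    of at most \<open>\<Delta>\<close> always leaves a unit for the next one. The clause on
    \<open>A\<close> supplies the parity condition of \<open>connect\<close>.\<close>
  define Inv where "Inv = (\<lambda>E' (\<phi> :: 'a + 'a set \<times> nat \<Rightarrow> 'v) w. inj_on \<phi> (V E') \<and> \<phi> ` V E' \<subseteq> X \<union> Y - Z \<and>
     (\<forall>z\<in>V E'. \<phi> z \<in> X \<longleftrightarrow> z \<in> A) \<and>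
     (\<forall>e\<in>E'. \<forall>i<\<sigma> e. adj (\<phi> (subdiv_vertex \<sigma> e i)) (\<phi> (subdiv_vertex \<sigma> e (Suc i)))) \<and>
     good (Z \<union> \<phi> ` V E') w \<and> (\<forall>z. z \<notin> Z \<union> \<phi> ` V E' \<longrightarrow> w z = int \<Delta>) \<and>
     (\<forall>x\<in>verts H. w (\<phi> (Inl x)) = int \<Delta> - int (card {e\<in>E'. x \<in> e})))"
  have "\<exists>\<phi> w. Inv E' \<phi> w" if "finite E'" "E' \<subseteq> edges H" for E'
    using that
  proof (induction E')
    case empty
    have fV: "finite (V {})" using Vsub[of "{}"] fF finite_subset by blast
    have "card (V {}) \<le> m" using card_mono[OF fF Vsub[of "{}"]] n by simp
    moreover have "m \<le> \<Delta> * m" using \<Delta>_ge by simp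
    ultimately have "card Z + card (V {}) \<le> 5 * \<Delta> * m" using Z unfolding mult.assoc by linarith
    from place_vertices[OF g0 fZ fV this, of "\<lambda>z. z \<in> A"] obtain \<phi> where
      \<phi>: "inj_on \<phi> (V {})" "\<phi> ` V {} \<subseteq> X \<union> Y - Z" "\<forall>v\<in>V {}. \<phi> v \<in> X \<longleftrightarrow> v \<in> A" "good (Z \<union> \<phi> ` V {}) w0" by blast
    have "w0 (\<phi> (Inl x)) = int \<Delta>" if "x \<in> verts H" for x
      using \<phi>(2) w0 that unfolding V_def by blast
    then have "Inv {} \<phi> w0" unfolding Inv_def using \<phi> w0 by simp
    then show ?case by blast
  next
    case (insert e E')
    then obtain \<phi> w where inv: "Inv E' \<phi> w" by blast
    have e: "e \<in> edges H" and E': "E' \<subseteq> edges H" using insert by auto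
    note en = ends[OF e]
    define u where "u = \<phi> (Inl (end1 e))"
    define v where "v = \<phi> (Inl (end2 e))"
    define W where "W = Z \<union> \<phi> ` V E'"
    have inj: "inj_on \<phi> (V E')" and ran: "\<phi> ` V E' \<subseteq> X \<union> Y - Z" and sd: "\<And>z. z \<in> V E' \<Longrightarrow> \<phi> z \<in> X \<longleftrightarrow> z \<in> A"
      and ad: "\<And>f i. f \<in> E' \<Longrightarrow> i < \<sigma> f \<Longrightarrow> adj (\<phi> (subdiv_vertex \<sigma> f i)) (\<phi> (subdiv_vertex \<sigma> f (Suc i)))"
      and g: "good W w" and fresh: "\<And>z. z \<notin> W \<Longrightarrow> w z = int \<Delta>"
      and wt: "\<And>x. x \<in> verts H \<Longrightarrow> w (\<phi> (Inl x)) = int \<Delta> - int (card {f\<in>E'. x \<in> f})"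
      using inv unfolding Inv_def W_def by blast+
    have InlV: "Inl x \<in> V E'" if "x \<in> verts H" for x using that unfolding V_def by blast
    have fV: "finite (V E')" using Vsub[OF E'] fF finite_subset by blast
    have W: "finite W" "W \<subseteq> X \<union> Y" using fZ fV Z ran unfolding W_def by auto
    have cV: "card (\<phi> ` V E') \<le> m"
      using card_image_le[OF fV, of \<phi>] card_mono[OF fF Vsub[OF E']] n by linarith
    have lm: "\<sigma> e \<le> m" using subdivision_length_le[OF H e, of \<sigma>] n by linarith
    \<comment> \<open>The budget: \<open>2 * m\<close> for \<open>Z\<close>, \<open>m\<close> for
      the embedded part, \<open>2 * m\<close> for \<open>2 * \<sigma> e\<close>, and
      \<open>4 * \<Delta> * m\<close> for the two trees.\<close>
    have "5 * m \<le> \<Delta> * m" using \<Delta>_ge by simp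
    then have cW: "card W + 2 * \<sigma> e + 4 * \<Delta> ^ h \<le> 5 * \<Delta> * m"
      using card_Un_le[of Z "\<phi> ` V E'"] cV Z(2) lm h(2) unfolding W_def mult.assoc by linarith
    have l0: "\<sigma> e > 0" using \<sigma>[OF e] by simp
    have sv0: "subdiv_vertex \<sigma> e 0 = Inl (end1 e)" and svl: "subdiv_vertex \<sigma> e (\<sigma> e) = Inl (end2 e)"
      using l0 by (auto simp: subdiv_vertex_def)
    have uv: "u \<in> W" "v \<in> W" "u \<noteq> v"
      using InlV en inj_onD[OF inj, of "Inl (end1 e)" "Inl (end2 e)"] unfolding u_def v_def W_def by auto
    have w1: "w (\<phi> (Inl x)) \<ge> 1" if x: "x \<in> e" "x \<in> verts H" for x
    proof -
      have "insert e {f\<in>E'. x \<in> f} \<subseteq> {f\<in>edges H. x \<in> f}" using x e E' by blast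
      then have "card (insert e {f\<in>E'. x \<in> f}) \<le> degree H x"
        unfolding degree_def using fE by (intro card_mono) auto
      then have "Suc (card {f\<in>E'. x \<in> f}) \<le> \<Delta>" using insert.hyps deg[OF x(2)] by simp
      then show ?thesis using wt[OF x(2)] by linarith
    qed
    have side: "(u \<in> X \<longleftrightarrow> v \<in> X) \<longleftrightarrow> even (\<sigma> e)"
      using subdivision_parity[OF H e AB, of "\<sigma> e"] sv0 svl sd[OF InlV[OF en(1)]] sd[OF InlV[OF en(2)]]
      unfolding u_def v_def by auto
    have w1u: "w u \<ge> 1" "w v \<ge> 1" using w1 en unfolding u_def v_def by auto
    obtain p w' where p: "p 0 = u" "p (\<sigma> e) = v" "\<And>i. i < \<sigma> e \<Longrightarrow> adj (p i) (p (Suc i))"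
        "inj_on p {1..<\<sigma> e}" "p ` {1..<\<sigma> e} \<inter> W = {}"
      and g': "good (W \<union> p ` {1..<\<sigma> e}) w'" and w': "w' u = w u - 1" "w' v = w v - 1"
        "\<And>z. z \<noteq> u \<Longrightarrow> z \<noteq> v \<Longrightarrow> z \<notin> p ` {1..<\<sigma> e} \<Longrightarrow> w' z = w z"
      using connect[OF g W cW uv w1u _ h(1) \<sigma>[OF e] side] fresh by (metis (no_types, lifting) DiffD2)
    define \<phi>' where "\<phi>' = (\<lambda>z. case z of Inl x \<Rightarrow> \<phi> z | Inr (f, i) \<Rightarrow> if f = e then p i else \<phi> z)"
    define N where "N = (\<lambda>i. Inr (e, i) :: 'a + 'a set \<times> nat) ` {1..<\<sigma> e}"
    have Vi: "V (insert e E') = V E' \<union> N" unfolding V_def N_def by auto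
    have old: "\<phi>' z = \<phi> z" if "z \<in> V E'" for z
      using that insert.hyps(2) unfolding V_def \<phi>'_def by (auto split: sum.splits)
    have new: "\<phi>' (Inr (e, i)) = p i" for i unfolding \<phi>'_def by simp
    have imo: "\<phi>' ` V E' = \<phi> ` V E'" using old by (intro image_cong) auto
    have imn: "\<phi>' ` N = p ` {1..<\<sigma> e}" unfolding N_def image_image new ..
    have im: "\<phi>' ` V (insert e E') = \<phi> ` V E' \<union> p ` {1..<\<sigma> e}" unfolding Vi image_Un imo imn ..
    have W': "Z \<union> \<phi>' ` V (insert e E') = W \<union> p ` {1..<\<sigma> e}" unfolding im W_def by blast
    have path: "\<phi>' (subdiv_vertex \<sigma> e i) = p i" if "i \<le> \<sigma> e" for i
      using p(1,2) old[OF InlV[OF en(1)]] old[OF InlV[OF en(2)]] new[of i] unfolding subdiv_vertex_def u_def v_def by auto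
    have pXY: "p i \<in> X \<union> Y" if "i < \<sigma> e" for i using p(3)[OF that] adj_XY by blast
    have "inj_on \<phi>' (V E')" using inj old by (auto simp: inj_on_def)
    moreover have "inj_on \<phi>' N" using p(4) new unfolding N_def by (auto simp: inj_on_def)
    moreover have "\<phi>' ` V E' \<inter> \<phi>' ` N = {}" using p(5) unfolding imo imn W_def by blast
    ultimately have 1: "inj_on \<phi>' (V (insert e E'))"
      unfolding Vi by (subst inj_on_Un) blast
    have 2: "\<phi>' ` V (insert e E') \<subseteq> X \<union> Y - Z"
    proof -
      have "p ` {1..<\<sigma> e} \<subseteq> X \<union> Y" using pXY by (simp add: image_subset_iff)
      then show ?thesis unfolding im using ran p(5) unfolding W_def by blast
    qed
    have 3: "\<phi>' z \<in> X \<longleftrightarrow> z \<in> A" if z: "z \<in> V (insert e E')" for z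
    proof (cases "z \<in> V E'")
      case True
      then show ?thesis using sd old by simp
    next
      case False
      then obtain i where i: "z = Inr (e, i)" "1 \<le> i" "i < \<sigma> e" using z unfolding Vi N_def by auto
      have zs: "z = subdiv_vertex \<sigma> e i" using i unfolding subdiv_vertex_def by auto
      have "p i \<in> X \<longleftrightarrow> (u \<in> X \<longleftrightarrow> even i)"
      proof -
        have "u \<in> X \<or> u \<in> Y" using uv W by blast
        moreover have "\<And>j. j < i \<Longrightarrow> adj (p j) (p (Suc j))" using p(3) i by simp
        ultimately show ?thesis using path_side[of i p] p(1) disjoint_XY by (auto split: if_splits)
      qed
      moreover have "z \<in> A \<longleftrightarrow> (Inl (end1 e) \<in> A \<longleftrightarrow> even i)"
        using subdivision_parity[OF H e AB, of i] zs i sv0 by auto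
      moreover have "u \<in> X \<longleftrightarrow> Inl (end1 e) \<in> A" using sd[OF InlV[OF en(1)]] unfolding u_def .
      ultimately show ?thesis using new i by simp
    qed
    have 4: "adj (\<phi>' (subdiv_vertex \<sigma> f i)) (\<phi>' (subdiv_vertex \<sigma> f (Suc i)))" if f: "f \<in> insert e E'" "i < \<sigma> f" for f i
    proof (cases "f = e")
      case True
      then show ?thesis using path p(3) f by simp
    next
      case False
      then have fE': "f \<in> E'" using f by blast
      then have "subdiv_vertex \<sigma> f j \<in> V E'" if "j \<le> \<sigma> f" for j
        using that ends[of f] E' unfolding V_def subdiv_vertex_def by auto
      then show ?thesis using old ad[OF fE' f(2)] f(2) by simp
    qed
    have 5: "w' z = int \<Delta>" if "z \<notin> Z \<union> \<phi>' ` V (insert e E')" for z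
    proof -
      have "z \<notin> W" "z \<notin> p ` {1..<\<sigma> e}" using that unfolding W' by auto
      then show ?thesis using fresh[of z] w'(3)[of z] uv by auto
    qed
    have 6: "w' (\<phi>' (Inl x)) = int \<Delta> - int (card {f\<in>insert e E'. x \<in> f})" if x: "x \<in> verts H" for x
    proof -
      have xo: "\<phi>' (Inl x) = \<phi> (Inl x)" by (rule old[OF InlV[OF x]])
      show ?thesis
      proof (cases "x \<in> e")
        case True
        then have "{f\<in>insert e E'. x \<in> f} = insert e {f\<in>E'. x \<in> f}" by auto
        then have "card {f\<in>insert e E'. x \<in> f} = Suc (card {f\<in>E'. x \<in> f})" using insert.hyps by simp
        moreover have "w' (\<phi> (Inl x)) = w (\<phi> (Inl x)) - 1"
        proof -
          have "x = end1 e \<or> x = end2 e" using True en(6) by blast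
          then show ?thesis using w'(1,2) unfolding u_def v_def by blast
        qed
        ultimately show ?thesis using wt[OF x] xo by simp
      next
        case False
        then have "{f\<in>insert e E'. x \<in> f} = {f\<in>E'. x \<in> f}" by auto
        moreover have "w' (\<phi> (Inl x)) = w (\<phi> (Inl x))"
        proof (rule w'(3))
          show "\<phi> (Inl x) \<noteq> u" "\<phi> (Inl x) \<noteq> v"
            using inj_onD[OF inj, of "Inl x" "Inl (end1 e)"] inj_onD[OF inj, of "Inl x" "Inl (end2 e)"] InlV x en False
            unfolding u_def v_def by auto
          show "\<phi> (Inl x) \<notin> p ` {1..<\<sigma> e}" using p(5) InlV[OF x] unfolding W_def by blast
        qed
        ultimately show ?thesis using wt[OF x] xo by simp
      qed
    qed
    have "Inv (insert e E') \<phi>' w'"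
      unfolding Inv_def using 1 2 3 4 5 6 g' unfolding W' by blast
    then show ?case by blast
  qed
  then obtain \<phi> w where "Inv (edges H) \<phi> w" using fE by blast
  then have "inj_on \<phi> (V (edges H))" "\<phi> ` V (edges H) \<subseteq> X \<union> Y"
    "\<forall>e\<in>edges H. \<forall>i<\<sigma> e. adj (\<phi> (subdiv_vertex \<sigma> e i)) (\<phi> (subdiv_vertex \<sigma> e (Suc i)))"
    unfolding Inv_def by auto
  then show ?thesis unfolding V_all by (intro exI[of _ \<phi>] conjI)
qed

end

section \<open>Pairs of maximal density\<close>

text \<open>Averaging: deleting an element of least weight never lowers the mean. The quotients are
  multiplied out.\<close>

lemma heavy_subset:
  fixes g :: "'b \<Rightarrow> real"
  assumes "finite S" "n \<le> card S"
  shows "\<exists>S'\<subseteq>S. card S' = n \<and> real n * sum g S \<le> real (card S) * sum g S'"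
proof (cases "n = 0")
  case True
  then show ?thesis by (intro exI[of _ "{}"]) auto
next
  case n0: False
  show ?thesis
    using assms
  proof (induction "card S - n" arbitrary: S)
    case 0
    then show ?case by (intro exI[of _ S]) auto
  next
    case (Suc k)
    let ?s = "card S"
    have s: "?s > n" using Suc.hyps(2) by linarith
    have "S \<noteq> {}" using s by auto
    then obtain x where x: "x \<in> S" "\<And>y. y \<in> S \<Longrightarrow> g x \<le> g y"
      using ex_min_if_finite[of "g ` S"] Suc.prems(1)
      by (metis (no_types, lifting) arg_min_if_finite(1) arg_min_least)
    have avg: "real ?s * g x \<le> sum g S"
      using sum_bounded_below[of S "g x" g] x by simp
    let ?S = "S - {x}"
    have c: "card ?S = ?s - 1" using x by simp
    have sm: "sum g ?S = sum g S - g x" using x Suc.prems(1) by (simp add: sum_diff1)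
    obtain S' where S': "S' \<subseteq> ?S" "card S' = n" "real n * sum g ?S \<le> real (card ?S) * sum g S'"
    proof -
      have "k = card ?S - n" "n \<le> card ?S" using Suc.hyps(2) s c by linarith+
      then show ?thesis using Suc.hyps(1)[of ?S] Suc.prems(1) that by blast
    qed
    have s1: "real (card ?S) = real ?s - 1" "real ?s - 1 > 0" using c s n0 by auto
    have "(real ?s - 1) * sum g S \<le> real ?s * sum g ?S"
      unfolding sm using avg by (simp add: algebra_simps)
    then have "real n * ((real ?s - 1) * sum g S) \<le> real n * (real ?s * sum g ?S)"
      by (intro mult_left_mono) auto
    also have "\<dots> = real ?s * (real n * sum g ?S)" by simp
    also have "\<dots> \<le> real ?s * ((real ?s - 1) * sum g S')"
      using S'(3) s1 by (intro mult_left_mono) auto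
    finally have "(real ?s - 1) * (real n * sum g S) \<le> (real ?s - 1) * (real ?s * sum g S')"
      by (simp add: algebra_simps)
    then have "real n * sum g S \<le> real ?s * sum g S'" using s1(2) mult_le_cancel_left_pos by blast
    then show ?case using S' by (intro exI[of _ S']) auto
  qed
qed

text \<open>Weights replace edges because the host is sampled with repetition: \<open>w x y\<close>
  will count how often the pair was drawn and got the chosen colour.\<close>

definition wt :: "('b \<Rightarrow> 'c \<Rightarrow> real) \<Rightarrow> 'b set \<Rightarrow> 'c set \<Rightarrow> real" where
  "wt w A B = (\<Sum>x\<in>A. \<Sum>y\<in>B. w x y)"

lemma wt_swap: "wt w A B = wt (\<lambda>y x. w x y) B A"
  unfolding wt_def by (rule sum.swap)

lemma heavy_pair:
  assumes "finite A" "finite B" "n \<le> card A" "n \<le> card B"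
  shows "\<exists>A'\<subseteq>A. \<exists>B'\<subseteq>B. card A' = n \<and> card B' = n \<and>
    real n * real n * wt w A B \<le> real (card A) * real (card B) * wt w A' B'"
proof -
  obtain A' where A': "A' \<subseteq> A" "card A' = n" "real n * wt w A B \<le> real (card A) * wt w A' B"
    using heavy_subset[OF assms(1,3), of "\<lambda>x. \<Sum>y\<in>B. w x y"] unfolding wt_def by blast
  obtain B' where B': "B' \<subseteq> B" "card B' = n" "real n * wt w A' B \<le> real (card B) * wt w A' B'"
    using heavy_subset[OF assms(2,4), of "\<lambda>y. \<Sum>x\<in>A'. w x y"] unfolding wt_swap[of w A'] unfolding wt_def by blast
  have "real n * (real n * wt w A B) \<le> real n * (real (card A) * wt w A' B)"
    using A' by (intro mult_left_mono) auto
  also have "\<dots> = real (card A) * (real n * wt w A' B)" by simp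
  also have "\<dots> \<le> real (card A) * (real (card B) * wt w A' B')"
    using B' by (intro mult_left_mono) auto
  finally show ?thesis using A' B' by (intro exI[of _ A'] conjI exI[of _ B']) (auto simp: mult.assoc)
qed

text \<open>\<open>(X, Y)\<close> maximises (edge density) \<open>\<times> s\<^bsup>1/k\<^esup>\<close> over all pairs of equal size \<open>s \<ge> n\<close>; the \<open>k\<close>-th powers
  of the inequalities are taken so that only natural exponents occur.\<close>

definition densest ::
  "('b \<Rightarrow> 'c \<Rightarrow> real) \<Rightarrow> nat \<Rightarrow> nat \<Rightarrow> 'b set \<Rightarrow> 'c set \<Rightarrow> 'b set \<Rightarrow> 'c set \<Rightarrow> bool" where
  "densest w n k V1 V2 X Y \<longleftrightarrow> X \<subseteq> V1 \<and> Y \<subseteq> V2 \<and> card X = card Y \<and> n \<le> card X \<and>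
     (\<forall>X' Y'. X' \<subseteq> V1 \<longrightarrow> Y' \<subseteq> V2 \<longrightarrow> card X' = card Y' \<longrightarrow> n \<le> card X' \<longrightarrow>
        wt w X' Y' ^ k * real (card X) ^ (2 * k - 1) \<le> wt w X Y ^ k * real (card X') ^ (2 * k - 1))"

lemma densestD:
  assumes "densest w n k V1 V2 X Y" "X' \<subseteq> V1" "Y' \<subseteq> V2" "card X' = card Y'" "n \<le> card X'"
  shows "wt w X' Y' ^ k * real (card X) ^ (2 * k - 1) \<le> wt w X Y ^ k * real (card X') ^ (2 * k - 1)"
  using assms unfolding densest_def by blast

lemma densest_swap: "densest w n k V1 V2 X Y \<Longrightarrow> densest (\<lambda>y x. w x y) n k V2 V1 Y X"
  unfolding densest_def wt_swap[of w, symmetric] by (simp add: wt_swap[of "\<lambda>y x. w x y"]) metis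

lemma densest_exists:
  assumes V: "finite V1" "finite V2" "card V1 = card V2" and n: "1 \<le> n" "n \<le> card V1"
  shows "\<exists>X Y. densest w n k V1 V2 X Y"
proof -
  define Q where "Q = {(X, Y). X \<subseteq> V1 \<and> Y \<subseteq> V2 \<and> card X = card Y \<and> n \<le> card X}"
  define f where "f = (\<lambda>(X, Y). wt w X Y ^ k / real (card X) ^ (2 * k - 1))"
  have "finite (Pow V1 \<times> Pow V2)" using V by simp
  then have fQ: "finite Q" by (rule rev_finite_subset) (auto simp: Q_def)
  have "(V1, V2) \<in> Q" using V n unfolding Q_def by auto
  then have "Max (f ` Q) \<in> f ` Q" using fQ by (intro Max_in) auto
  then obtain q where q: "q \<in> Q" "f q = Max (f ` Q)" by force
  then have mx: "f q' \<le> f q" if "q' \<in> Q" for q' using fQ that by simp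
  obtain X Y where XY: "q = (X, Y)" by (cases q)
  have "wt w X' Y' ^ k * real (card X) ^ (2 * k - 1) \<le> wt w X Y ^ k * real (card X') ^ (2 * k - 1)"
    if "X' \<subseteq> V1" "Y' \<subseteq> V2" "card X' = card Y'" "n \<le> card X'" for X' Y'
  proof -
    have "f (X', Y') \<le> f (X, Y)" using mx[of "(X', Y')"] XY that unfolding Q_def by auto
    moreover have "real (card X') > 0" "real (card X) > 0" using n that q(1) XY unfolding Q_def by auto
    ultimately show ?thesis unfolding f_def by (simp add: field_simps)
  qed
  then have "densest w n k V1 V2 X Y" using q(1) XY unfolding densest_def Q_def by blast
  then show ?thesis by blast
qed

text \<open>The bound \<open>8 * (n * P)\<close> is four times the average weight
  \<open>2 * (n * P)\<close> of an \<open>n\<close> by \<open>n\<close> pair in the host, and the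
  colour has at least a fraction 1/r of the total. Averaging down to \<open>n\<close> by
  \<open>n\<close> pairs shows that \<open>(X, Y)\<close> is at most \<open>4 * r\<close> times as
  dense as \<open>(V1, V2)\<close>, so the factor s^(1/k) cannot have dropped by more than
  \<open>4 * r\<close>.\<close>

lemma densest_size:
  assumes d: "densest w n k V1 V2 X Y" and k: "k \<ge> 1" and w: "\<And>x y. w x y \<ge> 0"
    and V: "finite V1" "finite V2" "card V1 = n * P" "card V2 = n * P" and n: "n \<ge> 1" "P \<ge> 1" "r > 0"
    and total: "real (2 * P ^ 2 * (n * P)) \<le> real r * wt w V1 V2"
    and sparse: "\<And>A B. A \<subseteq> V1 \<Longrightarrow> B \<subseteq> V2 \<Longrightarrow> card A = n \<Longrightarrow> card B = n \<Longrightarrow> wt w A B \<le> real (8 * (n * P))"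
  shows "n * P \<le> (4 * r) ^ k * card X" "wt w X Y > 0"
proof -
  let ?s = "real (card X)" and ?N = "real (n * P)"
  define e where "e = wt w X Y"
  define E where "E = wt w V1 V2"
  have X: "X \<subseteq> V1" "Y \<subseteq> V2" "card X = card Y" "n \<le> card X" using d unfolding densest_def by auto
  have N: "?N > 0" and s: "?s > 0" using n X by auto
  have e0: "e \<ge> 0" unfolding e_def wt_def using w by (intro sum_nonneg) auto
  have kk: "2 * k = Suc (2 * k - 1)" using k by simp
  have "n \<le> n * P" using n by simp
  then have 1: "E ^ k * ?s ^ (2 * k - 1) \<le> e ^ k * ?N ^ (2 * k - 1)"
    using densestD[OF d subset_refl subset_refl] V(3,4) unfolding E_def e_def by simp
  have "E > 0"
  proof -
    have "real (2 * P ^ 2 * (n * P)) > 0" using n by simp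
    then have "real r * E > 0" using total unfolding E_def by linarith
    then show ?thesis using n(3) by (simp add: zero_less_mult_iff)
  qed
  then have "e ^ k * ?N ^ (2 * k - 1) > 0" using 1 s by (smt (verit) mult_pos_pos zero_less_power)
  then have "e \<noteq> 0" using k by (auto simp: zero_power)
  then show "wt w X Y > 0" using e0 unfolding e_def by simp
  obtain A B where AB: "A \<subseteq> X" "B \<subseteq> Y" "card A = n" "card B = n" "real n * real n * e \<le> ?s * ?s * wt w A B"
  proof -
    have "finite X" "finite Y" "n \<le> card Y" using X V finite_subset by auto
    from heavy_pair[OF this(1,2) X(4) this(3), of w] show ?thesis using that X(3) unfolding e_def by auto
  qed
  have "wt w A B \<le> 8 * ?N" using sparse[of A B] AB X by auto
  then have "?s * ?s * wt w A B \<le> ?s * ?s * (8 * ?N)" by (intro mult_left_mono) auto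
  then have 2: "real n ^ 2 * e \<le> ?s ^ 2 * (8 * ?N)" using AB(5) by (simp add: power2_eq_square)
  have 3: "(2 * ?N ^ 3) ^ k * ?s ^ (2 * k - 1) \<le> (4 * real r) ^ k * (2 * ?N) ^ k * ?N ^ (2 * k - 1) * ?s ^ (2 * k)"
  proof -
    have "2 * ?N ^ 3 \<le> real n ^ 2 * (real r * E)"
    proof -
      have eq: "2 * ?N ^ 3 = real n ^ 2 * real (2 * P ^ 2 * (n * P))" by (simp add: power2_eq_square power3_eq_cube)
      show ?thesis unfolding eq E_def using total by (intro mult_left_mono) auto
    qed
    then have "(2 * ?N ^ 3) ^ k \<le> (real n ^ 2 * (real r * E)) ^ k" using N by (intro power_mono) auto
    then have "(2 * ?N ^ 3) ^ k * ?s ^ (2 * k - 1) \<le> (real n ^ 2 * (real r * E)) ^ k * ?s ^ (2 * k - 1)"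
      by (intro mult_right_mono) auto
    also have "\<dots> = (real n ^ 2 * real r) ^ k * (E ^ k * ?s ^ (2 * k - 1))"
      by (simp add: power_mult_distrib algebra_simps)
    also have "\<dots> \<le> (real n ^ 2 * real r) ^ k * (e ^ k * ?N ^ (2 * k - 1))"
      using 1 by (intro mult_left_mono) auto
    also have "\<dots> = real r ^ k * (real n ^ 2 * e) ^ k * ?N ^ (2 * k - 1)"
      by (simp add: power_mult_distrib algebra_simps)
    also have "\<dots> \<le> real r ^ k * (?s ^ 2 * (8 * ?N)) ^ k * ?N ^ (2 * k - 1)"
      using 2 e0 by (intro mult_right_mono mult_left_mono power_mono) auto
    also have "\<dots> = (real r * (?s ^ 2 * (8 * ?N))) ^ k * ?N ^ (2 * k - 1)"
      by (simp only: power_mult_distrib)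
    also have "real r * (?s ^ 2 * (8 * ?N)) = (4 * real r) * (2 * ?N) * ?s ^ 2" by simp
    also have "((4 * real r) * (2 * ?N) * ?s ^ 2) ^ k * ?N ^ (2 * k - 1) =
        (4 * real r) ^ k * (2 * ?N) ^ k * ?N ^ (2 * k - 1) * ?s ^ (2 * k)"
      unfolding power_mult_distrib power_mult by (simp only: ac_simps)
    finally show ?thesis .
  qed
  have "(2 * ?N ^ 3) ^ k = (2 * ?N) ^ k * ?N ^ (2 * k - 1) * ?N"
  proof -
    have "2 * ?N ^ 3 = 2 * ?N * ?N ^ 2" by (simp add: power2_eq_square power3_eq_cube)
    then have "(2 * ?N ^ 3) ^ k = (2 * ?N) ^ k * ?N ^ (2 * k)" by (simp only: power_mult_distrib power_mult)
    also have "?N ^ (2 * k) = ?N ^ (2 * k - 1) * ?N" by (subst kk) (simp only: power_Suc2)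
    finally show ?thesis by (simp only: ac_simps)
  qed
  moreover have "?s ^ (2 * k) = ?s ^ (2 * k - 1) * ?s" by (subst kk) (simp only: power_Suc2)
  ultimately have "((2 * ?N) ^ k * ?N ^ (2 * k - 1) * ?s ^ (2 * k - 1)) * ?N \<le>
      ((2 * ?N) ^ k * ?N ^ (2 * k - 1) * ?s ^ (2 * k - 1)) * ((4 * real r) ^ k * ?s)"
    using 3 by (simp only: ac_simps)
  moreover have "(2 * ?N) ^ k * ?N ^ (2 * k - 1) * ?s ^ (2 * k - 1) > 0" using N s by simp
  ultimately have "?N \<le> (4 * real r) ^ k * ?s" using mult_le_cancel_left_pos by blast
  then have "real (n * P) \<le> real ((4 * r) ^ k * card X)" by simp
  then show "n * P \<le> (4 * r) ^ k * card X" by (simp only: of_nat_le_iff)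
qed

text \<open>The fourth power of weighted AM-GM, (1 - x)^(3/4) \<le> 1 - 3x/4; the proof completes a
  square instead.\<close>

lemma quartic_ge_cubic:
  fixes x :: real assumes "0 \<le> x" "x \<le> 1" shows "(1 - x) ^ 3 \<le> (1 - 3 / 4 * x) ^ 4"
proof -
  have "(1 - 3 / 4 * x) ^ 4 - (1 - x) ^ 3 = x ^ 2 * (81 / 256 * (x - 88 / 81) ^ 2 + 1 / 648)"
    by (simp add: power4_eq_xxxx power3_eq_cube power2_eq_square field_simps)
  also have "\<dots> \<ge> 0" by simp
  finally show ?thesis by simp
qed

text \<open>Dropping a vertex of degree below 3/4 of the average, together with a suitable vertex of
  \<open>Y\<close>, would raise the density by more than the smaller size costs.
  \<open>n < card X\<close> keeps the smaller pair admissible.\<close>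

lemma densest_min_degree:
  assumes d: "densest w n (4 * j) V1 V2 X Y" and V: "finite V1" "finite V2" and w: "\<And>x y. w x y \<ge> 0"
    and pos: "wt w X Y > 0" and j: "j \<ge> 1" and n: "n < card X" "n \<ge> 1" and x: "x \<in> X"
  shows "3 * wt w X Y \<le> 4 * real (card X) * wt w {x} Y"
proof (rule ccontr)
  define e where "e = wt w X Y"
  define k where "k = 4 * j"
  define s where "s = real (card X)"
  assume "\<not> ?thesis"
  then have less: "4 * s * wt w {x} Y < 3 * e" unfolding e_def s_def by simp
  have X: "X \<subseteq> V1" "Y \<subseteq> V2" "card X = card Y" using d unfolding densest_def by auto
  have fX: "finite X" "finite Y" using X V finite_subset by blast+
  have s: "s \<ge> 2" using n unfolding s_def by auto
  let ?X = "X - {x}"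
  have cX: "card ?X = card X - 1" using x by simp
  have rX: "real (card X - 1) = s - 1" using n unfolding s_def by auto
  have eX: "wt w ?X Y = e - wt w {x} Y"
    unfolding wt_def e_def using x fX by (simp add: sum_diff1)
  have e1: "wt w ?X Y \<ge> e * (1 - 3 / 4 * (1 / s))" "wt w ?X Y > e * (1 - 3 / 4 * (1 / s))"
    using less s unfolding eX by (auto simp: field_simps)
  obtain Y' where Y': "Y' \<subseteq> Y" "card Y' = card X - 1" "real (card X - 1) * wt w ?X Y \<le> real (card Y) * wt w ?X Y'"
    using heavy_subset[OF fX(2), of "card X - 1" "\<lambda>y. \<Sum>x\<in>?X. w x y"] X
    unfolding wt_swap[of w ?X] unfolding wt_def by auto
  have "(s - 1) * wt w ?X Y \<le> s * wt w ?X Y'" using Y'(3) X(3) rX unfolding s_def by simp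
  then have e2: "(1 - 1 / s) * wt w ?X Y \<le> wt w ?X Y'" using s by (simp add: field_simps)
  have "wt w ?X Y' ^ k * s ^ (2 * k - 1) \<le> e ^ k * real (card ?X) ^ (2 * k - 1)"
  proof -
    have "?X \<subseteq> V1" "Y' \<subseteq> V2" "card ?X = card Y'" "n \<le> card ?X" using X Y' cX n by auto
    from densestD[OF d this] show ?thesis unfolding s_def e_def k_def .
  qed
  then have m: "wt w ?X Y' ^ k * s ^ (2 * k - 1) \<le> e ^ k * (s - 1) ^ (2 * k - 1)" unfolding cX rX .
  have k: "k \<ge> 4" "2 * k - 1 = k + (k - 1)" using j unfolding k_def by auto
  define q where "q = 1 - 1 / s"
  have q: "0 < q" "q \<le> 1" using s unfolding q_def by auto
  have sq: "s - 1 = s * q" using s unfolding q_def by (simp add: field_simps)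
  define t where "t = 1 - 3 / 4 * (1 / s)"
  have t0: "t > 0" using s unfolding t_def by (simp add: field_simps)
  have epos: "e > 0" using pos unfolding e_def .
  have "q * (e * t) < wt w ?X Y'" using e1(2) e2 q unfolding q_def[symmetric] t_def[symmetric]
    by (smt (verit) mult_strict_left_mono)
  then have "(q * (e * t)) ^ k < wt w ?X Y' ^ k"
    using q t0 epos k by (intro power_strict_mono) auto
  then have "(q * (e * t)) ^ k * s ^ (2 * k - 1) < e ^ k * (s - 1) ^ (2 * k - 1)"
    using m s by (smt (verit) mult_strict_right_mono zero_less_power)
  also have "\<dots> = e ^ k * s ^ (2 * k - 1) * q ^ k * q ^ (k - 1)"
    unfolding sq power_mult_distrib k(2) power_add by (simp only: ac_simps)
  finally have "(e ^ k * s ^ (2 * k - 1) * q ^ k) * t ^ k < (e ^ k * s ^ (2 * k - 1) * q ^ k) * q ^ (k - 1)"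
    unfolding power_mult_distrib by (simp only: ac_simps)
  moreover have "e ^ k * s ^ (2 * k - 1) * q ^ k > 0" using epos s q by simp
  \<comment> \<open>This is maximality after cancellation. It is refuted by
    \<open>q ^ 3 \<le> t ^ 4\<close>, since \<open>k = 4 * j\<close> gives
    \<open>k - 1 \<ge> 3 * j\<close>.\<close>
  ultimately have "t ^ k < q ^ (k - 1)" using mult_less_cancel_left_pos by blast
  also have "\<dots> \<le> q ^ (3 * j)" using q j unfolding k_def by (intro power_decreasing) auto
  also have "\<dots> = (q ^ 3) ^ j" by (simp add: power_mult)
  also have "\<dots> \<le> (t ^ 4) ^ j"
    using quartic_ge_cubic[of "1 / s"] s q unfolding q_def t_def by (intro power_mono) auto
  also have "\<dots> = t ^ k" unfolding k_def by (simp add: power_mult)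
  finally show False by simp
qed

text \<open>Otherwise \<open>m\<close> vertices of \<open>U\<close> send at least 3/4 of the average
  weight each into fewer than 3s/5 vertices. The best \<open>m\<close> of these give a pair of size
  \<open>m\<close> whose density is larger by 3/4 * 5/3 = 5/4. As (5/4)^4 > 2, the k-th power of
  this gain is at least \<open>2 ^ j\<close>, more than the loss s/m in size.\<close>

lemma densest_expands:
  assumes d: "densest w n (4 * j) V1 V2 X Y" and V: "finite V1" "finite V2" and w: "\<And>x y. w x y \<ge> 0"
    and pos: "wt w X Y > 0" and j: "j \<ge> 1" and n: "n < card X" "n \<ge> 1"
    and m: "n \<le> m" "5 * m < 3 * card X" "card X < 2 ^ j * m" and U: "U \<subseteq> X" "m \<le> card U"
  shows "3 * card X \<le> 5 * card {y\<in>Y. \<exists>x\<in>U. w x y > 0}"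
proof (rule ccontr)
  define e where "e = wt w X Y"
  define k where "k = 4 * j"
  define s where "s = real (card X)"
  assume contra: "\<not> ?thesis"
  have X: "X \<subseteq> V1" "Y \<subseteq> V2" "card X = card Y" using d unfolding densest_def by auto
  have fX: "finite X" "finite Y" using X V finite_subset by blast+
  have s: "s > 0" using n unfolding s_def by auto
  obtain U' where U': "U' \<subseteq> U" "card U' = m" using U(2) by (metis obtain_subset_with_card_n)
  define Nb where "Nb = {y\<in>Y. \<exists>x\<in>U'. w x y > 0}"
  have "card Nb \<le> card {y\<in>Y. \<exists>x\<in>U. w x y > 0}" unfolding Nb_def using U' fX by (intro card_mono) auto
  then have cNb: "5 * card Nb < 3 * card X" using contra by linarith
  \<comment> \<open>A neighbourhood smaller than \<open>m\<close> is padded, so that exactly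
    \<open>m\<close> of its vertices can be selected below.\<close>
  obtain V' where V': "Nb \<subseteq> V'" "V' \<subseteq> Y" "m \<le> card V'" "5 * card V' < 3 * card X"
  proof (cases "m \<le> card Nb")
    case True
    then show ?thesis using that[of Nb] cNb unfolding Nb_def by auto
  next
    case False
    have "m \<le> card Y" using m(2) X(3) by linarith
    then obtain V' where "Nb \<subseteq> V'" "V' \<subseteq> Y" "card V' = m"
      using False exists_subset_between[of Nb m Y] fX unfolding Nb_def by auto
    then show ?thesis using that[of V'] m by auto
  qed
  have fU': "finite U'" using U' U fX finite_subset by metis
  have "wt w U' V' = wt w U' Y"
    unfolding wt_def
  proof (rule sum.cong[OF refl])
    fix x assume x: "x \<in> U'"
    have "w x y = 0" if "y \<in> Y - V'" for y
    proof -
      have "y \<notin> Nb" using that V' by blast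
      then have "\<not> w x y > 0" using that x unfolding Nb_def by blast
      then show ?thesis using w[of x y] by linarith
    qed
    then show "(\<Sum>y\<in>V'. w x y) = (\<Sum>y\<in>Y. w x y)" using V' fX by (intro sum.mono_neutral_left) auto
  qed
  also have "wt w U' Y = (\<Sum>x\<in>U'. wt w {x} Y)" unfolding wt_def by simp
  also have "\<dots> \<ge> (\<Sum>x\<in>U'. 3 * e / (4 * s))"
  proof (rule sum_mono)
    fix x assume "x \<in> U'"
    then have "3 * e \<le> 4 * s * wt w {x} Y"
      using densest_min_degree[OF d V w pos j n] U U' unfolding e_def s_def by blast
    then show "3 * e / (4 * s) \<le> wt w {x} Y" using s by (simp add: field_simps)
  qed
  finally have deg: "real m * (3 * e / (4 * s)) \<le> wt w U' V'" using U'(2) by simp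
  have fV': "finite V'" using V' fX finite_subset by metis
  obtain V'' where V'': "V'' \<subseteq> V'" "card V'' = m" "real m * wt w U' V' \<le> real (card V') * wt w U' V''"
    using heavy_subset[OF fV' V'(3), of "\<lambda>y. \<Sum>x\<in>U'. w x y"] unfolding wt_swap[of w U'] unfolding wt_def by blast
  have mpos: "real m > 0" using n m by simp
  have epos: "e > 0" using pos unfolding e_def .
  have big: "5 / 4 * (real m ^ 2 / s ^ 2) * e \<le> wt w U' V''"
  proof -
    have "real m * (real m * (3 * e / (4 * s))) \<le> real m * wt w U' V'" using deg by (intro mult_left_mono) auto
    also have "\<dots> \<le> real (card V') * wt w U' V''" by (rule V'')
    also have "\<dots> \<le> (3 / 5 * s) * wt w U' V''"
    proof (rule mult_right_mono)
      have "5 * real (card V') < 3 * s" using V'(4) unfolding s_def by linarith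
      then show "real (card V') \<le> 3 / 5 * s" by simp
      show "0 \<le> wt w U' V''" unfolding wt_def using w by (intro sum_nonneg) auto
    qed
    finally show ?thesis using s by (simp add: field_simps power2_eq_square)
  qed
  have "wt w U' V'' ^ k * s ^ (2 * k - 1) \<le> e ^ k * real m ^ (2 * k - 1)"
  proof -
    have "U' \<subseteq> V1" "V'' \<subseteq> V2" "card U' = card V''" "n \<le> card U'" using U U' V' V'' X m(1) by auto
    from densestD[OF d this] show ?thesis unfolding s_def e_def k_def U'(2) .
  qed
  moreover have "(5 / 4 * (real m ^ 2 / s ^ 2) * e) ^ k * s ^ (2 * k - 1) \<le> wt w U' V'' ^ k * s ^ (2 * k - 1)"
    using big s epos mpos by (intro mult_right_mono power_mono) auto
  ultimately have 1: "(5 / 4 * (real m ^ 2 / s ^ 2) * e) ^ k * s ^ (2 * k - 1) \<le> e ^ k * real m ^ (2 * k - 1)" by linarith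
  have kk: "2 * k = Suc (2 * k - 1)" using j unfolding k_def by simp
  have "(5 / 4) ^ k * real m \<le> s"
  proof -
    have "(5 / 4 * (real m ^ 2 / s ^ 2) * e) ^ k * s ^ (2 * k - 1) * s
       = (5 / 4) ^ k * real m ^ (2 * k) / s ^ (2 * k) * e ^ k * s ^ (2 * k)"
      by (subst (3) kk) (simp add: power_mult_distrib power_divide power_mult)
    also have "\<dots> = (5 / 4) ^ k * real m ^ (2 * k) * e ^ k" using s by simp
    also have "\<dots> = (e ^ k * real m ^ (2 * k - 1)) * ((5 / 4) ^ k * real m)"
      by (subst kk) (simp add: mult_ac)
    finally have "(e ^ k * real m ^ (2 * k - 1)) * ((5 / 4) ^ k * real m) \<le> (e ^ k * real m ^ (2 * k - 1)) * s"
      using 1 s by (metis mult_right_mono less_imp_le)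
    then show ?thesis using epos mpos by simp
  qed
  moreover have "(5 / 4) ^ k \<ge> (2 :: real) ^ j"
  proof -
    have "(5 / 4 :: real) ^ k = ((5 / 4) ^ 4) ^ j" unfolding k_def by (simp add: power_mult)
    also have "\<dots> \<ge> 2 ^ j" by (intro power_mono) (auto simp: power4_eq_xxxx)
    finally show ?thesis .
  qed
  ultimately have "2 ^ j * real m \<le> s" using mpos by (smt (verit) mult_right_mono)
  moreover have "s < 2 ^ j * real m"
    using m(3) unfolding s_def by (metis of_nat_less_iff of_nat_mult of_nat_power of_nat_numeral)
  ultimately show False by simp
qed

section \<open>Hosts and dependent random choice\<close>

text \<open>A random function \<open>f\<close> works: the exponential moment of the number of edges it sends from \<open>A\<close> to \<open>B\<close>
  factorises, and is small enough for a union bound over all pairs.\<close>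

lemma uniform_host_exists:
  fixes V1 :: "'b set" and V2 :: "'c set"
  assumes V: "finite V1" "finite V2" "card V1 = n * P" "card V2 = n * P" and n: "n \<ge> 1" "P \<ge> 1"
  shows "\<exists>f. (\<forall>q\<in>V1 \<times> {..<2 * P ^ 2}. f q \<in> V2) \<and>
    (\<forall>A B. A \<subseteq> V1 \<longrightarrow> B \<subseteq> V2 \<longrightarrow> card A = n \<longrightarrow> card B = n \<longrightarrow>
      card {q \<in> A \<times> {..<2 * P ^ 2}. f q \<in> B} \<le> 8 * (n * P))"
proof (rule ccontr)
  define d where "d = 2 * P ^ 2"
  define N where "N = n * P"
  define Q where "Q = V1 \<times> {..<d}"
  define \<Omega> where "\<Omega> = PiE Q (\<lambda>_. V2)"
  define R where "R = {(A, B). A \<subseteq> V1 \<and> B \<subseteq> V2 \<and> card A = n \<and> card B = n}"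
  define cnt where "cnt = (\<lambda>(f :: 'b \<times> nat \<Rightarrow> 'c) (A, B). card {q \<in> A \<times> {..<d}. f q \<in> B})"
  have fQ: "finite Q" and cQ: "card Q = N * d" using V unfolding Q_def N_def by auto
  have f\<Omega>: "finite \<Omega>" and c\<Omega>: "card \<Omega> = N ^ (N * d)"
    using fQ V cQ unfolding \<Omega>_def by (auto simp: finite_PiE card_PiE N_def)
  have N1: "N \<ge> 1" using n unfolding N_def by simp
  have "R \<subseteq> Pow V1 \<times> Pow V2" unfolding R_def by auto
  moreover have "finite (Pow V1 \<times> Pow V2)" using V by simp
  ultimately have fR: "finite R" and cR0: "card R \<le> card (Pow V1 \<times> Pow V2)"
    by (auto intro: finite_subset simp del: card_cartesian_product intro!: card_mono)
  have "card (Pow V1 \<times> Pow V2) = 2 ^ N * 2 ^ N"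
    unfolding card_cartesian_product using V by (simp add: card_Pow N_def)
  also have "\<dots> = (2 * 2) ^ N" by (rule power_mult_distrib[symmetric])
  finally have "card R \<le> 4 ^ N" using cR0 by simp
  then have cR: "real (card R) \<le> 4 ^ N" by (metis of_nat_le_iff of_nat_numeral of_nat_power)
  assume contra: "\<not> ?thesis"
  have bad: "\<exists>q\<in>R. cnt f q > 8 * N" if f: "f \<in> \<Omega>" for f
  proof -
    have "\<forall>q\<in>V1 \<times> {..<2 * P ^ 2}. f q \<in> V2" using f unfolding \<Omega>_def Q_def d_def by (auto dest: PiE_mem)
    then obtain A B where "A \<subseteq> V1" "B \<subseteq> V2" "card A = n" "card B = n"
      "\<not> card {q \<in> A \<times> {..<2 * P ^ 2}. f q \<in> B} \<le> 8 * (n * P)" using contra by blast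
    then show ?thesis unfolding R_def cnt_def d_def N_def by (intro bexI[of _ "(A, B)"]) auto
  qed
  have moment: "(\<Sum>f\<in>\<Omega>. 2 ^ cnt f q) \<le> real (N ^ (N * d)) * 9 ^ N" if q: "q \<in> R" for q
  proof -
    obtain A B where AB: "q = (A, B)" "A \<subseteq> V1" "B \<subseteq> V2" "card A = n" "card B = n" using q unfolding R_def by auto
    \<comment> \<open>The moment has base 2: a slot contributes a factor 2 exactly if it gives an
      edge from \<open>A\<close> to \<open>B\<close>.\<close>
    define \<beta> where "\<beta> = (\<lambda>(p :: 'b \<times> nat) y. if fst p \<in> A \<and> y \<in> B then 2 else (1::real))"
    have "2 ^ cnt f q = (\<Prod>p\<in>Q. \<beta> p (f p))" for f
    proof -
      have "(\<Prod>p\<in>Q. \<beta> p (f p)) = (\<Prod>p\<in>{p \<in> A \<times> {..<d}. f p \<in> B}. \<beta> p (f p))"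
        using fQ AB(2) by (intro prod.mono_neutral_right) (auto simp: Q_def \<beta>_def)
      also have "\<dots> = (\<Prod>p\<in>{p \<in> A \<times> {..<d}. f p \<in> B}. 2)"
        by (intro prod.cong) (auto simp: \<beta>_def)
      finally show ?thesis unfolding cnt_def AB by simp
    qed
    then have "(\<Sum>f\<in>\<Omega>. 2 ^ cnt f q) = (\<Sum>f\<in>\<Omega>. \<Prod>p\<in>Q. \<beta> p (f p))" by simp
    also have "\<dots> = (\<Prod>p\<in>Q. \<Sum>y\<in>V2. \<beta> p y)"
      unfolding \<Omega>_def using fQ V by (intro prod_sum_PiE[symmetric]) auto
    also have "\<dots> = (\<Prod>p\<in>Q. if fst p \<in> A then real N + real n else real N)"
    proof (rule prod.cong[OF refl])
      fix p
      show "(\<Sum>y\<in>V2. \<beta> p y) = (if fst p \<in> A then real N + real n else real N)"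
      proof (cases "fst p \<in> A")
        case True
        have "(\<Sum>y\<in>V2. \<beta> p y) = (\<Sum>y\<in>V2. 1 + (if y \<in> B then 1 else 0))"
          using True by (intro sum.cong) (auto simp: \<beta>_def)
        also have "\<dots> = real (card V2) + real (card (V2 \<inter> B))"
          using V by (simp add: sum.distrib sum.If_cases)
        also have "V2 \<inter> B = B" using AB by blast
        finally show ?thesis using True AB V by (simp add: N_def)
      next
        case False
        then show ?thesis using V by (simp add: \<beta>_def N_def)
      qed
    qed
    also have "\<dots> \<le> (\<Prod>p\<in>Q. real N * (if fst p \<in> A then exp (1 / real P) else 1))"
    proof (rule prod_mono)
      fix p
      have "real N + real n = real N * (1 + 1 / real P)" using n by (simp add: N_def field_simps)
      also have "\<dots> \<le> real N * exp (1 / real P)" by (intro mult_left_mono exp_ge_add_one_self) auto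
      finally show "0 \<le> (if fst p \<in> A then real N + real n else real N) \<and>
        (if fst p \<in> A then real N + real n else real N) \<le> real N * (if fst p \<in> A then exp (1 / real P) else 1)" by auto
    qed
    also have "\<dots> = real N ^ (N * d) * (\<Prod>p\<in>Q. if fst p \<in> A then exp (1 / real P) else 1)"
      by (simp add: prod.distrib cQ)
    also have "(\<Prod>p\<in>Q. if fst p \<in> A then exp (1 / real P) else 1) = (\<Prod>p\<in>A \<times> {..<d}. exp (1 / real P))"
      using fQ AB(2) by (intro prod.mono_neutral_cong_right) (auto simp: Q_def)
    also have "\<dots> = exp (1 / real P) ^ (n * d)" using AB by (simp add: card_cartesian_product)
    also have "\<dots> = exp 2 ^ N"
    proof -
      have "real (n * d) * (1 / real P) = real N * 2"
        using n by (simp add: d_def N_def power2_eq_square)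
      then show ?thesis by (metis exp_of_nat_mult)
    qed
    also have "real N ^ (N * d) * exp 2 ^ N \<le> real N ^ (N * d) * 9 ^ N"
    proof (intro mult_left_mono power_mono)
      have "exp 2 = exp 1 * exp (1::real)" by (simp add: exp_add[symmetric])
      also have "\<dots> \<le> 3 * 3" using exp_le by (intro mult_mono) auto
      finally show "exp 2 \<le> (9::real)" by simp
    qed auto
    finally show ?thesis by simp
  qed
  \<comment> \<open>A bad function contributes at least 2^(8N) = 256^N. At most 4^N pairs with
    normalised moment at most 9^N (from exp(nd/P) = exp(2N)) allow only 36^N.\<close>
  have "real (card \<Omega>) * 256 ^ N = (\<Sum>f\<in>\<Omega>. 2 ^ (8 * N))" by (simp add: power_mult)
  also have "\<dots> \<le> (\<Sum>f\<in>\<Omega>. \<Sum>q\<in>R. 2 ^ cnt f q)"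
  proof (rule sum_mono)
    fix f assume "f \<in> \<Omega>"
    then obtain q where q: "q \<in> R" "cnt f q > 8 * N" using bad by blast
    have "(2::real) ^ (8 * N) \<le> 2 ^ cnt f q" using q by (intro power_increasing) auto
    also have "\<dots> \<le> (\<Sum>q\<in>R. 2 ^ cnt f q)" using q fR by (intro member_le_sum) auto
    finally show "(2::real) ^ (8 * N) \<le> (\<Sum>q\<in>R. 2 ^ cnt f q)" .
  qed
  also have "\<dots> = (\<Sum>q\<in>R. \<Sum>f\<in>\<Omega>. 2 ^ cnt f q)" by (rule sum.swap)
  also have "\<dots> \<le> real (card R) * (real (N ^ (N * d)) * 9 ^ N)"
    using moment by (intro sum_bounded_above) auto
  also have "\<dots> \<le> 4 ^ N * (real (N ^ (N * d)) * 9 ^ N)"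
    using cR by (intro mult_right_mono) auto
  also have "\<dots> = real (card \<Omega>) * (4 ^ N * 9 ^ N)" using c\<Omega> by (simp only: mult_ac)
  also have "4 ^ N * 9 ^ N = (36::real) ^ N" by (simp add: power_mult_distrib[symmetric])
  finally have "real (card \<Omega>) * 256 ^ N \<le> real (card \<Omega>) * 36 ^ N" .
  moreover have "real (card \<Omega>) > 0" using c\<Omega> N1 by simp
  ultimately have "(256::real) ^ N \<le> 36 ^ N" using mult_le_cancel_left_pos by blast
  moreover have "(36::real) ^ N < 256 ^ N" using N1 by (intro power_strict_mono) auto
  ultimately show False by simp
qed

text \<open>The power mean inequality, obtained from the tangent of the t-th power at
  \<open>c\<close>, that is, from Bernoulli.\<close>

lemma sum_power_ge:
  fixes a :: "'b \<Rightarrow> real"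
  assumes "finite S" "\<And>x. x \<in> S \<Longrightarrow> 0 \<le> a x" and c: "c > 0" "real (card S) * c \<le> sum a S"
  shows "real (card S) * c ^ t \<le> (\<Sum>x\<in>S. a x ^ t)"
proof -
  have "c ^ t * (1 + real t * (a x / c - 1)) \<le> a x ^ t" if "x \<in> S" for x
  proof -
    have "1 + real t * (a x / c - 1) \<le> (1 + (a x / c - 1)) ^ t"
      using assms(2)[OF that] c by (intro Bernoulli_inequality) auto
    then have "c ^ t * (1 + real t * (a x / c - 1)) \<le> c ^ t * (a x / c) ^ t"
      using c by (intro mult_left_mono) auto
    also have "\<dots> = a x ^ t" using c by (simp add: power_divide)
    finally show ?thesis .
  qed
  then have "(\<Sum>x\<in>S. c ^ t * (1 + real t * (a x / c - 1))) \<le> (\<Sum>x\<in>S. a x ^ t)" by (rule sum_mono)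
  moreover have "(\<Sum>x\<in>S. c ^ t * (1 + real t * (a x / c - 1))) =
     c ^ t * (real (card S) + real t * (sum a S / c - real (card S)))"
    by (simp add: sum_distrib_left[symmetric] sum.distrib sum_subtractf sum_divide_distrib)
  moreover have "c ^ t * (real (card S) + real t * (sum a S / c - real (card S))) \<ge> c ^ t * real (card S)"
  proof (rule mult_left_mono)
    have "sum a S / c - real (card S) \<ge> 0" using c by (simp add: field_simps)
    then show "real (card S) \<le> real (card S) + real t * (sum a S / c - real (card S))" by simp
  qed (use c in simp)
  ultimately show ?thesis by (simp add: mult.commute)
qed

lemma sum_card_swap:
  assumes "finite A" "finite B"
  shows "(\<Sum>y\<in>B. card {x\<in>A. Q x y}) = (\<Sum>x\<in>A. card {y\<in>B. Q x y})"
proof -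
  have "(\<Sum>y\<in>B. card {x\<in>A. Q x y}) = (\<Sum>y\<in>B. \<Sum>x\<in>A. if Q x y then 1 else 0)"
    using sum.inter_filter[OF assms(1), of "\<lambda>_. 1 :: nat"] by simp
  also have "\<dots> = (\<Sum>x\<in>A. \<Sum>y\<in>B. if Q x y then 1 else 0)" by (rule sum.swap)
  also have "\<dots> = (\<Sum>x\<in>A. card {y\<in>B. Q x y})"
    using sum.inter_filter[OF assms(2), of "\<lambda>_. 1 :: nat"] by simp
  finally show ?thesis .
qed

text \<open>\<open>W y\<close> is the common neighbourhood of \<open>t\<close> vertices sampled from
  \<open>V2\<close> with repetition. By convexity its mean size is at least M/r^t \<ge> 2n^2 \<ge> n
  + 1, while on average it contains at most one bad \<open>D\<close>-tuple. For a suitable sample,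
  removing one entry of each bad tuple leaves \<open>n\<close> vertices.\<close>

lemma dependent_random_choice:
  fixes V1 :: "'b set" and V2 :: "'c set" and adj :: "'b \<Rightarrow> 'c \<Rightarrow> bool"
  assumes V: "finite V1" "finite V2" "card V1 = M" "card V2 = M"
    and dens: "M * M \<le> r * (\<Sum>x\<in>V1. card {y\<in>V2. adj x y})" and r: "r \<ge> 1" and D: "D \<ge> 1" and n: "n \<ge> 1"
    and M: "2 * r ^ (2 * D) * n ^ 2 \<le> M"
  shows "\<exists>U\<subseteq>V1. n \<le> card U \<and> (\<forall>S\<subseteq>U. card S \<le> D \<longrightarrow> n \<le> card {y\<in>V2. \<forall>x\<in>S. adj x y})"
proof -
  \<comment> \<open>A bad tuple survives with probability at most (n/M)^t; for
    \<open>t = 2 * D\<close> this outweighs the \<open>M ^ D\<close> tuples as soon as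
    \<open>n ^ 2 \<le> M\<close>.\<close>
  define t where "t = 2 * D"
  define cn where "cn = (\<lambda>S. {y\<in>V2. \<forall>x\<in>S. adj x y})"
  define \<Omega> where "\<Omega> = PiE {..<t} (\<lambda>_. V2)"
  define W where "W = (\<lambda>y :: nat \<Rightarrow> 'c. {x\<in>V1. \<forall>i<t. adj x (y i)})"
  define Bad where "Bad = {g \<in> PiE {..<D} (\<lambda>_. V1). card (cn (g ` {..<D})) < n}"
  define bd where "bd = (\<lambda>y. {g \<in> Bad. g ` {..<D} \<subseteq> W y})"
  have f\<Omega>: "finite \<Omega>" and c\<Omega>: "card \<Omega> = M ^ t" using V unfolding \<Omega>_def by (auto simp: finite_PiE card_PiE)
  have fBad: "finite Bad" unfolding Bad_def using V by (simp add: finite_PiE)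
  have cBad: "card Bad \<le> M ^ D"
  proof -
    have "card Bad \<le> card (PiE {..<D} (\<lambda>_. V1))" unfolding Bad_def using V by (intro card_mono) (auto simp: finite_PiE)
    then show ?thesis using V by (simp add: card_PiE)
  qed
  have fW: "finite (W y)" for y unfolding W_def using V by simp
  have M1: "M \<ge> 1" and Mn2: "n ^ 2 \<le> M"
  proof -
    have rn: "1 \<le> r ^ (2 * D)" "1 \<le> n ^ 2" using r n by simp_all
    then have "1 * n ^ 2 \<le> 2 * r ^ (2 * D) * n ^ 2" by (intro mult_right_mono) simp_all
    then show "n ^ 2 \<le> M" using M by linarith
    then show "M \<ge> 1" using rn by linarith
  qed
  have s1: "(\<Sum>y\<in>\<Omega>. card (W y)) = (\<Sum>x\<in>V1. card {y\<in>V2. adj x y} ^ t)"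
  proof -
    have "(\<Sum>y\<in>\<Omega>. card (W y)) = (\<Sum>x\<in>V1. card {y\<in>\<Omega>. \<forall>i<t. adj x (y i)})"
      unfolding W_def by (rule sum_card_swap[OF V(1) f\<Omega>])
    also have "\<dots> = (\<Sum>x\<in>V1. card (PiE {..<t} (\<lambda>_. {y\<in>V2. adj x y})))"
    proof (rule sum.cong[OF refl])
      fix x
      have "{y\<in>\<Omega>. \<forall>i<t. adj x (y i)} = PiE {..<t} (\<lambda>_. {y\<in>V2. adj x y})"
        unfolding \<Omega>_def PiE_def Pi_def by auto
      then show "card {y\<in>\<Omega>. \<forall>i<t. adj x (y i)} = card (PiE {..<t} (\<lambda>_. {y\<in>V2. adj x y}))" by simp
    qed
    finally show ?thesis using V by (simp add: card_PiE)
  qed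
  have s2: "(\<Sum>y\<in>\<Omega>. card (bd y)) \<le> M ^ D * n ^ t"
  proof -
    have "(\<Sum>y\<in>\<Omega>. card (bd y)) = (\<Sum>g\<in>Bad. card {y\<in>\<Omega>. g ` {..<D} \<subseteq> W y})"
      unfolding bd_def by (rule sum_card_swap[OF fBad f\<Omega>])
    also have "\<dots> \<le> (\<Sum>g\<in>Bad. n ^ t)"
    proof (rule sum_mono)
      fix g assume g: "g \<in> Bad"
      have "{y\<in>\<Omega>. g ` {..<D} \<subseteq> W y} \<subseteq> PiE {..<t} (\<lambda>_. cn (g ` {..<D}))"
        unfolding \<Omega>_def W_def cn_def PiE_def Pi_def by auto
      moreover have fc: "finite (cn (g ` {..<D}))" unfolding cn_def using V by simp
      ultimately have "card {y\<in>\<Omega>. g ` {..<D} \<subseteq> W y} \<le> card (PiE {..<t} (\<lambda>_. cn (g ` {..<D})))"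
        by (intro card_mono) (auto simp: finite_PiE)
      also have "\<dots> = card (cn (g ` {..<D})) ^ t" by (simp add: card_PiE)
      also have "\<dots> \<le> n ^ t" using g unfolding Bad_def by (intro power_mono) auto
      finally show "card {y\<in>\<Omega>. g ` {..<D} \<subseteq> W y} \<le> n ^ t" .
    qed
    also have "\<dots> = card Bad * n ^ t" by simp
    also have "\<dots> \<le> M ^ D * n ^ t" using cBad by (intro mult_right_mono) auto
    finally show ?thesis .
  qed
  have s2': "(\<Sum>y\<in>\<Omega>. card (bd y)) \<le> M ^ t"
  proof -
    have "M ^ D * n ^ t = (M * n ^ 2) ^ D" unfolding t_def by (simp add: power_mult_distrib power_mult)
    also have "\<dots> \<le> (M * M) ^ D" using Mn2 by (intro power_mono mult_left_mono) auto
    also have "\<dots> = M ^ t" unfolding t_def by (simp add: power_mult power2_eq_square)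
    finally show ?thesis using s2 by linarith
  qed
  have "\<exists>y\<in>\<Omega>. n + card (bd y) \<le> card (W y)"
  proof (rule ccontr)
    assume c: "\<not> ?thesis"
    have ne: "\<Omega> \<noteq> {}" using c\<Omega> M1 by auto
    have "(\<Sum>y\<in>\<Omega>. card (W y)) < (\<Sum>y\<in>\<Omega>. n + card (bd y))"
      using c f\<Omega> ne by (intro sum_strict_mono) (auto simp: not_le)
    also have "\<dots> = M ^ t * n + (\<Sum>y\<in>\<Omega>. card (bd y))" by (simp add: sum.distrib c\<Omega>)
    also have "\<dots> \<le> M ^ t * (n + 1)" using s2' by (simp add: distrib_left)
    finally have lt: "(\<Sum>x\<in>V1. card {y\<in>V2. adj x y} ^ t) < M ^ t * (n + 1)" unfolding s1 .
    have "real (card V1) * (real M / real r) ^ t \<le> (\<Sum>x\<in>V1. real (card {y\<in>V2. adj x y}) ^ t)"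
    proof (rule sum_power_ge)
      have "real (M * M) \<le> real (r * (\<Sum>x\<in>V1. card {y\<in>V2. adj x y}))" using dens by (simp only: of_nat_le_iff)
      then show "real (card V1) * (real M / real r) \<le> (\<Sum>x\<in>V1. real (card {y\<in>V2. adj x y}))"
        using r V by (simp add: field_simps)
      show "real M / real r > 0" using M1 r by simp
    qed (use V in auto)
    also have "\<dots> = real (\<Sum>x\<in>V1. card {y\<in>V2. adj x y} ^ t)" by simp
    also have "\<dots> < real (M ^ t * (n + 1))" using lt by (simp only: of_nat_less_iff)
    finally have "real M ^ t * real M < real M ^ t * (real r ^ t * real (n + 1))"
      using r V by (simp add: power_divide field_simps)
    then have "real M < real r ^ t * real (n + 1)" using M1 by simp
    then have "M < r ^ t * (n + 1)" by (metis of_nat_less_iff of_nat_mult of_nat_power)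
    also have "\<dots> \<le> r ^ t * (2 * n ^ 2)"
    proof (rule mult_left_mono)
      have "n \<le> n ^ 2" using n by (simp add: power2_eq_square)
      then show "n + 1 \<le> 2 * n ^ 2" using n by linarith
    qed simp
    also have "\<dots> \<le> M" using M unfolding t_def by (simp add: mult_ac)
    finally show False by simp
  qed
  then obtain y where y: "y \<in> \<Omega>" "n + card (bd y) \<le> card (W y)" by blast
  define U where "U = W y - (\<lambda>g. g 0) ` bd y"
  have fb: "finite (bd y)" unfolding bd_def using fBad by simp
  have "card ((\<lambda>g. g 0) ` bd y) \<le> card (bd y)" using fb by (rule card_image_le)
  then have cU: "n \<le> card U"
    using y(2) diff_card_le_card_Diff[of "(\<lambda>g. g 0) ` bd y" "W y"] fb unfolding U_def by simp
  have "n \<le> card (cn S)" if S: "S \<subseteq> U" "card S \<le> D" for S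
  proof (cases "S = {}")
    case True
    have "n \<le> n ^ 2" using n by (simp add: power2_eq_square)
    then have "n \<le> M" using Mn2 by linarith
    then show ?thesis using True V unfolding cn_def by simp
  next
    case False
    have fS: "finite S" using S fW unfolding U_def by (meson Diff_subset finite_subset)
    then obtain b where b: "bij_betw b {0..<card S} S" using ex_bij_betw_nat_finite by blast
    have cS: "card S > 0" using False fS by (simp add: card_gt_0_iff)
    \<comment> \<open>A set with fewer than \<open>D\<close> elements becomes a
      \<open>D\<close>-tuple by repeating an element.\<close>
    define g where "g = restrict (\<lambda>i. if i < card S then b i else b 0) {..<D}"
    have im: "g ` {..<D} = S"
    proof (intro equalityI subsetI)
      fix x assume "x \<in> g ` {..<D}"
      then show "x \<in> S" using b cS unfolding g_def bij_betw_def by auto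
    next
      fix x assume "x \<in> S"
      then obtain i where "i < card S" "x = b i"
        using b unfolding bij_betw_def by (metis atLeastLessThan_iff imageE)
      then show "x \<in> g ` {..<D}" using S(2) unfolding g_def by (intro image_eqI[of _ _ i]) auto
    qed
    have SW: "S \<subseteq> W y" "S \<subseteq> V1" using S unfolding U_def W_def by auto
    show ?thesis
    proof (rule ccontr)
      assume "\<not> ?thesis"
      moreover have "g \<in> PiE {..<D} (\<lambda>_. V1)"
      proof (rule PiE_I)
        fix i assume "i \<in> {..<D}"
        then show "g i \<in> V1" using im SW by blast
      qed (simp add: g_def)
      ultimately have "g \<in> bd y" using im SW unfolding bd_def Bad_def by auto
      then have "g 0 \<notin> U" unfolding U_def by blast
      moreover have "g 0 \<in> S" using im D by auto
      ultimately show False using S by blast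
    qed
  qed
  then show ?thesis using cU unfolding cn_def U_def W_def by (intro exI[of _ U]) (auto simp: U_def W_def)
qed

section \<open>Bounds for the size-Ramsey number\<close>

lemma popular_colour:
  assumes "finite Q" "\<And>q. q \<in> Q \<Longrightarrow> col q < r" "r \<ge> (1::nat)"
  shows "\<exists>k<r. card Q \<le> r * card {q\<in>Q. col q = k}"
proof (rule ccontr)
  assume c: "\<not> ?thesis"
  have "Q = (\<Union>k\<in>{..<r}. {q\<in>Q. col q = k})" using assms(2) by auto
  then have "card Q = card (\<Union>k\<in>{..<r}. {q\<in>Q. col q = k})" by simp
  also have "\<dots> = (\<Sum>k<r. card {q\<in>Q. col q = k})"
    using assms(1) by (intro card_UN_disjoint) auto
  finally have "r * card Q = (\<Sum>k<r. r * card {q\<in>Q. col q = k})" by (simp add: sum_distrib_left)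
  also have "\<dots> < (\<Sum>k<r. card Q)"
    using c assms(3) by (intro sum_strict_mono) (auto simp: not_le lessThan_empty_iff)
  finally show False by simp
qed

lemma size_ramsey_le:
  fixes G :: "nat sgraph"
  assumes "size_ramsey_host r F G" "card (edges G) \<le> b"
  shows "size_ramsey r F \<le> b"
proof -
  have "size_ramsey r F \<le> card (edges G)"
    unfolding size_ramsey_def using assms(1) by (intro Least_le) blast
  then show ?thesis using assms(2) by simp
qed

lemma subdivision_degree:
  assumes H: "finite_sgraph H" and deg: "\<And>v. v \<in> verts H \<Longrightarrow> degree H v \<le> D" and D: "D \<ge> 2"
  shows "card {a. {a, b} \<in> edges (subdivision H \<sigma>)} \<le> D"
proof -
  have edge: "\<exists>e i. e \<in> edges H \<and> i < \<sigma> e \<and> (a = subdiv_vertex \<sigma> e i \<and> b = subdiv_vertex \<sigma> e (Suc i) \<or>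
      a = subdiv_vertex \<sigma> e (Suc i) \<and> b = subdiv_vertex \<sigma> e i)" if "{a, b} \<in> edges (subdivision H \<sigma>)" for a
    using that unfolding verts_edges_subdivision by (auto simp: doubleton_eq_iff)
  show ?thesis
  proof (cases b)
    case (Inr q)
    obtain e i where q: "q = (e, i)" by (cases q)
    have "{a. {a, b} \<in> edges (subdivision H \<sigma>)} \<subseteq> {subdiv_vertex \<sigma> e (i - 1), subdiv_vertex \<sigma> e (Suc i)}"
      using edge Inr q by (fastforce simp: subdiv_vertex_def split: if_splits)
    then have "card {a. {a, b} \<in> edges (subdivision H \<sigma>)} \<le> card {subdiv_vertex \<sigma> e (i - 1), subdiv_vertex \<sigma> e (Suc i)}"
      by (intro card_mono) auto
    also have "\<dots> \<le> 2" by (simp add: card_insert_if)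
    finally show ?thesis using D by simp
  next
    case (Inl v)
    let ?E = "{f\<in>edges H. v \<in> f}"
    \<comment> \<open>The one neighbour of \<open>v\<close> on the path of \<open>f\<close>, at
      whichever end \<open>v\<close> sits; every neighbour of \<open>v\<close> arises in this
      way.\<close>
    define nb where "nb = (\<lambda>f. if v = end1 f then subdiv_vertex \<sigma> f 1 else subdiv_vertex \<sigma> f (\<sigma> f - 1))"
    have ends: "f = {end1 f, end2 f}" "end1 f \<noteq> end2 f" if "f \<in> edges H" for f
      using end1_end2[of f "verts H"] H that by (auto simp: finite_sgraph_def)
    have fE: "finite ?E"
      using H finite_imp_finite_nsets finite_subset unfolding finite_sgraph_def by (metis finite_Collect_conjI Collect_mem_eq)
    have "{a. {a, b} \<in> edges (subdivision H \<sigma>)} \<subseteq> nb ` ?E"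
    proof
      fix a assume "a \<in> {a. {a, b} \<in> edges (subdivision H \<sigma>)}"
      then obtain e i where e: "e \<in> edges H" "i < \<sigma> e" and
        ab: "a = subdiv_vertex \<sigma> e i \<and> b = subdiv_vertex \<sigma> e (Suc i) \<or> a = subdiv_vertex \<sigma> e (Suc i) \<and> b = subdiv_vertex \<sigma> e i"
        using edge by blast
      have "v \<in> e \<and> a = nb e"
        using ab
      proof
        assume "a = subdiv_vertex \<sigma> e i \<and> b = subdiv_vertex \<sigma> e (Suc i)"
        then have "v = end2 e" "Suc i = \<sigma> e" "a = subdiv_vertex \<sigma> e i"
          using Inl by (auto simp: subdiv_vertex_def split: if_splits)
        then show ?thesis using ends[OF e(1)] unfolding nb_def by (metis diff_Suc_1 insertCI)
      next
        assume "a = subdiv_vertex \<sigma> e (Suc i) \<and> b = subdiv_vertex \<sigma> e i"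
        then have "v = end1 e" "i = 0" "a = subdiv_vertex \<sigma> e (Suc i)"
          using Inl e(2) by (auto simp: subdiv_vertex_def split: if_splits)
        then show ?thesis using ends[OF e(1)] unfolding nb_def by (metis One_nat_def insertCI)
      qed
      then show "a \<in> nb ` ?E" using e by blast
    qed
    then have "card {a. {a, b} \<in> edges (subdivision H \<sigma>)} \<le> card (nb ` ?E)" using fE by (intro card_mono) auto
    also have "\<dots> \<le> card ?E" by (rule card_image_le[OF fE])
    also have "\<dots> \<le> D"
    proof (cases "v \<in> verts H")
      case True
      then show ?thesis using deg unfolding degree_def by blast
    next
      case False
      then have "?E = {}" using H unfolding finite_sgraph_def nsets_def by blast
      then show ?thesis by (simp only: card.empty)
    qed
    finally show ?thesis .
  qed
qed

text \<open>One part of \<open>F\<close> goes anywhere into the set given by dependent random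
  choice. The other part follows greedily: the neighbours of each vertex, at most \<open>D\<close>
  of them, have \<open>n\<close> common neighbours in the colour, and fewer than \<open>n\<close>
  are taken.\<close>

lemma size_ramsey_bipartite_le:
  fixes F :: "'a sgraph"
  assumes F: "finite_sgraph F" and bip: "bipartite F" and deg: "\<And>b. card {a. {a, b} \<in> edges F} \<le> D"
    and D: "D \<ge> 1" and r: "r \<ge> 1" and n: "n = card (verts F)" "n \<ge> 1"
  shows "size_ramsey r F \<le> (2 * r ^ (2 * D) * n ^ 2) ^ 2"
proof -
  define M where "M = 2 * r ^ (2 * D) * n ^ 2"
  define V1 where "V1 = {..<M}"
  define V2 where "V2 = {M..<2 * M}"
  define G where "G = \<lparr>verts = {..<2 * M}, edges = (\<lambda>(x, y). {x, y}) ` (V1 \<times> V2)\<rparr>"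
  have V: "finite V1" "finite V2" "card V1 = M" "card V2 = M" unfolding V1_def V2_def by auto
  have dis: "V1 \<inter> V2 = {}" unfolding V1_def V2_def by auto
  obtain A B where AB: "A \<union> B = verts F" "A \<inter> B = {}" "\<forall>e\<in>edges F. \<exists>a\<in>A. \<exists>b\<in>B. e = {a, b}"
    using bip unfolding bipartite_def by (elim exE conjE)
  have "finite (A \<union> B)" unfolding AB(1) using F by (simp add: finite_sgraph_def)
  then have fin: "finite A" "finite B" by auto
  have cAB: "card A \<le> n" "card B \<le> n"
    unfolding n AB(1)[symmetric] using fin by (auto intro: card_mono)
  have "\<exists>k<r. monochromatic_copy G c k F" if c: "c \<in> edges G \<rightarrow> {..<r}" for c
  proof -
    have "\<exists>k<r. card (V1 \<times> V2) \<le> r * card {q\<in>V1 \<times> V2. c {fst q, snd q} = k}"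
    proof (rule popular_colour)
      fix q assume q: "q \<in> V1 \<times> V2"
      then have "{fst q, snd q} \<in> edges G" unfolding G_def by (auto intro!: image_eqI[of _ _ q])
      then show "c {fst q, snd q} < r" using c by (auto simp: Pi_def)
    qed (use V r in auto)
    then obtain k where k: "k < r" "M * M \<le> r * card {q\<in>V1 \<times> V2. c {fst q, snd q} = k}"
      using V by (auto simp: card_cartesian_product)
    have "{q\<in>V1 \<times> V2. c {fst q, snd q} = k} = (SIGMA x:V1. {y\<in>V2. c {x, y} = k})" by auto
    then have "M * M \<le> r * (\<Sum>x\<in>V1. card {y\<in>V2. c {x, y} = k})" using k(2) V by simp
    from dependent_random_choice[OF V this r D n(2)] obtain U where U: "U \<subseteq> V1" "n \<le> card U"
      and cn: "\<And>S. S \<subseteq> U \<Longrightarrow> card S \<le> D \<Longrightarrow> n \<le> card {y\<in>V2. \<forall>x\<in>S. c {x, y} = k}"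
      unfolding M_def by blast
    have fU: "finite U" using U V finite_subset by blast
    obtain f where f: "f ` A \<subseteq> U" "inj_on f A"
      using card_le_inj[OF fin(1) fU] cAB U by auto
    define nb where "nb = (\<lambda>b. {a\<in>A. {a, b} \<in> edges F})"
    have cnb: "n \<le> card {y\<in>V2. \<forall>x\<in>f ` nb b. c {x, y} = k}" for b
    proof (rule cn)
      show "f ` nb b \<subseteq> U" using f unfolding nb_def by blast
      have sub: "nb b \<subseteq> {a. {a, b} \<in> edges F}" unfolding nb_def by blast
      have "finite {a. {a, b} \<in> edges F}"
      proof (rule finite_subset)
        show "{a. {a, b} \<in> edges F} \<subseteq> verts F" using F unfolding finite_sgraph_def nsets_def by auto
      qed (use F in \<open>simp add: finite_sgraph_def\<close>)
      then have "card (nb b) \<le> D" using card_mono[OF _ sub] deg[of b] by linarith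
      moreover have "card (f ` nb b) \<le> card (nb b)" using fin unfolding nb_def by (intro card_image_le) simp
      ultimately show "card (f ` nb b) \<le> D" by simp
    qed
    have greedy: "\<exists>g. inj_on g B' \<and> (\<forall>b\<in>B'. g b \<in> {y\<in>V2. \<forall>x\<in>f ` nb b. c {x, y} = k})" if "finite B'" "card B' \<le> n" for B'
      using that
    proof (induction B')
      case (insert b B')
      then obtain g where g: "inj_on g B'" "\<forall>b\<in>B'. g b \<in> {y\<in>V2. \<forall>x\<in>f ` nb b. c {x, y} = k}" by auto
      have "card (g ` B') < n" using insert card_image_le[of B' g] by auto
      then have "card (g ` B') < card {y\<in>V2. \<forall>x\<in>f ` nb b. c {x, y} = k}" using cnb[of b] by linarith
      then obtain y where y: "y \<in> {y\<in>V2. \<forall>x\<in>f ` nb b. c {x, y} = k}" "y \<notin> g ` B'"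
        using insert.hyps(1) by (meson card_mono finite_imageI leD subsetI)
      have "inj_on (g(b := y)) (insert b B')" using g(1) y(2) insert.hyps(2) by (auto simp: inj_on_def)
      moreover have "\<forall>b'\<in>insert b B'. (g(b := y)) b' \<in> {y\<in>V2. \<forall>x\<in>f ` nb b'. c {x, y} = k}"
        using g(2) y(1) insert.hyps(2) by auto
      ultimately show ?case by blast
    qed simp
    obtain g where g: "inj_on g B" "\<forall>b\<in>B. g b \<in> {y\<in>V2. \<forall>x\<in>f ` nb b. c {x, y} = k}"
      using greedy[OF fin(2) cAB(2)] by (elim exE conjE)
    define \<phi> where "\<phi> = (\<lambda>z. if z \<in> A then f z else g z)"
    have imA: "\<phi> z \<in> V1" if "z \<in> A" for z using f U that unfolding \<phi>_def by auto
    have imB: "\<phi> z \<in> V2" "\<phi> z = g z" if "z \<in> B" for z using bspec[OF g(2), of z] AB(2) that unfolding \<phi>_def by auto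
    have "inj_on \<phi> (verts F)"
    proof (rule inj_onI)
      fix x y assume xy: "x \<in> verts F" "y \<in> verts F" "\<phi> x = \<phi> y"
      then have "x \<in> A \<and> y \<in> A \<or> x \<in> B \<and> y \<in> B" using AB(1) imA imB dis by (metis UnE disjoint_iff)
      then show "x = y" using xy(3) inj_onD[OF f(2)] inj_onD[OF g(1)] imB(2) unfolding \<phi>_def by metis
    qed
    moreover have "\<phi> ` verts F \<subseteq> verts G"
      using imA imB(1) AB(1) unfolding G_def V1_def V2_def by fastforce
    moreover have "\<phi> ` e \<in> edges G \<and> c (\<phi> ` e) = k" if e: "e \<in> edges F" for e
    proof -
      obtain a b where ab: "a \<in> A" "b \<in> B" "e = {a, b}" using bspec[OF AB(3) e] by (elim bexE)
      have "\<phi> a = f a" "\<phi> b = g b" using ab imB(2) unfolding \<phi>_def by auto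
      then have im: "\<phi> ` e = {f a, g b}" using ab(3) by simp
      have "f a \<in> V1" "g b \<in> V2" using imA[OF ab(1)] imB[OF ab(2)] ab(1) unfolding \<phi>_def by auto
      moreover have "c {f a, g b} = k" using bspec[OF g(2) ab(2)] ab e unfolding nb_def by auto
      ultimately show ?thesis unfolding im G_def by auto
    qed
    ultimately show ?thesis using k(1) unfolding monochromatic_copy_def by blast
  qed
  moreover have "finite_sgraph G"
    unfolding finite_sgraph_def G_def V1_def V2_def nsets_def by (auto simp: card_insert_if)
  ultimately have "size_ramsey_host r F G" unfolding size_ramsey_host_def by blast
  moreover have "card (edges G) \<le> (2 * r ^ (2 * D) * n ^ 2) ^ 2"
  proof -
    have "card (edges G) \<le> card (V1 \<times> V2)" unfolding G_def sgraph.simps using V by (intro card_image_le) simp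
    then show ?thesis using V unfolding M_def[symmetric] by (simp add: card_cartesian_product power2_eq_square)
  qed
  ultimately show ?thesis by (rule size_ramsey_le)
qed

lemma wt_count:
  assumes "finite A" "finite B"
  shows "wt (\<lambda>x y. real (card {i\<in>{..<d::nat}. f (x, i) = y \<and> P x y})) A B =
    real (card {q\<in>A \<times> {..<d}. f q \<in> B \<and> P (fst q) (f q)})"
proof -
  have "(\<Sum>y\<in>B. card {i\<in>{..<d}. f (x, i) = y \<and> P x y}) = card {i\<in>{..<d}. f (x, i) \<in> B \<and> P x (f (x, i))}" for x
  proof -
    have "{i\<in>{..<d}. f (x, i) \<in> B \<and> P x (f (x, i))} = (\<Union>y\<in>B. {i\<in>{..<d}. f (x, i) = y \<and> P x y})" by auto
    then show ?thesis using assms by (simp only:) (intro card_UN_disjoint[symmetric]; auto)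
  qed
  then have "wt (\<lambda>x y. real (card {i\<in>{..<d::nat}. f (x, i) = y \<and> P x y})) A B =
     real (\<Sum>x\<in>A. card {i\<in>{..<d}. f (x, i) \<in> B \<and> P x (f (x, i))})"
    unfolding wt_def by (simp flip: of_nat_sum)
  also have "(\<Sum>x\<in>A. card {i\<in>{..<d}. f (x, i) \<in> B \<and> P x (f (x, i))}) =
     card (SIGMA x:A. {i\<in>{..<d}. f (x, i) \<in> B \<and> P x (f (x, i))})"
    using assms by simp
  also have "(SIGMA x:A. {i\<in>{..<d}. f (x, i) \<in> B \<and> P x (f (x, i))}) = {q\<in>A \<times> {..<d}. f q \<in> B \<and> P (fst q) (f q)}"
    by auto
  finally show ?thesis .
qed

lemma least_power:
  fixes m b :: nat
  assumes "m \<ge> 1" "b \<ge> 2"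
  shows "\<exists>h. m \<le> b ^ h \<and> b ^ h \<le> b * m \<and> (h > 0 \<longrightarrow> b ^ (h - 1) < m)"
proof -
  define h where "h = (LEAST h. m \<le> b ^ h)"
  have "m < b ^ m" using assms(2) by (meson less_exp less_le_trans power_mono zero_le_numeral)
  then have 1: "m \<le> b ^ h" unfolding h_def by (intro LeastI[of "\<lambda>h. m \<le> b ^ h" m]) simp
  have 2: "b ^ (h - 1) < m" if "h > 0"
    using not_less_Least[of "h - 1" "\<lambda>h. m \<le> b ^ h"] that unfolding h_def by simp
  have "b ^ h \<le> b * m"
  proof (cases h)
    case 0
    then show ?thesis using assms by simp
  next
    case (Suc i)
    then show ?thesis using 2 by simp
  qed
  then show ?thesis using 1 2 by blast
qed

lemma size_ramsey_long_subdivision_le: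
  fixes H :: "'a sgraph"
  assumes H: "finite_sgraph H" and deg: "\<And>v. v \<in> verts H \<Longrightarrow> degree H v \<le> D" and D: "D \<ge> 3" and r: "r \<ge> 1"
    and bip: "bipartite (subdivision H \<sigma>)" and n: "n = card (verts (subdivision H \<sigma>))" "n \<ge> 1"
    and j: "64 * D ^ 2 \<le> 2 ^ j" and large: "D ^ 6 * (4 * r) ^ (4 * j) \<le> n"
    and long: "\<And>e. e \<in> edges H \<Longrightarrow> n ^ 2 \<le> D ^ \<sigma> e"
  shows "size_ramsey r (subdivision H \<sigma>) \<le> 2 * (32 * D ^ 2 * (4 * r) ^ (4 * j)) ^ 3 * n"
proof -
  let ?F = "subdivision H \<sigma>"
  define k where "k = 4 * j"
  \<comment> \<open>The ratio s/m that the expander demands for \<open>\<Delta> = D ^ 2\<close>. The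
    extra factor \<open>(4 * r) ^ k\<close> in \<open>P\<close> compensates the shrinking of the
    best pair, so that \<open>s \<ge> n * T\<close> and hence \<open>m \<ge> n\<close>.\<close>
  define T where "T = 32 * D ^ 2"
  define P where "P = T * (4 * r) ^ k"
  define N where "N = n * P"
  define d where "d = 2 * P ^ 2"
  define V1 where "V1 = {..<N}"
  define V2 where "V2 = {N..<2 * N}"
  have V: "finite V1" "finite V2" "card V1 = n * P" "card V2 = n * P" unfolding V1_def V2_def N_def by auto
  have dis: "V1 \<inter> V2 = {}" unfolding V1_def V2_def by auto
  have D2: "D ^ 2 \<ge> 9" using power_mono[OF D, of 2] by simp
  have rk: "(4 * r) ^ k \<ge> 1" using r by simp
  have T: "T \<ge> 288" using D2 unfolding T_def by simp
  have P1: "P \<ge> 1" using T rk unfolding P_def by simp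
  have j1: "j \<ge> 1" using j D2 by (cases j) auto
  obtain f where f: "\<forall>q\<in>V1 \<times> {..<d}. f q \<in> V2"
    "\<forall>A B. A \<subseteq> V1 \<longrightarrow> B \<subseteq> V2 \<longrightarrow> card A = n \<longrightarrow> card B = n \<longrightarrow>
      card {q \<in> A \<times> {..<d}. f q \<in> B} \<le> 8 * (n * P)"
    using uniform_host_exists[OF V n(2) P1] unfolding d_def[symmetric] by (elim exE conjE)
  have fV: "f q \<in> V2" if "q \<in> V1 \<times> {..<d}" for q using f(1) that by (rule bspec)
  have sp: "card {q \<in> A \<times> {..<d}. f q \<in> B} \<le> 8 * (n * P)"
    if "A \<subseteq> V1" "B \<subseteq> V2" "card A = n" "card B = n" for A B
    using f(2)[rule_format, OF that] .
  define G where "G = \<lparr>verts = {..<2 * N}, edges = (\<lambda>q. {fst q, f q}) ` (V1 \<times> {..<d})\<rparr>"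
  have "\<exists>c0<r. monochromatic_copy G c c0 ?F" if c: "c \<in> edges G \<rightarrow> {..<r}" for c
  proof -
    have "\<exists>c0<r. card (V1 \<times> {..<d}) \<le> r * card {q\<in>V1 \<times> {..<d}. c {fst q, f q} = c0}"
    proof (rule popular_colour)
      fix q assume "q \<in> V1 \<times> {..<d}"
      then have "{fst q, f q} \<in> edges G" unfolding G_def by simp
      then show "c {fst q, f q} < r" using c by (auto simp: Pi_def)
    qed (use V r in auto)
    then obtain c0 where c0: "c0 < r" "card (V1 \<times> {..<d}) \<le> r * card {q\<in>V1 \<times> {..<d}. c {fst q, f q} = c0}" by blast
    define w where "w = (\<lambda>x y. real (card {i\<in>{..<d}. f (x, i) = y \<and> c {x, y} = c0}))"
    have w0: "w x y \<ge> 0" for x y unfolding w_def by simp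
    have wt: "wt w A B = real (card {q\<in>A \<times> {..<d}. f q \<in> B \<and> c {fst q, f q} = c0})" if "finite A" "finite B" for A B
      unfolding w_def using wt_count[OF that, of d f "\<lambda>x y. c {x, y} = c0"] .
    have nP: "n \<le> card V1" using V P1 by simp
    obtain X Y where dX: "densest w n k V1 V2 X Y"
      using densest_exists[OF V(1,2) _ n(2) nP] V by force
    have total: "real (2 * P ^ 2 * (n * P)) \<le> real r * wt w V1 V2"
    proof -
      have "{q\<in>V1 \<times> {..<d}. f q \<in> V2 \<and> c {fst q, f q} = c0} = {q\<in>V1 \<times> {..<d}. c {fst q, f q} = c0}"
        using fV by blast
      then have "real r * wt w V1 V2 = real (r * card {q\<in>V1 \<times> {..<d}. c {fst q, f q} = c0})"
        unfolding wt[OF V(1,2)] by simp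
      moreover have "card (V1 \<times> {..<d}) = 2 * P ^ 2 * (n * P)" using V by (simp add: card_cartesian_product d_def)
      ultimately show ?thesis using c0(2) by (simp only: of_nat_le_iff)
    qed
    have sparse: "wt w A B \<le> real (8 * (n * P))" if "A \<subseteq> V1" "B \<subseteq> V2" "card A = n" "card B = n" for A B
    proof -
      have fAB: "finite A" "finite B" using that V finite_subset by blast+
      have "card {q\<in>A \<times> {..<d}. f q \<in> B \<and> c {fst q, f q} = c0} \<le> card {q\<in>A \<times> {..<d}. f q \<in> B}"
        using fAB by (intro card_mono) auto
      then show ?thesis unfolding wt[OF fAB] using sp[OF that] by (simp only: of_nat_le_iff)
    qed
    have k1: "k \<ge> 1" using j1 unfolding k_def by simp
    have r0: "r > 0" using r by simp
    have size: "n * P \<le> (4 * r) ^ k * card X" and pos: "wt w X Y > 0"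
      by (rule densest_size[OF dX k1 w0 V n(2) P1 r0 total]; rule sparse; assumption)+
    define s where "s = card X"
    have X: "X \<subseteq> V1" "Y \<subseteq> V2" "card X = s" "card Y = s" using dX unfolding densest_def s_def by auto
    have fX: "finite X" "finite Y" using X V finite_subset by blast+
    have "(4 * r) ^ k * (n * T) \<le> (4 * r) ^ k * s" using size unfolding P_def s_def by (simp add: mult_ac)
    then have snT: "n * T \<le> s" using rk r by simp
    have sN: "s \<le> n * P" using card_mono[OF V(1) X(1)] V(3) X(3) by simp
    define m where "m = s div T"
    have mn: "n \<le> m" unfolding m_def using snT T by (simp add: less_eq_div_iff_mult_less_eq)
    have m1: "m \<ge> 1" using mn n by simp
    have mT: "T * m \<le> s" unfolding m_def by simp
    \<comment> \<open>Rounding in \<open>s div T\<close> costs a factor below 2, which is why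
      \<open>j\<close> satisfies \<open>64 * D ^ 2 \<le> 2 ^ j\<close> and not just 32.\<close>
    have "s < T * m + T" unfolding m_def using T dividend_less_times_div[of T s] by simp
    moreover have "T \<le> T * m" using m1 by simp
    ultimately have "s < 2 * T * m" unfolding mult.assoc by linarith
    moreover have "2 * T * m \<le> 2 ^ j * m" using j unfolding T_def by (intro mult_right_mono) auto
    ultimately have sj: "s < 2 ^ j * m" by linarith
    have "288 * m \<le> T * m" using T by (intro mult_right_mono) auto
    then have m5: "5 * m < 3 * s" and ns: "n < s" using mT m1 mn by linarith+
    have mle: "m \<le> n * (4 * r) ^ k"
    proof -
      have "n * P = T * (n * (4 * r) ^ k)" unfolding P_def by (simp only: mult_ac)
      then have "T * m \<le> T * (n * (4 * r) ^ k)" using mT sN by linarith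
      then show ?thesis using T by simp
    qed
    define adj where "adj = (\<lambda>x y. x \<in> X \<and> y \<in> Y \<and> w x y > 0 \<or> x \<in> Y \<and> y \<in> X \<and> w y x > 0)"
    have XY: "X \<inter> Y = {}" using X dis by blast
    have w0': "(\<lambda>y x. w x y) x y \<ge> 0" for x y using w0 .
    have pos': "wt (\<lambda>y x. w x y) Y X > 0" using pos wt_swap[of w X Y] by simp
    have expX: "3 * s \<le> 5 * card {y. \<exists>x\<in>U. adj x y}" if "U \<subseteq> X" "m \<le> card U" for U
    proof -
      have "3 * card X \<le> 5 * card {y\<in>Y. \<exists>x\<in>U. w x y > 0}"
        using densest_expands[OF dX[unfolded k_def] V(1,2) w0 pos j1 _ n(2) mn _ _ that] ns m5 sj X by simp
      moreover have "{y\<in>Y. \<exists>x\<in>U. w x y > 0} = {y. \<exists>x\<in>U. adj x y}" using that XY unfolding adj_def by blast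
      ultimately show ?thesis using X by simp
    qed
    have expY: "3 * s \<le> 5 * card {y. \<exists>x\<in>U. adj x y}" if "U \<subseteq> Y" "m \<le> card U" for U
    proof -
      have "3 * card Y \<le> 5 * card {y\<in>X. \<exists>x\<in>U. w y x > 0}"
        using densest_expands[OF densest_swap[OF dX[unfolded k_def]] V(2,1) w0' pos' j1 _ n(2) mn _ _ that] ns m5 sj X by simp
      moreover have "{y\<in>X. \<exists>x\<in>U. w y x > 0} = {y. \<exists>x\<in>U. adj x y}" using that XY unfolding adj_def by blast
      ultimately show ?thesis using X by simp
    qed
    interpret bipartite_expander X Y adj s m "D ^ 2"
    proof
      show "32 * D ^ 2 * m \<le> s" using mT unfolding T_def .
      show "3 * s \<le> 5 * card {y. \<exists>x\<in>U. adj x y}" if "U \<subseteq> X \<or> U \<subseteq> Y" "m \<le> card U" for U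
        using expX expY that by blast
    qed (use fX XY X m1 D2 in \<open>auto simp: adj_def\<close>)
    obtain h where h: "m \<le> (D ^ 2) ^ h" "(D ^ 2) ^ h \<le> D ^ 2 * m" "h > 0 \<Longrightarrow> (D ^ 2) ^ (h - 1) < m"
      using least_power[OF m1, of "D ^ 2"] D2 by auto
    \<comment> \<open>One factor \<open>n\<close> of \<open>n ^ 2\<close> pays for the
      \<open>n\<close> in \<open>m\<close>, the other, by \<open>large\<close>, for
      \<open>(4 * r) ^ k\<close> and \<open>D ^ 6\<close>. With \<open>(D ^ 2) ^ (h - 1) < m\<close>
      this gives 2(h - 1) + 6 < \<open>\<sigma> e\<close>, so 6 is the exponent that yields the
      required 5.\<close>
    have hl: "2 * h + 5 \<le> \<sigma> e" if e: "e \<in> edges H" for e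
    proof -
      have "D ^ 6 * m \<le> D ^ 6 * (n * (4 * r) ^ k)" using mle by simp
      also have "\<dots> = n * (D ^ 6 * (4 * r) ^ k)" by (simp only: mult_ac)
      also have "\<dots> \<le> n * n" using large unfolding k_def by simp
      also have "\<dots> \<le> D ^ \<sigma> e" using long[OF e] by (simp add: power2_eq_square)
      finally have Dm: "D ^ 6 * m \<le> D ^ \<sigma> e" .
      show ?thesis
      proof (cases "h = 0")
        case True
        have "D ^ 6 * 1 \<le> D ^ 6 * m" using m1 by (intro mult_left_mono) auto
        then have "D ^ 6 \<le> D ^ \<sigma> e" using Dm by linarith
        then have "6 \<le> \<sigma> e" using D by (simp add: power_increasing_iff)
        then show ?thesis using True by simp
      next
        case False
        then have "D ^ 6 * (D ^ 2) ^ (h - 1) < D ^ 6 * m" using h(3) D by simp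
        also have "D ^ 6 * (D ^ 2) ^ (h - 1) = D ^ (6 + 2 * (h - 1))" by (simp only: power_add power_mult)
        finally have "D ^ (6 + 2 * (h - 1)) < D ^ \<sigma> e" using Dm by linarith
        then have "6 + 2 * (h - 1) < \<sigma> e" using D by (simp add: power_strict_increasing_iff)
        then show ?thesis using False by linarith
      qed
    qed
    have degD: "degree H v \<le> D ^ 2" if "v \<in> verts H" for v
    proof -
      have "D \<le> D ^ 2" using D by (simp add: power2_eq_square)
      then show ?thesis using deg[OF that] by linarith
    qed
    obtain \<phi> where \<phi>: "inj_on \<phi> (verts ?F)" "\<phi> ` verts ?F \<subseteq> X \<union> Y"
      "\<And>e i. e \<in> edges H \<Longrightarrow> i < \<sigma> e \<Longrightarrow> adj (\<phi> (subdiv_vertex \<sigma> e i)) (\<phi> (subdiv_vertex \<sigma> e (Suc i)))"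
      using embed_subdivision[OF H degD _ bip h(1,2) hl] mn n(1) by auto
    have mono: "{x, y} \<in> edges G \<and> c {x, y} = c0" if "adj x y" for x y
    proof -
      have "{x, y} \<in> edges G \<and> c {x, y} = c0" if xy: "x \<in> X" "w x y > 0" for x y
      proof -
        have "{i\<in>{..<d}. f (x, i) = y \<and> c {x, y} = c0} \<noteq> {}" using xy(2) unfolding w_def by (metis card.empty less_irrefl of_nat_0)
        then obtain i where "i < d" "f (x, i) = y" "c {x, y} = c0" by blast
        then show ?thesis using xy(1) X unfolding G_def by (auto intro!: image_eqI[of _ _ "(x, i)"])
      qed
      then show ?thesis using that unfolding adj_def by (metis insert_commute)
    qed
    have "\<phi> ` e \<in> edges G \<and> c (\<phi> ` e) = c0" if e: "e \<in> edges ?F" for e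
    proof -
      obtain e' i where "e' \<in> edges H" "i < \<sigma> e'" "e = {subdiv_vertex \<sigma> e' i, subdiv_vertex \<sigma> e' (Suc i)}"
        using e unfolding verts_edges_subdivision by blast
      then show ?thesis using mono[OF \<phi>(3)] by simp
    qed
    moreover have "\<phi> ` verts ?F \<subseteq> verts G" using \<phi>(2) X unfolding G_def V1_def V2_def by fastforce
    ultimately show ?thesis using \<phi>(1) c0(1) unfolding monochromatic_copy_def by blast
  qed
  moreover have "finite_sgraph G"
  proof -
    have "{fst q, f q} \<in> [{..<2 * N}]\<^bsup>2\<^esup>" if q: "q \<in> V1 \<times> {..<d}" for q
    proof -
      have "fst q < N" "N \<le> f q" "f q < 2 * N" using q fV[OF q] unfolding V1_def V2_def by auto
      then show ?thesis unfolding nsets_def by auto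
    qed
    then show ?thesis unfolding finite_sgraph_def G_def by auto
  qed
  ultimately have "size_ramsey_host r ?F G" unfolding size_ramsey_host_def by blast
  moreover have "card (edges G) \<le> 2 * (32 * D ^ 2 * (4 * r) ^ (4 * j)) ^ 3 * n"
  proof -
    have "card (edges G) \<le> card (V1 \<times> {..<d})" unfolding G_def sgraph.simps using V by (intro card_image_le) simp
    also have "\<dots> = 2 * P ^ 3 * n" using V by (simp add: card_cartesian_product d_def power2_eq_square power3_eq_cube)
    finally show ?thesis unfolding P_def T_def k_def .
  qed
  ultimately show ?thesis by (rule size_ramsey_le)
qed

section \<open>Numerical estimates and the case distinction on \<open>n\<close>\<close>

lemma degree_le_max_degree:
  assumes "finite_sgraph H" "v \<in> verts H"
  shows "degree H v \<le> max_degree H"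
  unfolding max_degree_def using assms by (intro cSUP_upper) (auto simp: finite_sgraph_def)

lemma max_degree_pos_edge:
  assumes "max_degree H > 0"
  shows "\<exists>e. e \<in> edges H"
proof (rule ccontr)
  assume "\<not> ?thesis"
  then have "degree H v = 0" for v unfolding degree_def by simp
  then have "max_degree H = (SUP v\<in>verts H. 0)" unfolding max_degree_def by simp
  \<comment> \<open>On natural numbers the supremum of the empty set is 0, which settles the graph
    without vertices.\<close>
  also have "\<dots> = 0" by (cases "verts H = {}") simp_all
  finally show False using assms by simp
qed

lemma subdivision_card_ge_2:
  assumes H: "finite_sgraph H" and e: "e \<in> edges H"
  shows "card (verts (subdivision H \<sigma>)) \<ge> 2"
proof -
  have fin: "finite (verts (subdivision H \<sigma>))"
    using finite_sgraph_subdivision[OF H] unfolding finite_sgraph_def by blast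
  have e2: "e \<subseteq> verts H" "card e = 2" using H e unfolding finite_sgraph_def nsets_def by auto
  then have "(Inl ` e :: ('a + 'a set \<times> nat) set) \<subseteq> verts (subdivision H \<sigma>)"
    unfolding verts_edges_subdivision by blast
  from card_mono[OF fin this] show ?thesis using e2 by (simp add: card_image)
qed

text \<open>The base \<open>D - 1\<close> is raised to \<open>D\<close> at the end, the form that is
  compared with powers of the branching \<open>D ^ 2\<close>.\<close>

lemma square_le_power_of_elog:
  assumes D: "D \<ge> 3" and n: "n \<ge> 1" and l: "ereal (real l) \<ge> 2 * elog (real D - 1) (real n)"
  shows "n ^ 2 \<le> D ^ l"
proof -
  let ?b = "real D - 1"
  have b: "?b > 1" using D by simp
  have "ereal (real l) \<ge> ereal (2 * log ?b (real n))" using l b by (simp add: elog_eq_log)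
  then have "2 * log ?b (real n) \<le> real l" by simp
  then have "?b powr (2 * log ?b (real n)) \<le> ?b powr real l" using b by simp
  also have "?b powr (2 * log ?b (real n)) = (?b powr log ?b (real n)) ^ 2"
    using b by (simp add: powr_powr[symmetric] powr_power mult.commute)
  also have "?b powr log ?b (real n) = real n" using b n by simp
  also have "?b powr real l = ?b ^ l" using b by (simp add: powr_realpow)
  also have "\<dots> \<le> real D ^ l" using b by (intro power_mono) auto
  finally have "real (n ^ 2) \<le> real (D ^ l)" by simp
  then show ?thesis by (simp only: of_nat_le_iff)
qed

text \<open>As \<open>2 ^ j\<close> is at most \<open>128 * D ^ 2\<close>, the bounds ln 2 \<ge> 1/2
  and ln D \<ge> 1 give j \<le> 7 + 4 ln D \<le> 11 ln D. By \<open>4 * r \<le> r ^ 3\<close> the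
  power \<open>(4 * r) ^ (4 * j)\<close> costs 12 * 11 = 132 times ln D in the exponent, and
  \<open>D ^ 6\<close> costs 12 times; 144 is the sum.\<close>

lemma power_constants:
  fixes r D :: nat
  assumes r: "r \<ge> 2" and D: "D \<ge> 3"
  shows "\<exists>j. 64 * D ^ 2 \<le> 2 ^ j \<and> real (D ^ 6 * (4 * r) ^ (4 * j)) \<le> real r powr (144 * ln (real D)) \<and>
    real (2 * (32 * D ^ 2 * (4 * r) ^ (4 * j)) ^ 3) \<le> real r powr (400 * real D * ln (real D))"
proof -
  define L where "L = ln (real D)"
  have L1: "L \<ge> 1"
  proof -
    have "exp 1 \<le> real D" using exp_le D by linarith
    then show ?thesis unfolding L_def using D by (simp add: ln_ge_iff)
  qed
  have l2: "ln (2::real) \<ge> 1 / 2"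
  proof -
    have "exp (1 / 2) ^ 2 \<le> (2::real) ^ 2" using exp_le by (simp add: exp_of_nat_mult[symmetric])
    then have "exp (1 / 2) \<le> (2::real)" by (rule power2_le_imp_le) simp
    then show ?thesis by (subst ln_ge_iff) simp_all
  qed
  have rp: "real r \<ge> 1" "real r > 1" using r by auto
  have lr: "ln (real r) \<ge> 1 / 2"
  proof -
    have "ln (2::real) \<le> ln (real r)" using r by simp
    then show ?thesis using l2 by linarith
  qed
  have "64 * D ^ 2 \<ge> 1" using D by simp
  then obtain j where j: "64 * D ^ 2 \<le> 2 ^ j" "2 ^ j \<le> 2 * (64 * D ^ 2)"
    using least_power[of "64 * D ^ 2" 2] by auto
  have jL: "real j \<le> 11 * L"
  proof -
    have "real (2 ^ j) \<le> real (2 * (64 * D ^ 2))" using j(2) by (simp only: of_nat_le_iff)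
    also have "real (2 * (64 * D ^ 2)) = 2 ^ 7 * real D ^ 2" by simp
    finally have "(2::real) ^ j \<le> 2 ^ 7 * real D ^ 2" by simp
    then have "ln ((2::real) ^ j) \<le> ln (2 ^ 7 * real D ^ 2)" using D by (subst ln_le_cancel_iff) simp_all
    also have "\<dots> = ln ((2::real) ^ 7) + ln (real D ^ 2)" using D by (subst ln_mult) simp_all
    also have "ln ((2::real) ^ 7) = 7 * ln 2" by (subst ln_realpow) simp_all
    also have "ln (real D ^ 2) = 2 * L" unfolding L_def using D by (subst ln_realpow) simp_all
    finally have "real j * ln 2 \<le> 7 * ln 2 + 2 * L" by (simp add: ln_realpow)
    also have "2 * L \<le> (4 * L) * ln 2" using mult_left_mono[OF l2, of "4 * L"] L1 by simp
    finally have "real j * ln 2 \<le> (7 + 4 * L) * ln 2" by (simp add: algebra_simps)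
    then have "real j \<le> 7 + 4 * L" using l2 by simp
    then show ?thesis using L1 by linarith
  qed
  have DL: "real D \<le> real r powr (2 * L)"
  proof -
    have "L \<le> (2 * L) * ln (real r)" using mult_left_mono[OF lr, of "2 * L"] L1 by simp
    then have "exp L \<le> exp ((2 * L) * ln (real r))" by simp
    then show ?thesis using D r unfolding L_def by (simp add: powr_def)
  qed
  have r4: "real ((4 * r) ^ (4 * j)) \<le> real r powr (132 * L)"
  proof -
    have "4 \<le> r * r" using mult_le_mono[OF r r] by simp
    then have "4 * r \<le> r ^ 3" by (simp add: power3_eq_cube)
    then have "(4 * r) ^ (4 * j) \<le> (r ^ 3) ^ (4 * j)" by (intro power_mono) auto
    also have "\<dots> = r ^ (12 * j)" by (simp add: power_mult[symmetric])
    finally have "real ((4 * r) ^ (4 * j)) \<le> real (r ^ (12 * j))" by (simp only: of_nat_le_iff)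
    also have "\<dots> = real r powr real (12 * j)" using powr_realpow[of "real r" "12 * j"] r by simp
    also have "\<dots> \<le> real r powr (132 * L)" using jL rp by (intro powr_mono) auto
    finally show ?thesis .
  qed
  have D6: "real (D ^ 6) \<le> real r powr (12 * L)"
  proof -
    have "real (D ^ 6) \<le> (real r powr (2 * L)) ^ 6" using DL by (simp add: power_mono)
    also have "\<dots> = real r powr (12 * L)" using rp by (simp add: powr_power)
    finally show ?thesis .
  qed
  have "real (D ^ 6 * (4 * r) ^ (4 * j)) \<le> real r powr (12 * L) * real r powr (132 * L)"
    unfolding of_nat_mult using D6 r4 by (intro mult_mono) auto
  also have "\<dots> = real r powr (144 * L)" by (simp add: powr_add[symmetric])
  finally have 1: "real (D ^ 6 * (4 * r) ^ (4 * j)) \<le> real r powr (144 * L)" .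
  \<comment> \<open>Here 2 * 32^3 = 2^16, and below 396 = 3 * 132.\<close>
  have "real (2 * (32 * D ^ 2 * (4 * r) ^ (4 * j)) ^ 3) = 2 ^ 16 * (real (D ^ 6) * real ((4 * r) ^ (4 * j)) ^ 3)"
    by (simp add: power_mult_distrib)
  also have "\<dots> \<le> real r powr 16 * (real r powr (12 * L) * real r powr (396 * L))"
  proof (intro mult_mono D6)
    have "(2::real) ^ 16 \<le> real r ^ 16" using r by (intro power_mono) auto
    then show "(2::real) ^ 16 \<le> real r powr 16" using rp by (simp add: powr_numeral)
    have "real ((4 * r) ^ (4 * j)) ^ 3 \<le> (real r powr (132 * L)) ^ 3" using r4 by (intro power_mono) auto
    also have "\<dots> = real r powr (396 * L)" using rp by (simp add: powr_power)
    finally show "real ((4 * r) ^ (4 * j)) ^ 3 \<le> real r powr (396 * L)" .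
  qed auto
  also have "\<dots> = real r powr (16 + (12 * L + 396 * L))" by (simp only: powr_add)
  also have "\<dots> \<le> real r powr (400 * real D * L)"
  proof (rule powr_mono)
    have "400 * 3 * L \<le> 400 * real D * L" using D L1 by (intro mult_right_mono) auto
    then show "16 + (12 * L + 396 * L) \<le> 400 * real D * L" using L1 by linarith
  qed (use rp in simp)
  finally show ?thesis using 1 j(1) unfolding L_def by blast
qed

theorem theorem1p4:
  fixes r D n :: nat
    and H :: "'a sgraph"
    and \<sigma> :: "'a set \<Rightarrow> nat"
  assumes "r \<ge> 2"
    and "D \<ge> 2"
    and "finite_sgraph H"
    and "max_degree H = D"
    and "n = card (verts (subdivision H \<sigma>))"
    and "\<forall>e\<in>edges H. ereal (real (\<sigma> e)) \<ge> 2 * elog (real D - 1) (real n)"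
    and "bipartite (subdivision H \<sigma>)"
  shows "real (size_ramsey r (subdivision H \<sigma>)) \<le> real r powr (400 * real D * ln (real D)) * real n"
proof -
  note r = assms(1) and H = assms(3) and n = assms(5) and bip = assms(7)
  let ?F = "subdivision H \<sigma>"
  obtain e where e: "e \<in> edges H" using max_degree_pos_edge[of H] assms(2,4) by auto
  have n2: "n \<ge> 2" using subdivision_card_ge_2[OF H e] n by simp
  \<comment> \<open>For \<open>D = 2\<close> the base is 1, so \<open>elog\<close> is infinite
    because \<open>n \<ge> 2\<close>; the edge \<open>e\<close> has finite
    \<open>\<sigma> e\<close>.\<close>
  have "D \<noteq> 2"
  proof
    assume "D = 2"
    then have "ereal (real (\<sigma> e)) \<ge> 2 * elog 1 (real n)" using assms(6) e by fastforce
    then show False using n2 by (simp add: elog_base_1)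
  qed
  then have D: "D \<ge> 3" using assms(2) by simp
  have deg: "degree H v \<le> D" if "v \<in> verts H" for v using degree_le_max_degree[OF H that] assms(4) by simp
  let ?L = "ln (real D)"
  have L1: "?L \<ge> 1"
  proof -
    have "exp 1 \<le> real D" using exp_le D by linarith
    then show ?thesis using D by (simp add: ln_ge_iff)
  qed
  obtain j where j: "64 * D ^ 2 \<le> 2 ^ j" "real (D ^ 6 * (4 * r) ^ (4 * j)) \<le> real r powr (144 * ?L)"
    "real (2 * (32 * D ^ 2 * (4 * r) ^ (4 * j)) ^ 3) \<le> real r powr (400 * real D * ?L)"
    using power_constants[OF r D] by blast
  show ?thesis
  proof (cases "D ^ 6 * (4 * r) ^ (4 * j) \<le> n")
    case True
    have "size_ramsey r ?F \<le> 2 * (32 * D ^ 2 * (4 * r) ^ (4 * j)) ^ 3 * n"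
    proof (rule size_ramsey_long_subdivision_le[OF H deg D _ bip n _ j(1) True])
      show "n ^ 2 \<le> D ^ \<sigma> e" if "e \<in> edges H" for e
        using square_le_power_of_elog[OF D _ bspec[OF assms(6) that]] n2 by simp
    qed (use r n2 in auto)
    then have "real (size_ramsey r ?F) \<le> real (2 * (32 * D ^ 2 * (4 * r) ^ (4 * j)) ^ 3 * n)"
      by (simp only: of_nat_le_iff)
    also have "\<dots> = real (2 * (32 * D ^ 2 * (4 * r) ^ (4 * j)) ^ 3) * real n" by (rule of_nat_mult)
    also have "\<dots> \<le> real r powr (400 * real D * ?L) * real n" using j(3) by (intro mult_right_mono) auto
    finally show ?thesis .
  next
    case False
    then have "real n \<le> real (D ^ 6 * (4 * r) ^ (4 * j))" by (simp only: of_nat_le_iff)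
    then have nL: "real n \<le> real r powr (144 * ?L)" using j(2) by linarith
    have "card {a. {a, b} \<in> edges ?F} \<le> D" for b using subdivision_degree[OF H deg assms(2)] .
    then have "size_ramsey r ?F \<le> (2 * r ^ (2 * D) * n ^ 2) ^ 2"
      using finite_sgraph_subdivision[OF H] bip D r n n2 by (intro size_ramsey_bipartite_le) auto
    then have "real (size_ramsey r ?F) \<le> real ((2 * r ^ (2 * D) * n ^ 2) ^ 2)" by (simp only: of_nat_le_iff)
    also have "\<dots> = 2 ^ 2 * real r ^ (4 * D) * real n ^ 3 * real n"
      by (simp add: power_mult_distrib power_mult[symmetric] power3_eq_cube power4_eq_xxxx)
    also have "\<dots> \<le> real r powr (400 * real D * ?L) * real n"
    proof (rule mult_right_mono)
      \<comment> \<open>Three of the four factors \<open>n\<close> are absorbed, at 3 * 144 = 432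
        times ln D in the exponent; \<open>D \<ge> 3\<close> turns this into 144 D ln D.\<close>
      have "2 ^ 2 * real r ^ (4 * D) * real n ^ 3 \<le> real r ^ 2 * real r ^ (4 * D) * (real r powr (144 * ?L)) ^ 3"
        using r nL by (intro mult_mono power_mono) auto
      also have "\<dots> = real r powr 2 * real r powr real (4 * D) * real r powr (432 * ?L)"
      proof -
        have "(real r powr (144 * ?L)) ^ 3 = real r powr (432 * ?L)" using r by (simp add: powr_power)
        moreover have "real r powr 2 = real r ^ 2" using r by (simp add: powr_numeral)
        moreover have "real r powr real (4 * D) = real r ^ (4 * D)" using r by (intro powr_realpow) auto
        ultimately show ?thesis by presburger
      qed
      also have "\<dots> = real r powr (2 + real (4 * D) + 432 * ?L)" by (simp only: powr_add)
      also have "\<dots> \<le> real r powr (400 * real D * ?L)"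
      proof (rule powr_mono)
        have "4 * real D * 1 \<le> 4 * real D * ?L" using L1 by (intro mult_left_mono) auto
        moreover have "3 * ?L \<le> real D * ?L" using D L1 by (intro mult_right_mono) auto
        ultimately show "2 + real (4 * D) + 432 * ?L \<le> 400 * real D * ?L"
          using L1 unfolding of_nat_mult of_nat_numeral mult.assoc by linarith
      qed (use r in simp)
      finally show "2 ^ 2 * real r ^ (4 * D) * real n ^ 3 \<le> real r powr (400 * real D * ?L)" .
    qed simp
    finally show ?thesis .
  qed
qed

end
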